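(* Let $k$ be a field of arbitrary characteristic, $n\ge1$, and let $q\in k^\times$ be a primitive $m$-th root of unity with $m$ odd. Then the single parameter quantized coordinate ring of $n\times n$ matrices satisfies $$\operatorname{PIdeg}\mathcal O_q(M_n(k))=m^{\frac{n(n-1)}2}.$$
   Context: $\mathcal O_q(M_n(k))$ is the $k$-algebra $\mathcal O_{\lambda,\boldsymbol p}(M_n(k))$ with $\lambda=q^{-2}$ and $p_{ij}=q$ for $i>j$, $p_{ii}=1$, $p_{ij}=q^{-1}$ for $i<j$. Here $\mathcal O_{\lambda,\boldsymbol p}(M_n(k))$ has generators $x_{ij}$ ($1\le i,j\le n$) and relations: $x_{\ell m}x_{ij}=p_{\ell i}p_{jm}x_{ij}x_{\ell m}+(\lambda-1)p_{\ell i}x_{im}x_{\ell j}$ if $\ell>i$, $m>j$; $x_{\ell m}x_{ij}=\lambda p_{\ell i}p_{jm}x_{ij}x_{\ell m}$ if $\ell>i$, $m\le j$; $x_{\ell m}x_{ij}=p_{jm}x_{ij}x_{\ell m}$ if $\ell=i$, $m>j$ (in these relations $m$ is an index). $\operatorname{PIdeg}$ is the PI degree of a prime PI ring. *)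

theory Defs
  imports "HOL-Algebra.QuotRing" "HOL-Algebra.Module"
begin

section \<open>Free algebras\<close>

text \<open>
  The free associative unital algebra on the set \<open>S\<close> over a commutative ring \<open>'k\<close>: an element is the
  finitely supported function that maps a word in \<open>S\<close> to its coefficient, and
  the product is convolution with respect to concatenation.
\<close>

definition free_algebra :: "'x set \<Rightarrow> ('k::comm_ring_1, 'x list \<Rightarrow> 'k) module" where
  "free_algebra S =
    \<lparr> carrier = {f. finite {w. f w \<noteq> 0} \<and> (\<forall>w. f w \<noteq> 0 \<longrightarrow> set w \<subseteq> S)},
      mult = (\<lambda>f g w. \<Sum>i\<le>length w. f (take i w) * g (drop i w)),
      one = (\<lambda>w. if w = [] then 1 else 0),
      zero = (\<lambda>w. 0),
      add = (\<lambda>f g w. f w + g w),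
      smult = (\<lambda>c f w. c * f w) \<rparr>"

definition free_gen :: "'x \<Rightarrow> 'x list \<Rightarrow> 'k::comm_ring_1" where
  "free_gen x = (\<lambda>w. if w = [x] then 1 else 0)"

lemma free_algebra_carrier_iff:
  "f \<in> carrier (free_algebra S) \<longleftrightarrow> finite {w. f w \<noteq> 0} \<and> (\<forall>w. f w \<noteq> 0 \<longrightarrow> set w \<subseteq> S)"
  by (simp add: free_algebra_def)

lemma free_gen_closed:
  assumes "x \<in> S"
  shows "free_gen x \<in> carrier (free_algebra S)"
  using assms by (simp add: free_algebra_carrier_iff free_gen_def)

lemma smult_free_algebra_closed:
  assumes "f \<in> carrier (free_algebra S)"
  shows "c \<odot>\<^bsub>free_algebra S\<^esub> f \<in> carrier (free_algebra S)"
proof -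
  have "{w. c * f w \<noteq> 0} \<subseteq> {w. f w \<noteq> 0}" by auto
  then have "finite {w. c * f w \<noteq> 0}"
    using assms by (auto simp: free_algebra_carrier_iff intro: finite_subset)
  moreover have "\<forall>w. c * f w \<noteq> 0 \<longrightarrow> set w \<subseteq> S"
    using assms by (metis free_algebra_carrier_iff mult_zero_right)
  ultimately show ?thesis
    by (simp add: free_algebra_def)
qed

lemma free_algebra_add_closed:
  assumes f: "f \<in> carrier (free_algebra S)" and g: "g \<in> carrier (free_algebra S)"
  shows "f \<oplus>\<^bsub>free_algebra S\<^esub> g \<in> carrier (free_algebra S)"
proof -
  have "{w. f w + g w \<noteq> 0} \<subseteq> {w. f w \<noteq> 0} \<union> {w. g w \<noteq> 0}" by auto
  then have "finite {w. f w + g w \<noteq> 0}"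
    by (rule finite_subset) (use f g in \<open>simp add: free_algebra_carrier_iff\<close>)
  moreover have "\<forall>w. f w + g w \<noteq> 0 \<longrightarrow> set w \<subseteq> S"
    using f g by (metis free_algebra_carrier_iff add.right_neutral)
  ultimately show ?thesis
    by (simp add: free_algebra_def)
qed

lemma free_algebra_mult_closed:
  assumes f: "f \<in> carrier (free_algebra S)" and g: "g \<in> carrier (free_algebra S)"
  shows "f \<otimes>\<^bsub>free_algebra S\<^esub> g \<in> carrier (free_algebra S)"
proof -
  let ?T = "(\<lambda>(u, v). u @ v) ` ({w. f w \<noteq> 0} \<times> {w. g w \<noteq> 0})"
  have sub: "{w. (\<Sum>i\<le>length w. f (take i w) * g (drop i w)) \<noteq> 0} \<subseteq> ?T"
  proof
    fix w assume "w \<in> {w. (\<Sum>i\<le>length w. f (take i w) * g (drop i w)) \<noteq> 0}"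
    then obtain i where "f (take i w) * g (drop i w) \<noteq> 0"
      by (metis (mono_tags, lifting) mem_Collect_eq sum.neutral)
    then have "f (take i w) \<noteq> 0" "g (drop i w) \<noteq> 0"
      by (metis mult_zero_left, metis mult_zero_right)
    then show "w \<in> ?T"
      by (auto intro!: image_eqI[of _ _ "(take i w, drop i w)"])
  qed
  have "finite ?T" "\<forall>w\<in>?T. set w \<subseteq> S"
    using f g by (auto simp: free_algebra_carrier_iff)
  then have "finite {w. (\<Sum>i\<le>length w. f (take i w) * g (drop i w)) \<noteq> 0}"
    "\<forall>w. (\<Sum>i\<le>length w. f (take i w) * g (drop i w)) \<noteq> 0 \<longrightarrow> set w \<subseteq> S"
    using sub by (blast intro: finite_subset)+
  then show ?thesis
    by (simp add: free_algebra_def)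
qed

lemma free_algebra_mult_assoc:
  "(f \<otimes>\<^bsub>free_algebra S\<^esub> g) \<otimes>\<^bsub>free_algebra S\<^esub> h =
    f \<otimes>\<^bsub>free_algebra S\<^esub> (g \<otimes>\<^bsub>free_algebra S\<^esub> h)"
proof
  fix w :: "'a list"
  let ?n = "length w"
  let ?t = "\<lambda>j i. f (take j w) * g (drop j (take i w)) * h (drop i w)"
  have "((f \<otimes>\<^bsub>free_algebra S\<^esub> g) \<otimes>\<^bsub>free_algebra S\<^esub> h) w = (\<Sum>i\<le>?n. \<Sum>j\<le>i. ?t j i)"
    by (auto simp: free_algebra_def sum_distrib_right min_def intro!: sum.cong)
  also have "\<dots> = (\<Sum>(i,j)\<in>(SIGMA i:{..?n}. {..i}). ?t j i)"
    by (rule sum.Sigma) auto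
  also have "\<dots> = (\<Sum>(j,k)\<in>(SIGMA j:{..?n}. {..?n - j}). ?t j (j + k))"
    by (rule sum.reindex_bij_witness[where i = "\<lambda>(j,k). (j + k, j)" and j = "\<lambda>(i,j). (j, i - j)"]) auto
  also have "\<dots> = (\<Sum>j\<le>?n. \<Sum>k\<le>?n - j. ?t j (j + k))"
    by (rule sum.Sigma[symmetric]) auto
  also have "\<dots> = (f \<otimes>\<^bsub>free_algebra S\<^esub> (g \<otimes>\<^bsub>free_algebra S\<^esub> h)) w"
    by (auto simp: free_algebra_def sum_distrib_left take_drop mult.assoc add.commute intro!: sum.cong)
  finally show "((f \<otimes>\<^bsub>free_algebra S\<^esub> g) \<otimes>\<^bsub>free_algebra S\<^esub> h) w =
    (f \<otimes>\<^bsub>free_algebra S\<^esub> (g \<otimes>\<^bsub>free_algebra S\<^esub> h)) w" .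
qed

lemma ring_free_algebra:
  "ring (free_algebra S :: ('k::comm_ring_1, 'x list \<Rightarrow> 'k) module)"
proof (rule ringI)
  let ?F = "free_algebra S :: ('k, 'x list \<Rightarrow> 'k) module"
  show "abelian_group ?F"
  proof (rule abelian_groupI)
    show "f \<oplus>\<^bsub>?F\<^esub> g \<in> carrier ?F" if "f \<in> carrier ?F" "g \<in> carrier ?F" for f g
      using that by (rule free_algebra_add_closed)
    show "\<exists>g\<in>carrier ?F. g \<oplus>\<^bsub>?F\<^esub> f = \<zero>\<^bsub>?F\<^esub>" if "f \<in> carrier ?F" for f
      using that by (intro bexI[of _ "\<lambda>w. - f w"]) (simp_all add: free_algebra_def)
  qed (simp_all add: free_algebra_def ac_simps)
  show "monoid ?F"
  proof (rule monoidI)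
    show "f \<otimes>\<^bsub>?F\<^esub> g \<otimes>\<^bsub>?F\<^esub> h = f \<otimes>\<^bsub>?F\<^esub> (g \<otimes>\<^bsub>?F\<^esub> h)" for f g h
      by (rule free_algebra_mult_assoc)
    show "\<one>\<^bsub>?F\<^esub> \<in> carrier ?F"
      by (simp add: free_algebra_def)
    show "\<one>\<^bsub>?F\<^esub> \<otimes>\<^bsub>?F\<^esub> f = f" for f
    proof
      fix w
      have "(\<one>\<^bsub>?F\<^esub> \<otimes>\<^bsub>?F\<^esub> f) w = (\<Sum>i\<le>length w. if i = 0 then f w else 0)"
        unfolding free_algebra_def monoid.simps ring.simps by (intro sum.cong) auto
      then show "(\<one>\<^bsub>?F\<^esub> \<otimes>\<^bsub>?F\<^esub> f) w = f w" by simp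
    qed
    show "f \<otimes>\<^bsub>?F\<^esub> \<one>\<^bsub>?F\<^esub> = f" for f
    proof
      fix w
      have "(f \<otimes>\<^bsub>?F\<^esub> \<one>\<^bsub>?F\<^esub>) w = (\<Sum>i\<le>length w. if i = length w then f w else 0)"
        unfolding free_algebra_def monoid.simps ring.simps by (intro sum.cong) auto
      then show "(f \<otimes>\<^bsub>?F\<^esub> \<one>\<^bsub>?F\<^esub>) w = f w" by simp
    qed
  qed (rule free_algebra_mult_closed)
qed (simp_all add: free_algebra_def distrib_left distrib_right sum.distrib)


section \<open>Quantized coordinate rings of matrices\<close>

definition matrix_indices :: "nat \<Rightarrow> (nat \<times> nat) set" where
  "matrix_indices n = {1..n} \<times> {1..n}"

definition quantum_matrix_relators ::
    "nat \<Rightarrow> 'k::field \<Rightarrow> (nat \<Rightarrow> nat \<Rightarrow> 'k) \<Rightarrow> ((nat \<times> nat) list \<Rightarrow> 'k) set" where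
  "quantum_matrix_relators n lam p =
    (let F = free_algebra (matrix_indices n);
         x = (\<lambda>i j. free_gen (i, j))
     in {x l m \<otimes>\<^bsub>F\<^esub> x i j \<ominus>\<^bsub>F\<^esub>
           ((p l i * p j m) \<odot>\<^bsub>F\<^esub> (x i j \<otimes>\<^bsub>F\<^esub> x l m) \<oplus>\<^bsub>F\<^esub>
            ((lam - 1) * p l i) \<odot>\<^bsub>F\<^esub> (x i m \<otimes>\<^bsub>F\<^esub> x l j))
         | l m i j. {l, m, i, j} \<subseteq> {1..n} \<and> l > i \<and> m > j}
      \<union> {x l m \<otimes>\<^bsub>F\<^esub> x i j \<ominus>\<^bsub>F\<^esub> (lam * p l i * p j m) \<odot>\<^bsub>F\<^esub> (x i j \<otimes>\<^bsub>F\<^esub> x l m)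
         | l m i j. {l, m, i, j} \<subseteq> {1..n} \<and> l > i \<and> m \<le> j}
      \<union> {x l m \<otimes>\<^bsub>F\<^esub> x i j \<ominus>\<^bsub>F\<^esub> p j m \<odot>\<^bsub>F\<^esub> (x i j \<otimes>\<^bsub>F\<^esub> x l m)
         | l m i j. {l, m, i, j} \<subseteq> {1..n} \<and> l = i \<and> m > j})"

text \<open>
  In the free algebra the scalars are elements of the ring, so the two-sided ring ideal generated by
  the relators is also the algebra ideal generated by them.
\<close>

definition quantum_matrices ::
    "nat \<Rightarrow> 'k::field \<Rightarrow> (nat \<Rightarrow> nat \<Rightarrow> 'k) \<Rightarrow> ((nat \<times> nat) list \<Rightarrow> 'k) set ring" where
  "quantum_matrices n lam p =
    (let F = free_algebra (matrix_indices n)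
     in F Quot (genideal F (quantum_matrix_relators n lam p)))"

definition single_parameter_quantum_matrices ::
    "nat \<Rightarrow> 'k::field \<Rightarrow> ((nat \<times> nat) list \<Rightarrow> 'k) set ring" where
  "single_parameter_quantum_matrices n q =
    quantum_matrices n (inverse (q ^ 2))
      (\<lambda>i j. if i > j then q else if i = j then 1 else inverse q)"

definition primitive_root_of_unity :: "nat \<Rightarrow> 'k::field \<Rightarrow> bool" where
  "primitive_root_of_unity m q \<longleftrightarrow> m > 0 \<and> q ^ m = 1 \<and> (\<forall>j. 0 < j \<and> j < m \<longrightarrow> q ^ j \<noteq> 1)"


section \<open>Prime rings and polynomial identities\<close>

definition prime_ring :: "('a, 'b) ring_scheme \<Rightarrow> bool" where
  "prime_ring R \<longleftrightarrow> ring R \<and> \<one>\<^bsub>R\<^esub> \<noteq> \<zero>\<^bsub>R\<^esub> \<and>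
    (\<forall>a\<in>carrier R. \<forall>b\<in>carrier R.
      (\<forall>r\<in>carrier R. a \<otimes>\<^bsub>R\<^esub> r \<otimes>\<^bsub>R\<^esub> b = \<zero>\<^bsub>R\<^esub>) \<longrightarrow> a = \<zero>\<^bsub>R\<^esub> \<or> b = \<zero>\<^bsub>R\<^esub>)"

text \<open>
  Noncommutative polynomials with integer coefficients in the variables \<open>X\<^sub>0, X\<^sub>1, \<dots>\<close>
  are the elements of the free algebra on \<open>UNIV :: nat set\<close> over the integers.
\<close>

definition nc_degree :: "(nat list \<Rightarrow> int) \<Rightarrow> nat" where
  "nc_degree f = Max (length ` {w. f w \<noteq> 0})"

text \<open>Monic means that some monomial of highest degree has coefficient 1.\<close>

definition nc_monic :: "(nat list \<Rightarrow> int) \<Rightarrow> bool" where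
  "nc_monic f \<longleftrightarrow> (\<exists>w. f w = 1 \<and> length w = nc_degree f)"

definition nc_eval :: "('a, 'b) ring_scheme \<Rightarrow> (nat \<Rightarrow> 'a) \<Rightarrow> (nat list \<Rightarrow> int) \<Rightarrow> 'a" where
  "nc_eval R r f =
    (\<Oplus>\<^bsub>R\<^esub>w\<in>{w. f w \<noteq> 0}. [f w] \<cdot>\<^bsub>R\<^esub> foldr (\<lambda>i a. r i \<otimes>\<^bsub>R\<^esub> a) w \<one>\<^bsub>R\<^esub>)"

definition monic_polynomial_identity :: "('a, 'b) ring_scheme \<Rightarrow> (nat list \<Rightarrow> int) \<Rightarrow> bool" where
  "monic_polynomial_identity R f \<longleftrightarrow>
    f \<in> carrier (free_algebra UNIV) \<and> nc_monic f \<and>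
    (\<forall>r\<in>UNIV \<rightarrow> carrier R. nc_eval R r f = \<zero>\<^bsub>R\<^esub>)"

definition PI_ring :: "('a, 'b) ring_scheme \<Rightarrow> bool" where
  "PI_ring R \<longleftrightarrow> ring R \<and> (\<exists>f. monic_polynomial_identity R f)"

definition PI_minimal_degree :: "('a, 'b) ring_scheme \<Rightarrow> nat" where
  "PI_minimal_degree R = (LEAST d. \<exists>f. monic_polynomial_identity R f \<and> nc_degree f = d)"

text \<open>
  The PI degree of a prime PI ring is half its minimal degree, which is even by Posner's theorem;
  it is only meaningful for prime PI rings.
\<close>

definition PI_degree :: "('a, 'b) ring_scheme \<Rightarrow> nat" where
  "PI_degree R = (THE d. PI_minimal_degree R = 2 * d)"

end

theory Submission
  imports Defs
    "HOL-Library.Poly_Mapping"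
    "HOL-Library.Product_Lexorder"
    "HOL-Combinatorics.Multiset_Permutations"
    "HOL-Computational_Algebra.Formal_Power_Series"
    "Jordan_Normal_Form.Determinant"
begin

text \<open>
  The single parameter quantum matrices embed into a quantum torus with generators \<open>t\<^sub>i\<^sub>j\<close>:
  one row at a time, with \<open>b = (t\<^sub>r\<^sub>1, \<dots>, t\<^sub>r\<^sub>n)\<close> the new row, the entries \<open>x\<^sub>i\<^sub>j\<close> above it are replaced by
  \<open>\<Sum>s\<ge>j. x\<^sub>i\<^sub>s b\<^sub>s\<^sup>-\<^sup>1 b\<^sub>j\<close>, so that \<open>x\<^sub>i\<^sub>j\<close> has leading term \<open>t\<^sub>i\<^sub>j\<close>. Leading terms and
  straightening show that this is an embedding and that the algebra is a domain.
  The torus is represented by weighted shifts of functions on a lattice whose coordinates are the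
  positions \<open>1 \<le> d \<le> r < n\<close>, with coefficients in a Laurent polynomial ring. As \<open>q\<close> has order \<open>m\<close>, functions
  that are \<open>m\<close>-periodic in every coordinate form an invariant free module of rank \<open>N = m ^ (n (n - 1) / 2)\<close>. Hence the
  Amitsur--Levitzki theorem gives the standard identity of degree \<open>2 N\<close>. Conversely, an identity of
  the algebra is polarized and passes to the leading terms, which for odd \<open>m\<close> generate all matrix
  units on periodic functions, and so its degree is at least \<open>2 N\<close>.
\<close>

section \<open>Linear operators on function spaces\<close>

text \<open>Periodic functions turn operators into N x N matrices over a commutative ring, but an
  element of the algebra is not determined a priori by its action on them. The formal Laurent
  variables close this gap: they record degrees, so every nonzero element has an invertible leading
  part and cannot kill the constant function 1, which is periodic. One test function thus carries
  the standard identity over to the whole algebra. The minimal degree is computed from both sides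
  for the algebra itself, so neither its centre nor a ring of fractions nor Posner's theorem enters.
  Arbitrary characteristic shapes several steps. Amitsur-Levitzki is proved over the rationals,
  where the traces argument may divide, and is transferred through integral matrix units.
  Polarization substitutes sums only and preserves the coefficient 1 of a monic word. Averaging over
  powers of an operator is possible because a primitive m-th root of unity forces m to be nonzero in
  the field. Oddness of m enters once: the available words multiply by q to twice a coordinate, and
  2 has to be inverted modulo m.\<close>

typedef (overloaded) ('i, 'c) lop =
  "{Y :: ('i \<Rightarrow> 'c::comm_ring_1) \<Rightarrow> 'i \<Rightarrow> 'c.
     \<forall>F G c. Y (\<lambda>a. F a + c * G a) = (\<lambda>a. Y F a + c * Y G a)}"
  morphisms app Lop
  by (rule exI[of _ "\<lambda>F. F"]) simp

setup_lifting type_definition_lop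

lemma app_linear: "app Y (\<lambda>a. F a + c * G a) = (\<lambda>a. app Y F a + c * app Y G a)"
  using app[of Y] by blast

lemma app_add: "app Y (\<lambda>a. F a + G a) = (\<lambda>a. app Y F a + app Y G a)"
  using app_linear[of Y F 1 G] by simp

lemma app_zero [simp]: "app Y (\<lambda>a. 0) = (\<lambda>a. 0)"
  using app_add[of Y "\<lambda>a. 0" "\<lambda>a. 0"] by (auto simp: fun_eq_iff)

lemma app_smult: "app Y (\<lambda>a. c * G a) = (\<lambda>a. c * app Y G a)"
  using app_linear[of Y "\<lambda>a. 0" c G] by simp

lemma app_sum: "app Y (\<lambda>a. \<Sum>x\<in>A. F x a) = (\<lambda>a. \<Sum>x\<in>A. app Y (F x) a)"
  by (induction A rule: infinite_finite_induct) (simp_all add: app_add)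

instantiation lop :: (type, comm_ring_1) ring_1
begin

lift_definition zero_lop :: "('a, 'b) lop" is "\<lambda>F a. 0" by simp
lift_definition one_lop :: "('a, 'b) lop" is "\<lambda>F. F" by simp
lift_definition plus_lop :: "('a, 'b) lop \<Rightarrow> ('a, 'b) lop \<Rightarrow> ('a, 'b) lop"
  is "\<lambda>Y Z F a. Y F a + Z F a" by (simp add: algebra_simps)
lift_definition minus_lop :: "('a, 'b) lop \<Rightarrow> ('a, 'b) lop \<Rightarrow> ('a, 'b) lop"
  is "\<lambda>Y Z F a. Y F a - Z F a" by (simp add: algebra_simps)
lift_definition uminus_lop :: "('a, 'b) lop \<Rightarrow> ('a, 'b) lop"
  is "\<lambda>Y F a. - Y F a" by (simp add: algebra_simps)
lift_definition times_lop :: "('a, 'b) lop \<Rightarrow> ('a, 'b) lop \<Rightarrow> ('a, 'b) lop"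
  is "\<lambda>Y Z F. Y (Z F)" by simp

lemma app_ring_simps [simp]:
  "app 0 F = (\<lambda>a. 0)" "app 1 F = F"
  "app (Y + Z) F = (\<lambda>a. app Y F a + app Z F a)"
  "app (Y - Z) F = (\<lambda>a. app Y F a - app Z F a)"
  "app (- Y) F = (\<lambda>a. - app Y F a)"
  "app (Y * Z) F = app Y (app Z F)"
  by (simp_all add: zero_lop.rep_eq one_lop.rep_eq plus_lop.rep_eq minus_lop.rep_eq
      uminus_lop.rep_eq times_lop.rep_eq)

lemma lop_eqI: "(\<And>F a. app Y F a = app Z F a) \<Longrightarrow> Y = Z"
  by (metis app_inject ext)

instance
proof
  have "app (0 :: ('a, 'b) lop) (\<lambda>a. 1) undefined \<noteq> app 1 (\<lambda>a. 1) undefined" by simp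
  then show "0 \<noteq> (1 :: ('a, 'b) lop)" by force
qed (auto intro!: lop_eqI simp: app_add algebra_simps)

end

lemma app_sum_lop: "app (\<Sum>x\<in>A. Y x) F a = (\<Sum>x\<in>A. app (Y x) F a)"
  by (induction A rule: infinite_finite_induct) simp_all

lemma app_of_int: "app (of_int k :: ('i, 'c::comm_ring_1) lop) F = (\<lambda>a. of_int k * F a)"
proof -
  have n: "app (of_nat k :: ('i, 'c) lop) F = (\<lambda>a. of_nat k * F a)" for k
    by (induction k) (simp_all add: algebra_simps)
  show ?thesis
  proof (cases "k \<ge> 0")
    case True
    then show ?thesis using n[of "nat k"] by simp
  next
    case False
    then have "of_int k = - (of_nat (nat (- k)) :: ('i, 'c) lop)" "of_int k = - (of_nat (nat (- k)) :: 'c)"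
      by simp_all
    then show ?thesis using n[of "nat (- k)"] by simp
  qed
qed

lift_definition scl :: "'c::comm_ring_1 \<Rightarrow> ('i, 'c) lop \<Rightarrow> ('i, 'c) lop"
  is "\<lambda>c Y F a. c * Y F a" by (simp add: algebra_simps)

lemma app_scl [simp]: "app (scl c Y) F = (\<lambda>a. c * app Y F a)"
  by (simp add: scl.rep_eq)

lemma scl_simps:
  "scl c Y * Z = scl c (Y * Z)"
  "Y * scl c Z = scl c (Y * Z)"
  "scl c (Y + Z) = scl c Y + scl c Z"
  "scl c (Y - Z) = scl c Y - scl c Z"
  "scl c (- Y) = - scl c Y"
  "scl c (scl d Y) = scl (c * d) Y"
  "scl c 0 = 0"
  by (auto intro!: lop_eqI simp: algebra_simps app_smult)

lemma scl_coeff_simps: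
  "scl 1 Y = Y" "scl 0 Y = 0"
  "scl (c + d) Y = scl c Y + scl d Y"
  "scl (c - d) Y = scl c Y - scl d Y"
  "scl (- c) Y = - scl c Y"
  by (auto intro!: lop_eqI simp: algebra_simps)

lemma scl_sum: "scl c (\<Sum>x\<in>A. Y x) = (\<Sum>x\<in>A. scl c (Y x))"
  by (induction A rule: infinite_finite_induct) (simp_all add: scl_simps)

lemma scl_sum_left: "scl (\<Sum>x\<in>A. c x) Y = (\<Sum>x\<in>A. scl (c x) Y)"
  by (induction A rule: infinite_finite_induct) (simp_all add: scl_coeff_simps)

section \<open>Adding a row to a quantum matrix\<close>

locale unit_scalar =
  fixes q qi :: "'c::comm_ring_1"
  assumes q_qi: "q * qi = 1"
begin

lemma qi_q: "qi * q = 1" using q_qi by (simp add: mult.commute)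

text \<open>The relations of rectangular r x n quantum matrices, each listed for one order of the
  two entries. The rectangular shape is what an induction over rows needs.\<close>

definition qmat :: "nat \<Rightarrow> nat \<Rightarrow> (nat \<Rightarrow> nat \<Rightarrow> ('i, 'c) lop) \<Rightarrow> bool" where
  "qmat r n X \<longleftrightarrow>
    (\<forall>i\<in>{1..r}. \<forall>j\<in>{1..n}. \<forall>l\<in>{1..n}. j < l \<longrightarrow> X i j * X i l = scl q (X i l * X i j)) \<and>
    (\<forall>i\<in>{1..r}. \<forall>k\<in>{1..r}. \<forall>j\<in>{1..n}. i < k \<longrightarrow> X i j * X k j = scl q (X k j * X i j)) \<and>
    (\<forall>i\<in>{1..r}. \<forall>k\<in>{1..r}. \<forall>j\<in>{1..n}. \<forall>l\<in>{1..n}. i < k \<and> l < j \<longrightarrow>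
       X i j * X k l = X k l * X i j) \<and>
    (\<forall>i\<in>{1..r}. \<forall>k\<in>{1..r}. \<forall>j\<in>{1..n}. \<forall>l\<in>{1..n}. i < k \<and> j < l \<longrightarrow>
       X i j * X k l = X k l * X i j + scl (q - qi) (X i l * X k j))"

lemma qmatD:
  assumes "qmat r n X" "i \<in> {1..r}" "j \<in> {1..n}"
  shows "\<lbrakk>l \<in> {1..n}; j < l\<rbrakk> \<Longrightarrow> X i j * X i l = scl q (X i l * X i j)"
    and "\<lbrakk>k \<in> {1..r}; i < k\<rbrakk> \<Longrightarrow> X i j * X k j = scl q (X k j * X i j)"
    and "\<lbrakk>k \<in> {1..r}; l \<in> {1..n}; i < k; l < j\<rbrakk> \<Longrightarrow> X i j * X k l = X k l * X i j"
    and "\<lbrakk>k \<in> {1..r}; l \<in> {1..n}; i < k; j < l\<rbrakk> \<Longrightarrow>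
      X i j * X k l = X k l * X i j + scl (q - qi) (X i l * X k j)"
proof -
  note h = assms(1)[unfolded qmat_def]
  note h1 = conjunct1[OF h, rule_format] and h2 = conjunct1[OF conjunct2[OF h], rule_format]
    and h3 = conjunct1[OF conjunct2[OF conjunct2[OF h]], rule_format, OF _ _ _ _ conjI]
    and h4 = conjunct2[OF conjunct2[OF conjunct2[OF h]], rule_format, OF _ _ _ _ conjI]
  show "\<lbrakk>l \<in> {1..n}; j < l\<rbrakk> \<Longrightarrow> X i j * X i l = scl q (X i l * X i j)"
    by (rule h1[OF assms(2,3)])
  show "\<lbrakk>k \<in> {1..r}; i < k\<rbrakk> \<Longrightarrow> X i j * X k j = scl q (X k j * X i j)"
    by (rule h2[OF assms(2) _ assms(3)])
  show "\<lbrakk>k \<in> {1..r}; l \<in> {1..n}; i < k; l < j\<rbrakk> \<Longrightarrow> X i j * X k l = X k l * X i j"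
    by (rule h3[OF assms(2) _ assms(3)])
  show "\<lbrakk>k \<in> {1..r}; l \<in> {1..n}; i < k; j < l\<rbrakk> \<Longrightarrow>
      X i j * X k l = X k l * X i j + scl (q - qi) (X i l * X k j)"
    by (rule h4[OF assms(2) _ assms(3)])
qed

lemma scl_inverse_iff: "Y = scl q Z \<longleftrightarrow> Z = scl qi Y"
  by (auto simp: scl_simps scl_coeff_simps q_qi qi_q)

end

text \<open>The new row \<open>b\<close> meets \<open>X\<close> in the way torus variables do:
  unlike in a quantum matrix, \<open>X i j * b l\<close> has no correction term for
  \<open>j < l\<close>. The modified matrix \<open>X'\<close> has to create that term.\<close>

locale row_extension = unit_scalar q qi for q qi :: "'c::comm_ring_1" +
  fixes r n :: nat and X :: "nat \<Rightarrow> nat \<Rightarrow> ('i, 'c) lop" and b c :: "nat \<Rightarrow> ('i, 'c) lop"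
  assumes X: "qmat r n X"
    and bc: "\<And>j. j \<in> {1..n} \<Longrightarrow> b j * c j = 1" "\<And>j. j \<in> {1..n} \<Longrightarrow> c j * b j = 1"
    and bb: "\<And>j l. j \<in> {1..n} \<Longrightarrow> l \<in> {1..n} \<Longrightarrow> j < l \<Longrightarrow> b j * b l = scl q (b l * b j)"
    and Xb_col: "\<And>i j. i \<in> {1..r} \<Longrightarrow> j \<in> {1..n} \<Longrightarrow> X i j * b j = scl q (b j * X i j)"
    and Xb: "\<And>i j l. i \<in> {1..r} \<Longrightarrow> j \<in> {1..n} \<Longrightarrow> l \<in> {1..n} \<Longrightarrow> j \<noteq> l \<Longrightarrow>
        X i j * b l = b l * X i j"
begin

section \<open>Commutation rules for the inverses of the new row\<close>

lemma bc_cancel: 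
  "j \<in> {1..n} \<Longrightarrow> b j * (c j * Y) = Y" "j \<in> {1..n} \<Longrightarrow> c j * (b j * Y) = Y"
  "j \<in> {1..n} \<Longrightarrow> Y * b j * c j = Y" "j \<in> {1..n} \<Longrightarrow> Y * c j * b j = Y"
  using bc by (simp_all flip: mult.assoc) (simp_all add: mult.assoc)

lemma swap_c:
  assumes j: "j \<in> {1..n}" and Y: "Y * b j = scl s (b j * Y)"
  shows "c j * Y = scl s (Y * c j)"
proof -
  have "c j * Y = c j * (Y * b j) * c j" using j by (simp add: bc_cancel flip: mult.assoc)
  also have "\<dots> = scl s (Y * c j)" using j by (simp add: Y scl_simps bc_cancel mult.assoc)
  finally show ?thesis .
qed

lemma cX_col: "i \<in> {1..r} \<Longrightarrow> j \<in> {1..n} \<Longrightarrow> c j * X i j = scl q (X i j * c j)"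
  by (intro swap_c Xb_col)

lemma cX: "i \<in> {1..r} \<Longrightarrow> j \<in> {1..n} \<Longrightarrow> l \<in> {1..n} \<Longrightarrow> j \<noteq> l \<Longrightarrow> c l * X i j = X i j * c l"
  using swap_c[of l "X i j" 1] Xb by (simp add: scl_coeff_simps)

lemma cb_lt: "j \<in> {1..n} \<Longrightarrow> l \<in> {1..n} \<Longrightarrow> j < l \<Longrightarrow> c l * b j = scl q (b j * c l)"
  by (intro swap_c bb)

lemma cb_gt: "j \<in> {1..n} \<Longrightarrow> l \<in> {1..n} \<Longrightarrow> l < j \<Longrightarrow> c l * b j = scl qi (b j * c l)"
  using swap_c[of l "b j" qi] bb[of l j] scl_inverse_iff[of "b l * b j" "b j * b l"] by simp

lemma cc: "j \<in> {1..n} \<Longrightarrow> l \<in> {1..n} \<Longrightarrow> j < l \<Longrightarrow> c j * c l = scl q (c l * c j)"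
  using swap_c[of j "c l" q] cb_lt[of j l] by simp

text \<open>Passing \<open>b j\<close> costs \<open>U i s\<close> the factor q for
  \<open>j \<le> s\<close> and its inverse for \<open>s < j\<close>. Hence the tail
  \<open>S i l\<close> and the middle piece \<open>D i j l\<close> both q-commute with
  \<open>b l\<close>, with opposite exponents, and the split \<open>S i j = D i j l + S i l\<close>
  drives the relations of \<open>X'\<close> between different columns.\<close>

definition U :: "nat \<Rightarrow> nat \<Rightarrow> ('i, 'c) lop" where "U i s = X i s * c s"
definition S :: "nat \<Rightarrow> nat \<Rightarrow> ('i, 'c) lop" where "S i j = (\<Sum>s\<in>{j..n}. U i s)"
definition D :: "nat \<Rightarrow> nat \<Rightarrow> nat \<Rightarrow> ('i, 'c) lop" where "D i j l = (\<Sum>s\<in>{j..<l}. U i s)"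
definition X' :: "nat \<Rightarrow> nat \<Rightarrow> ('i, 'c) lop" where
  "X' i j = (if i \<le> r then S i j * b j else b j)"

lemma S_split: "j \<le> l \<Longrightarrow> l \<le> n \<Longrightarrow> S i j = D i j l + S i l"
  unfolding S_def D_def
  by (subst sum.union_disjoint[symmetric]) (auto intro!: sum.cong)

lemma Ub_ge: "i \<in> {1..r} \<Longrightarrow> j \<in> {1..n} \<Longrightarrow> s \<in> {1..n} \<Longrightarrow> j \<le> s \<Longrightarrow> U i s * b j = scl q (b j * U i s)"
proof (cases "j = s")
  case True
  assume a: "i \<in> {1..r}" "j \<in> {1..n}" "s \<in> {1..n}"
  then have "b s * X i s = scl qi (X i s * b s)"
    using Xb_col[of i s] scl_inverse_iff by blast
  then have "b s * U i s = scl qi (X i s)"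
    using a by (simp add: U_def bc_cancel scl_simps flip: mult.assoc)
  then show ?thesis
    using a True by (simp add: U_def bc_cancel scl_simps q_qi scl_coeff_simps)
next
  case False
  assume a: "i \<in> {1..r}" "j \<in> {1..n}" "s \<in> {1..n}" "j \<le> s"
  then show ?thesis using False
    by (simp add: U_def mult.assoc cb_lt scl_simps) (simp add: Xb flip: mult.assoc)
qed

lemma Ub_lt: "i \<in> {1..r} \<Longrightarrow> j \<in> {1..n} \<Longrightarrow> s \<in> {1..n} \<Longrightarrow> s < j \<Longrightarrow> U i s * b j = scl qi (b j * U i s)"
  by (simp add: U_def mult.assoc cb_gt scl_simps) (simp add: Xb flip: mult.assoc)

lemma UU:
  assumes "i \<in> {1..r}" "k \<in> {1..r}" "s \<in> {1..n}" "t \<in> {1..n}" "s \<noteq> t"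
  shows "U i s * U k t = X i s * X k t * (c s * c t)"
  using assms by (simp add: U_def mult.assoc) (simp add: cX flip: mult.assoc)

lemma UU_row:
  assumes "i \<in> {1..r}" "s \<in> {1..n}" "t \<in> {1..n}" "s < t"
  shows "U i s * U i t = scl (q * q) (U i t * U i s)"
proof -
  have "X i s * X i t = scl q (X i t * X i s)" using assms by (intro qmatD[OF X])
  then show ?thesis
    using UU[of i i s t] UU[of i i t s] cc[of s t] assms by (simp add: scl_simps)
qed

lemma UU_col:
  assumes "i \<in> {1..r}" "k \<in> {1..r}" "s \<in> {1..n}" "i < k"
  shows "U i s * U k s = scl q (U k s * U i s)"
proof -
  have X: "X i s * X k s = scl q (X k s * X i s)" using assms by (intro qmatD[OF X])
  have "U i s * U k s = X i s * (c s * X k s) * c s" by (simp add: U_def mult.assoc)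
  also have "\<dots> = scl q (X i s * X k s * c s * c s)" using assms by (simp add: cX_col scl_simps mult.assoc)
  also have "\<dots> = scl q (X k s * scl q (X i s * c s) * c s)" unfolding X by (simp add: scl_simps mult.assoc)
  also have "scl q (X i s * c s) = c s * X i s" using assms by (simp add: cX_col)
  finally show ?thesis by (simp add: U_def mult.assoc)
qed

lemma UU_anti:
  assumes "i \<in> {1..r}" "k \<in> {1..r}" "s \<in> {1..n}" "t \<in> {1..n}" "s < t" "i < k"
  shows "U k s * U i t = scl q (U i t * U k s)"
proof -
  have "X i t * X k s = X k s * X i t" using assms by (intro qmatD[OF X])
  then show ?thesis
    using UU[of k i s t] UU[of i k t s] cc[of s t] assms by (simp add: scl_simps)
qed

lemma UU_diag:
  assumes "i \<in> {1..r}" "k \<in> {1..r}" "s \<in> {1..n}" "t \<in> {1..n}" "s < t" "i < k"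
  shows "U i s * U k t = scl q (U k t * U i s) + scl (q * q - 1) (U i t * U k s)"
proof -
  have X: "X i s * X k t = X k t * X i s + scl (q - qi) (X i t * X k s)"
    using assms by (intro qmatD[OF X])
  show ?thesis
    using UU[of i k s t] UU[of k i t s] UU[of i k t s] X cc[of s t] assms
    by (simp add: scl_simps distrib_right right_diff_distrib q_qi)
qed

lemma Sb: "i \<in> {1..r} \<Longrightarrow> l \<in> {1..n} \<Longrightarrow> l \<le> j \<Longrightarrow> S i j * b l = scl q (b l * S i j)"
  unfolding S_def sum_distrib_right sum_distrib_left scl_sum
  by (intro sum.cong Ub_ge) auto

lemma Db: "i \<in> {1..r} \<Longrightarrow> 1 \<le> j \<Longrightarrow> l \<in> {1..n} \<Longrightarrow> D i j l * b l = scl qi (b l * D i j l)"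
  unfolding D_def sum_distrib_right sum_distrib_left scl_sum
  by (intro sum.cong Ub_lt) auto

lemma bS: "i \<in> {1..r} \<Longrightarrow> l \<in> {1..n} \<Longrightarrow> l \<le> j \<Longrightarrow> b l * S i j = scl qi (S i j * b l)"
  using Sb[of i l j] by (simp add: scl_inverse_iff)

lemma bD: "i \<in> {1..r} \<Longrightarrow> 1 \<le> j \<Longrightarrow> l \<in> {1..n} \<Longrightarrow> b l * D i j l = scl q (D i j l * b l)"
  using Db[of i j l] by (simp add: scl_inverse_iff)

lemma DS_row: "i \<in> {1..r} \<Longrightarrow> 1 \<le> j \<Longrightarrow> l \<in> {1..n} \<Longrightarrow> D i j l * S i l = scl (q * q) (S i l * D i j l)"
  unfolding D_def S_def sum_product scl_sum
  by (subst (2) sum.swap) (intro sum.cong UU_row, auto)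

lemma DS_anti: "i \<in> {1..r} \<Longrightarrow> k \<in> {1..r} \<Longrightarrow> i < k \<Longrightarrow> 1 \<le> l \<Longrightarrow> j \<in> {1..n} \<Longrightarrow>
    D k l j * S i j = scl q (S i j * D k l j)"
  unfolding D_def S_def sum_product scl_sum
  by (subst (2) sum.swap) (intro sum.cong UU_anti, auto)

lemma DS_diag: "i \<in> {1..r} \<Longrightarrow> k \<in> {1..r} \<Longrightarrow> i < k \<Longrightarrow> 1 \<le> j \<Longrightarrow> l \<in> {1..n} \<Longrightarrow>
    D i j l * S k l = scl q (S k l * D i j l) + scl (q * q - 1) (S i l * D k j l)"
  unfolding D_def S_def sum_product scl_sum
  by (subst (2 3) sum.swap) (unfold sum.distrib[symmetric], intro sum.cong UU_diag, auto)

text \<open>Induction on the length of the tail. The cross terms close up: the extra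
  \<open>(q * q - 1)\<close> part of the diagonal relation and the summand
  \<open>S i (Suc j) * U k j\<close> add to \<open>q * q\<close> times the latter, which is q times
  \<open>U k j * S i (Suc j)\<close>.\<close>

lemma SS_col: "i \<in> {1..r} \<Longrightarrow> k \<in> {1..r} \<Longrightarrow> i < k \<Longrightarrow> 1 \<le> j \<Longrightarrow> S i j * S k j = scl q (S k j * S i j)"
proof (induction "Suc n - j" arbitrary: j)
  case 0
  then show ?case by (simp add: S_def scl_simps)
next
  case (Suc x)
  show ?case
  proof (cases "j = n")
    case True
    then show ?thesis using Suc.prems UU_col[of i k n] by (simp add: S_def)
  next
    case False
    then have jn: "j < n" "Suc j \<in> {1..n}" using Suc by auto
    have e: "S i j = U i j + S i (Suc j)" for i
      using jn S_split[of j "Suc j" i] by (simp add: D_def)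
    have IH: "S i (Suc j) * S k (Suc j) = scl q (S k (Suc j) * S i (Suc j))"
      using Suc jn by auto
    have a: "U k j * S i (Suc j) = scl q (S i (Suc j) * U k j)"
      using DS_anti[of i k j "Suc j"] Suc.prems jn by (simp add: D_def)
    have d: "U i j * S k (Suc j) = scl q (S k (Suc j) * U i j) + scl (q * q - 1) (S i (Suc j) * U k j)"
      using DS_diag[of i k j "Suc j"] Suc.prems jn by (simp add: D_def)
    show ?thesis using Suc.prems jn UU_col[of i k j]
      by (simp add: e distrib_left distrib_right IH a d scl_simps scl_coeff_simps)
  qed
qed

section \<open>The quantum matrix relations for the extended matrix\<close>

lemma X'_last_diag:
  assumes "i \<in> {1..r}" "j \<in> {1..n}" "l \<in> {1..n}" "j < l"
  shows "S i j * b j * b l = b l * (S i j * b j) + scl (q - qi) (S i l * b l * b j)"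
proof -
  \<comment> \<open>Reordering \<open>b j * b l\<close> gives q on both pieces. Moving
    \<open>b l\<close> to the right past \<open>D i j l\<close> gives q as well, but past the tail
    \<open>S i l\<close> it gives \<open>qi\<close>; the mismatch \<open>q - qi\<close> is the
    correction term.\<close>
  have S: "S i j = D i j l + S i l" using assms by (intro S_split) auto
  have "S i j * b j * b l = scl q (S i j * b l * b j)"
    using assms by (simp add: mult.assoc bb scl_simps)
  also have "\<dots> = scl q (S i l * b l * b j) + scl q (D i j l * b l * b j)"
    by (simp add: S distrib_right scl_simps)
  finally have 1: "S i j * b j * b l = scl q (S i l * b l * b j) + scl q (D i j l * b l * b j)" .
  have "b l * (S i j * b j) = (b l * S i l) * b j + (b l * D i j l) * b j"
    by (simp add: S distrib_right distrib_left mult.assoc)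
  also have "\<dots> = scl qi (S i l * b l * b j) + scl q (D i j l * b l * b j)"
    using assms by (simp add: bS bD scl_simps)
  finally show ?thesis unfolding 1 by (simp add: scl_coeff_simps)
qed

lemma X'_row:
  assumes "i \<in> {1..r}" "j \<in> {1..n}" "l \<in> {1..n}" "j < l"
  shows "S i j * b j * (S i l * b l) = scl q (S i l * b l * (S i j * b j))"
proof -
  have S: "S i j = D i j l + S i l" using assms by (intro S_split) auto
  have "S i j * b j * (S i l * b l) = S i j * (b j * S i l) * b l" by (simp add: mult.assoc)
  also have "\<dots> = S i j * S i l * b l * b j"
    using assms by (simp add: bS bb scl_simps mult.assoc qi_q scl_coeff_simps)
  also have "\<dots> = S i l * S i l * b l * b j + scl (q * q) (S i l * D i j l * b l * b j)"
    using assms by (simp add: S distrib_right DS_row scl_simps)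
  finally have 1: "S i j * b j * (S i l * b l) =
    S i l * S i l * b l * b j + scl (q * q) (S i l * D i j l * b l * b j)" .
  have "S i l * b l * (S i j * b j) = S i l * (b l * S i l + b l * D i j l) * b j"
    by (simp add: S distrib_right distrib_left mult.assoc)
  also have "\<dots> = scl qi (S i l * S i l * b l * b j) + scl q (S i l * D i j l * b l * b j)"
    using assms by (simp add: bS bD scl_simps distrib_right distrib_left mult.assoc)
  finally show ?thesis unfolding 1 by (simp add: scl_simps scl_coeff_simps q_qi)
qed

lemma X'_col:
  assumes "i \<in> {1..r}" "k \<in> {1..r}" "i < k" "j \<in> {1..n}"
  shows "S i j * b j * (S k j * b j) = scl q (S k j * b j * (S i j * b j))"
proof -
  have *: "S i j * b j * (S k j * b j) = scl qi (S i j * S k j * b j * b j)"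
    if "k \<in> {1..r}" for i k
  proof -
    have "S i j * b j * (S k j * b j) = S i j * (b j * S k j) * b j" by (simp add: mult.assoc)
    also have "\<dots> = scl qi (S i j * S k j * b j * b j)"
      using assms that by (simp add: bS scl_simps flip: mult.assoc)
    finally show ?thesis .
  qed
  show ?thesis using assms by (simp add: * SS_col scl_simps mult.commute)
qed

lemma X'_anti:
  assumes "i \<in> {1..r}" "k \<in> {1..r}" "i < k" "j \<in> {1..n}" "l \<in> {1..n}" "l < j"
  shows "S i j * b j * (S k l * b l) = S k l * b l * (S i j * b j)"
proof -
  have S: "S k l = D k l j + S k j" using assms by (intro S_split) auto
  have "S i j * b j * (S k l * b l) = S i j * (b j * D k l j + b j * S k j) * b l"
    by (simp add: S distrib_right distrib_left mult.assoc)
  also have "\<dots> = scl q (S i j * D k l j * b j * b l) + scl qi (S i j * S k j * b j * b l)"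
    using assms by (simp add: bS bD scl_simps distrib_right distrib_left mult.assoc)
  finally have 1: "S i j * b j * (S k l * b l) = \<dots>" .
  have "S k l * b l * (S i j * b j) = S k l * (b l * S i j) * b j" by (simp add: mult.assoc)
  also have "\<dots> = S k l * S i j * b j * b l"
    using assms bb[of l j] by (simp add: bS scl_simps mult.assoc qi_q scl_coeff_simps)
  also have "\<dots> = scl q (S i j * D k l j * b j * b l) + S k j * S i j * b j * b l"
    using assms by (simp add: S DS_anti distrib_right scl_simps)
  finally show ?thesis unfolding 1
    using assms by (simp add: SS_col scl_simps scl_coeff_simps qi_q)
qed

lemma X'_diag:
  assumes "i \<in> {1..r}" "k \<in> {1..r}" "i < k" "j \<in> {1..n}" "l \<in> {1..n}" "j < l"
  shows "S i j * b j * (S k l * b l) =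
    S k l * b l * (S i j * b j) + scl (q - qi) (S i l * b l * (S k j * b j))"
proof -
  \<comment> \<open>Both sides are normalized to products of \<open>S\<close> and \<open>D\<close>
    followed by \<open>b l * b j\<close>, and are then combinations of the same three
    products.\<close>
  let ?m = "\<lambda>Y. Y * b l * b j"
  have S: "S i j = D i j l + S i l" for i using assms by (intro S_split) auto
  have "S i j * b j * (S k l * b l) = S i j * (b j * S k l) * b l" by (simp add: mult.assoc)
  also have "\<dots> = ?m (S i j * S k l)"
    using assms by (simp add: bS bb scl_simps mult.assoc qi_q scl_coeff_simps)
  also have "\<dots> = scl q (?m (S k l * D i j l)) + scl (q * q - 1) (?m (S i l * D k j l))
      + scl q (?m (S k l * S i l))"
    using assms by (simp add: S DS_diag SS_col scl_simps distrib_right)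
  finally have 1: "S i j * b j * (S k l * b l) = \<dots>" .
  have *: "S k l * b l * (S i j * b j) = scl qi (?m (S k l * S i l)) + scl q (?m (S k l * D i j l))"
    if "i \<in> {1..r}" for i k
  proof -
    have "S k l * b l * (S i j * b j) = S k l * (b l * S i l + b l * D i j l) * b j"
      by (simp add: S distrib_right distrib_left mult.assoc)
    also have "\<dots> = scl qi (?m (S k l * S i l)) + scl q (?m (S k l * D i j l))"
      using assms that by (simp add: bS bD scl_simps distrib_right distrib_left mult.assoc)
    finally show ?thesis .
  qed
  have "S i l * S k l = scl q (S k l * S i l)" using assms by (intro SS_col) auto
  then show ?thesis unfolding 1 *[OF assms(1)] *[OF assms(2)]
    by (simp add: scl_simps scl_coeff_simps q_qi qi_q left_diff_distrib right_diff_distrib)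
qed

theorem qmat_X': "qmat (Suc r) n X'"
  unfolding qmat_def
proof (intro conjI ballI impI)
  fix i j l assume a: "i \<in> {1..Suc r}" "j \<in> {1..n}" "l \<in> {1..n}" "j < l"
  show "X' i j * X' i l = scl q (X' i l * X' i j)"
    using a X'_row[of i j l] bb[of j l] by (simp add: X'_def)
next
  fix i k j assume a: "i \<in> {1..Suc r}" "k \<in> {1..Suc r}" "j \<in> {1..n}" "i < k"
  show "X' i j * X' k j = scl q (X' k j * X' i j)"
  proof (cases "k = Suc r")
    case True
    have "S i j * b j * b j = scl q (b j * (S i j * b j))"
      using a True by (simp add: Sb scl_simps mult.assoc)
    then show ?thesis using a True by (simp add: X'_def)
  next
    case False
    then show ?thesis using a X'_col[of i k j] by (simp add: X'_def)
  qed
next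
  fix i k j l assume a: "i \<in> {1..Suc r}" "k \<in> {1..Suc r}" "j \<in> {1..n}" "l \<in> {1..n}" "i < k \<and> l < j"
  have "S i j * b j * b l = b l * (S i j * b j)" if "i \<le> r"
  proof -
    have "b l * (S i j * b j) = b l * S i j * b j" by (simp add: mult.assoc)
    also have "\<dots> = scl qi (S i j * (b l * b j))" using a that by (simp add: bS scl_simps mult.assoc)
    also have "\<dots> = S i j * b j * b l"
      using a by (simp add: bb scl_simps qi_q scl_coeff_simps mult.assoc)
    finally show ?thesis by simp
  qed
  then show "X' i j * X' k l = X' k l * X' i j"
    using a X'_anti[of i k j l] by (cases "k = Suc r") (simp_all add: X'_def)
next
  fix i k j l assume a: "i \<in> {1..Suc r}" "k \<in> {1..Suc r}" "j \<in> {1..n}" "l \<in> {1..n}" "i < k \<and> j < l"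
  then show "X' i j * X' k l = X' k l * X' i j + scl (q - qi) (X' i l * X' k j)"
    using X'_diag[of i k j l] X'_last_diag[of i j l] by (cases "k = Suc r") (simp_all add: X'_def)
qed

end

section \<open>Top-degree parts of operators\<close>

lift_definition wsh :: "('i \<Rightarrow> 'c::comm_ring_1) \<Rightarrow> ('i \<Rightarrow> 'i) \<Rightarrow> ('i, 'c) lop"
  is "\<lambda>w s F a. w a * F (s a)" by (simp add: algebra_simps)

lemma app_wsh [simp]: "app (wsh w s) F = (\<lambda>a. w a * F (s a))"
  by (simp add: wsh.rep_eq)

lemma wsh_mult: "wsh w s * wsh w' s' = wsh (\<lambda>a. w a * w' (s a)) (\<lambda>a. s' (s a))"
  by (rule lop_eqI) (simp add: mult.assoc)

lemma wsh_one: "(\<And>a. w a = 1) \<Longrightarrow> (\<And>a. s a = a) \<Longrightarrow> wsh w s = 1"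
  by (rule lop_eqI) simp

lemma scl_wsh: "scl c (wsh w s) = wsh (\<lambda>a. c * w a) s"
  by (rule lop_eqI) (simp add: mult.assoc)

abbreviation cst :: "'k \<Rightarrow> 'g::comm_monoid_add \<Rightarrow>\<^sub>0 'k::comm_ring_1" where
  "cst \<equiv> Poly_Mapping.single 0"

lemma lookup_single_mult:
  fixes p :: "'g::cancel_comm_monoid_add \<Rightarrow>\<^sub>0 'k::comm_ring_1"
  shows "Poly_Mapping.lookup (Poly_Mapping.single g c * p) (h + g) = c * Poly_Mapping.lookup p h"
proof (induction p rule: Poly_Mapping.update_induct)
  case const
  show ?case by simp
next
  case (update f a b)
  have e: "Poly_Mapping.update a b f = f + Poly_Mapping.single a b"
    using update(1)
    by (intro poly_mapping_eqI) (auto simp: lookup_update lookup_add lookup_single in_keys_iff when_def)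
  have "Poly_Mapping.lookup (Poly_Mapping.single (g + a) (c * b)) (h + g) =
      c * Poly_Mapping.lookup (Poly_Mapping.single a b) h"
    by (cases "a = h") (auto simp: lookup_single when_def add.commute[of h g])
  then show ?case
    unfolding e distrib_left lookup_add mult_single by (simp add: update(3))
qed

lemma keys_single_mult:
  fixes p :: "'g::cancel_comm_monoid_add \<Rightarrow>\<^sub>0 'k::comm_ring_1"
  assumes "v \<in> Poly_Mapping.keys (Poly_Mapping.single g c * p)"
  obtains u where "u \<in> Poly_Mapping.keys p" "v = u + g"
proof -
  obtain a u where "a \<in> Poly_Mapping.keys (Poly_Mapping.single g c)" "u \<in> Poly_Mapping.keys p" "v = a + u"
    using assms keys_mult[of "Poly_Mapping.single g c" p] by blast
  then show ?thesis
    using that[of u] by (simp add: add.commute split: if_splits)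
qed

definition bounded_degree :: "'g \<Rightarrow> ('i \<Rightarrow> 'g::linordered_ab_group_add \<Rightarrow>\<^sub>0 'k::comm_ring_1) \<Rightarrow> bool" where
  "bounded_degree h F \<longleftrightarrow> (\<forall>a. \<forall>v\<in>Poly_Mapping.keys (F a). v \<le> h)"

text \<open>\<open>Y\<close> raises degrees by at most \<open>g\<close>, and \<open>s\<close> is its
  action on the coefficients of top degree. The value \<open>s = 0\<close> is allowed, so the notion
  is additive at fixed \<open>g\<close> and terms of smaller degree contribute zero.\<close>

definition lead :: "('i, 'g::linordered_ab_group_add \<Rightarrow>\<^sub>0 'k::comm_ring_1) lop \<Rightarrow> 'g \<Rightarrow> ('i, 'k) lop \<Rightarrow> bool" where
  "lead Y g s \<longleftrightarrow> (\<forall>h F. bounded_degree h F \<longrightarrow>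
     bounded_degree (h + g) (app Y F) \<and>
     (\<lambda>a. Poly_Mapping.lookup (app Y F a) (h + g)) = app s (\<lambda>a. Poly_Mapping.lookup (F a) h))"

lemma leadD:
  assumes "lead Y g s" "bounded_degree h F"
  shows "bounded_degree (h + g) (app Y F)"
    and "(\<lambda>a. Poly_Mapping.lookup (app Y F a) (h + g)) = app s (\<lambda>a. Poly_Mapping.lookup (F a) h)"
  using assms unfolding lead_def by blast+

lemma bounded_degree_add: "bounded_degree h F \<Longrightarrow> bounded_degree h G \<Longrightarrow> bounded_degree h (\<lambda>a. F a + G a)"
  unfolding bounded_degree_def using Poly_Mapping.keys_add by (metis UnE subsetD)

lemma bounded_degree_zero [simp]: "bounded_degree h (\<lambda>a. 0)"
  by (simp add: bounded_degree_def)

lemma lead_one: "lead 1 0 1"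
  by (simp add: lead_def)

lemma lead_mult:
  assumes "lead Y g s" "lead Z h t"
  shows "lead (Y * Z) (g + h) (s * t)"
  unfolding lead_def
proof (intro allI impI)
  fix u :: 'b and F :: "'a \<Rightarrow> 'b \<Rightarrow>\<^sub>0 'c" assume F: "bounded_degree u F"
  note Z = leadD[OF assms(2) F]
  note Y = leadD[OF assms(1) Z(1)]
  have e: "u + h + g = u + (g + h)" by (simp add: ac_simps)
  show "bounded_degree (u + (g + h)) (app (Y * Z) F) \<and>
    (\<lambda>a. Poly_Mapping.lookup (app (Y * Z) F a) (u + (g + h))) = app (s * t) (\<lambda>a. Poly_Mapping.lookup (F a) u)"
    using Y Z unfolding e by simp
qed

lemma lead_add:
  assumes "lead Y g s" "lead Z g t"
  shows "lead (Y + Z) g (s + t)"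
  unfolding lead_def
proof (intro allI impI)
  fix u :: 'b and F :: "'a \<Rightarrow> 'b \<Rightarrow>\<^sub>0 'c" assume F: "bounded_degree u F"
  show "bounded_degree (u + g) (app (Y + Z) F) \<and>
    (\<lambda>a. Poly_Mapping.lookup (app (Y + Z) F a) (u + g)) = app (s + t) (\<lambda>a. Poly_Mapping.lookup (F a) u)"
    using leadD[OF assms(1) F] leadD[OF assms(2) F]
    by (auto simp: bounded_degree_add lookup_add fun_eq_iff)
qed

lemma lead_zero: "lead 0 g 0"
  by (simp add: lead_def)

lemma lead_lower:
  assumes "lead Y g s" "g < g'"
  shows "lead Y g' 0"
  unfolding lead_def
proof (intro allI impI)
  fix u :: 'b and F :: "'a \<Rightarrow> 'b \<Rightarrow>\<^sub>0 'c" assume F: "bounded_degree u F"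
  note Y = leadD(1)[OF assms(1) F]
  have "u + g < u + g'" using assms(2) by simp
  then have "v < u + g'" if "v \<in> Poly_Mapping.keys (app Y F a)" for v a
    using Y that unfolding bounded_degree_def by (meson le_less_trans)
  then have "bounded_degree (u + g') (app Y F)" "\<And>a. u + g' \<notin> Poly_Mapping.keys (app Y F a)"
    unfolding bounded_degree_def by (auto intro: less_imp_le)
  then show "bounded_degree (u + g') (app Y F) \<and>
    (\<lambda>a. Poly_Mapping.lookup (app Y F a) (u + g')) = app 0 (\<lambda>a. Poly_Mapping.lookup (F a) u)"
    by (simp add: in_keys_iff)
qed

lemma lead_sum: "(\<And>x. x \<in> A \<Longrightarrow> lead (Y x) g (s x)) \<Longrightarrow> lead (\<Sum>x\<in>A. Y x) g (\<Sum>x\<in>A. s x)"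
  by (induction A rule: infinite_finite_induct) (auto simp: lead_zero lead_add)

lemma lead_wsh: "lead (wsh (\<lambda>a. Poly_Mapping.single g (w a)) s) g (wsh w s)"
  unfolding lead_def bounded_degree_def
  by (auto simp: lookup_single_mult elim!: keys_single_mult)

lemma lead_scl:
  assumes "lead Y g s" shows "lead (scl (cst c) Y) g (scl c s)"
proof -
  have "lead (wsh (\<lambda>a. cst c) (\<lambda>a. a) * Y) (0 + g) (wsh (\<lambda>a. c) (\<lambda>a. a) * s)"
    by (intro lead_mult lead_wsh assms)
  moreover have "wsh (\<lambda>a. cst c) (\<lambda>a. a) * Y = scl (cst c) Y" "wsh (\<lambda>a. c) (\<lambda>a. a) * s = scl c s"
    by (auto intro!: lop_eqI)
  ultimately show ?thesis by simp
qed

lemma lead_zeroD: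
  fixes g :: "'g::linordered_ab_group_add" and s :: "('i, 'k::comm_ring_1) lop"
  assumes "lead 0 g s" shows "s = 0"
proof (rule lop_eqI)
  fix f :: "'i \<Rightarrow> 'k" and a
  have "bounded_degree 0 (\<lambda>a. cst (f a) :: 'g \<Rightarrow>\<^sub>0 'k)"
    unfolding bounded_degree_def by simp
  from leadD(2)[OF assms this] show "app s f a = app 0 f a"
    by (simp add: fun_eq_iff)
qed

text \<open>The constant function 1 has degree 0, so it tests the leading part alone. This serves
  operators that are controlled on periodic functions only.\<close>

lemma lead_eq_zero_imp:
  assumes "lead Y g s" "app Y (\<lambda>a. 1) = (\<lambda>a. 0)"
  shows "app s (\<lambda>a. 1) = (\<lambda>a. 0)"
proof -
  have b: "bounded_degree 0 (\<lambda>a. 1)"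
    unfolding bounded_degree_def by simp
  show ?thesis
    using leadD(2)[OF assms(1) b] assms(2) by (simp add: fun_eq_iff)
qed

lemma lead_prod_list:
  "(\<And>x. x \<in> set w \<Longrightarrow> lead (Y x) (g x) (s x)) \<Longrightarrow>
    lead (prod_list (map Y w)) (sum_list (map g w)) (prod_list (map s w))"
  by (induction w) (auto intro: lead_one lead_mult)

section \<open>The quantum torus\<close>

text \<open>
  The generator \<open>t\<^sub>i\<^sub>j\<close> of the torus shifts by \<open>mu i j\<close> and multiplies by \<open>q\<close> to the power \<open>gam n i j\<close>, so that
  \<open>t\<^sub>i\<^sub>j t\<^sub>k\<^sub>l = q\<^sup>e t\<^sub>k\<^sub>l t\<^sub>i\<^sub>j\<close> with \<open>e = gam n i j (mu k l) - gam n k l (mu i j)\<close>. The formulas come from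
  diagonalizing the central elements of the tori of all upper left \<open>r \<times> r\<close> blocks simultaneously, in
  the style of Gelfand and Tsetlin: the coordinates \<open>(r, d)\<close> with fixed \<open>r\<close> record their eigenvalues.
  For \<open>r = n\<close> these would never be shifted, so \<open>crd\<close> drops them.
\<close>

definition mu :: "nat \<Rightarrow> nat \<Rightarrow> nat \<times> nat \<Rightarrow> int" where
  "mu i j = (\<lambda>(r, d). of_bool (d = j \<and> j \<le> r \<and> r < i) + of_bool (i + d = r + 1 \<and> i \<le> r \<and> r < j))"

definition crd :: "nat \<Rightarrow> (nat \<times> nat \<Rightarrow> int) \<Rightarrow> nat \<Rightarrow> nat \<Rightarrow> int" where
  "crd n a r d = (if r < n then a (r, d) else 0)"

definition gam :: "nat \<Rightarrow> nat \<Rightarrow> nat \<Rightarrow> (nat \<times> nat \<Rightarrow> int) \<Rightarrow> int" where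
  "gam n i j a =
    (if j \<le> i then (\<Sum>t\<in>{1..j}. crd n a i t) - (\<Sum>t\<in>{1..<j}. crd n a (i - 1) t)
     else (\<Sum>t\<in>{1..i}. crd n a j (j + 1 - t)) - (\<Sum>t\<in>{1..<i}. crd n a (j - 1) (j - t)))"

lemma crd_add: "crd n (\<lambda>x. a x + b x) r d = crd n a r d + crd n b r d"
  by (simp add: crd_def)

lemma crd_uminus: "crd n (\<lambda>x. - a x) r d = - crd n a r d"
  by (simp add: crd_def)

lemma gam_add: "gam n i j (\<lambda>x. a x + b x) = gam n i j a + gam n i j b"
  by (simp add: gam_def crd_add sum.distrib)

lemma gam_uminus: "gam n i j (\<lambda>x. - a x) = - gam n i j a"
  by (simp add: gam_def crd_uminus sum_negf)

lemma gam_diff: "gam n i j (\<lambda>x. a x - b x) = gam n i j a - gam n i j b"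
  using gam_add[of n i j a "\<lambda>x. - b x"] by (simp add: gam_uminus)

lemma crd_mu: "i \<le> n \<Longrightarrow> j \<le> n \<Longrightarrow> crd n (mu i j) r d =
    of_bool (d = j \<and> j \<le> r \<and> r < i) + of_bool (i + d = r + 1 \<and> i \<le> r \<and> r < j)"
  by (auto simp: crd_def mu_def)

lemma sum_eq_of_bool:
  assumes "finite A" "\<And>t. t \<in> A \<Longrightarrow> f t = of_bool (P \<and> t = a)"
  shows "sum f A = (of_bool (P \<and> a \<in> A) :: int)"
  using assms by (induction A rule: finite_induct) auto

text \<open>For \<open>l \<le> k\<close> only the first indicator in \<open>mu k l\<close> can be
  nonzero, for \<open>k < l\<close> only the second. Each of the two sums in \<open>gam\<close> then
  has at most one nonzero term, and the four positions relative to the diagonal are treated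
  separately.\<close>

lemma gam_mu_lower_lower:
  assumes "l \<le> k" "j \<le> i" "1 \<le> l" "k \<le> n"
  shows "gam n i j (mu k l) = of_bool (l \<le> j \<and> i < k) - of_bool (l < j \<and> i \<le> k)"
proof -
  have "(\<Sum>t\<in>{1..j}. crd n (mu k l) i t) = of_bool ((l \<le> i \<and> i < k) \<and> l \<in> {1..j})"
    using assms by (intro sum_eq_of_bool) (auto simp: crd_mu)
  moreover have "(\<Sum>t\<in>{1..<j}. crd n (mu k l) (i - 1) t) = of_bool ((l \<le> i - 1 \<and> i - 1 < k) \<and> l \<in> {1..<j})"
    using assms by (intro sum_eq_of_bool) (auto simp: crd_mu)
  ultimately show ?thesis
    using assms by (simp only: gam_def if_True if_False not_less[symmetric]) (auto simp: of_bool_def)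
qed

lemma gam_mu_lower_upper:
  assumes "k < l" "j \<le> i" "1 \<le> k" "l \<le> n"
  shows "gam n i j (mu k l) = of_bool (k \<le> i \<and> i < l \<and> i < j + k) - of_bool (k < i \<and> i \<le> l \<and> i < j + k)"
proof -
  have "(\<Sum>t\<in>{1..j}. crd n (mu k l) i t) = of_bool ((k \<le> i \<and> i < l) \<and> i + 1 - k \<in> {1..j})"
    using assms by (intro sum_eq_of_bool) (auto simp: crd_mu)
  moreover have "(\<Sum>t\<in>{1..<j}. crd n (mu k l) (i - 1) t) = of_bool ((k \<le> i - 1 \<and> i - 1 < l) \<and> i - k \<in> {1..<j})"
    using assms by (intro sum_eq_of_bool) (auto simp: crd_mu)
  ultimately show ?thesis
    using assms by (simp only: gam_def if_True if_False not_less[symmetric]) (auto simp: of_bool_def)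
qed

lemma gam_mu_upper_lower:
  assumes "l \<le> k" "i < j" "1 \<le> l" "k \<le> n"
  shows "gam n i j (mu k l) = of_bool (l \<le> j \<and> j < k \<and> j < l + i) - of_bool (l < j \<and> j \<le> k \<and> j < l + i)"
proof -
  have "(\<Sum>t\<in>{1..i}. crd n (mu k l) j (j + 1 - t)) = of_bool ((l \<le> j \<and> j < k) \<and> j + 1 - l \<in> {1..i})"
    using assms by (intro sum_eq_of_bool) (auto simp: crd_mu)
  moreover have "(\<Sum>t\<in>{1..<i}. crd n (mu k l) (j - 1) (j - t)) = of_bool ((l \<le> j - 1 \<and> j - 1 < k) \<and> j - l \<in> {1..<i})"
    using assms by (intro sum_eq_of_bool) (auto simp: crd_mu)
  ultimately show ?thesis
    using assms by (simp only: gam_def if_True if_False not_less[symmetric]) (auto simp: of_bool_def)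
qed

lemma gam_mu_upper_upper:
  assumes "k < l" "i < j" "1 \<le> k" "l \<le> n"
  shows "gam n i j (mu k l) = of_bool (k \<le> i \<and> j < l) - of_bool (k < i \<and> j \<le> l)"
proof -
  have "(\<Sum>t\<in>{1..i}. crd n (mu k l) j (j + 1 - t)) = of_bool ((k \<le> j \<and> j < l) \<and> k \<in> {1..i})"
    using assms by (intro sum_eq_of_bool) (auto simp: crd_mu)
  moreover have "(\<Sum>t\<in>{1..<i}. crd n (mu k l) (j - 1) (j - t)) = of_bool ((k \<le> j - 1 \<and> j - 1 < l) \<and> k \<in> {1..<i})"
    using assms by (intro sum_eq_of_bool) (auto simp: crd_mu)
  ultimately show ?thesis
    using assms by (simp only: gam_def if_True if_False not_less[symmetric]) (auto simp: of_bool_def)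
qed

lemmas gam_mu = gam_mu_lower_lower gam_mu_lower_upper gam_mu_upper_lower gam_mu_upper_upper

lemma gam_mu_row:
  assumes "i \<in> {1..n}" "j \<in> {1..n}" "l \<in> {1..n}" "j < l"
  shows "gam n i j (mu i l) - gam n i l (mu i j) = 1"
  using assms by (cases "j \<le> i"; cases "l \<le> i") (auto simp: gam_mu of_bool_def)

lemma gam_mu_col:
  assumes "i \<in> {1..n}" "j \<in> {1..n}" "k \<in> {1..n}" "i < k"
  shows "gam n i j (mu k j) - gam n k j (mu i j) = 1"
  using assms by (cases "j \<le> i"; cases "j \<le> k") (auto simp: gam_mu of_bool_def)

text \<open>Diagonal pairs commute like antidiagonal ones: the correction term in the relation of a
  quantum matrix has lower degree and leaves no trace in the torus.\<close>

lemma gam_mu_comm: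
  assumes "i \<in> {1..n}" "j \<in> {1..n}" "k \<in> {1..n}" "l \<in> {1..n}" "i \<noteq> k" "j \<noteq> l"
  shows "gam n i j (mu k l) = gam n k l (mu i j)"
  using assms by (cases "j \<le> i"; cases "l \<le> k") (auto simp: gam_mu of_bool_def)

type_synonym 'k laurent = "((nat \<times> nat) \<Rightarrow>\<^sub>0 int) \<Rightarrow>\<^sub>0 'k"

abbreviation unit_exp :: "nat \<Rightarrow> nat \<Rightarrow> (nat \<times> nat) \<Rightarrow>\<^sub>0 int" where
  "unit_exp i j \<equiv> Poly_Mapping.single (i, j) 1"

locale quantum_torus =
  fixes n :: nat and q :: "'k::field"
  assumes q: "q \<noteq> 0"
begin

text \<open>The Laurent variable at \<open>(i, j)\<close> is a commuting coefficient that only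
  records the degree; dropping it gives \<open>sym\<close>, the leading part.\<close>

definition tor :: "nat \<Rightarrow> nat \<Rightarrow> (nat \<times> nat \<Rightarrow> int, 'k laurent) lop" where
  "tor i j = wsh (\<lambda>a. Poly_Mapping.single (unit_exp i j) (q powi gam n i j a)) (\<lambda>a x. a x - mu i j x)"

definition tor_inv :: "nat \<Rightarrow> nat \<Rightarrow> (nat \<times> nat \<Rightarrow> int, 'k laurent) lop" where
  "tor_inv i j = wsh (\<lambda>a. Poly_Mapping.single (- unit_exp i j) (q powi - gam n i j (\<lambda>x. a x + mu i j x)))
     (\<lambda>a x. a x + mu i j x)"

definition sym :: "nat \<Rightarrow> nat \<Rightarrow> (nat \<times> nat \<Rightarrow> int, 'k) lop" where
  "sym i j = wsh (\<lambda>a. q powi gam n i j a) (\<lambda>a x. a x - mu i j x)"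

definition sym_inv :: "nat \<Rightarrow> nat \<Rightarrow> (nat \<times> nat \<Rightarrow> int, 'k) lop" where
  "sym_inv i j = wsh (\<lambda>a. q powi - gam n i j (\<lambda>x. a x + mu i j x)) (\<lambda>a x. a x + mu i j x)"

lemma tor_inverse: "tor i j * tor_inv i j = 1" "tor_inv i j * tor i j = 1"
  using q by (auto simp: tor_def tor_inv_def wsh_mult mult_single gam_add gam_diff
      simp flip: power_int_add intro!: wsh_one)

lemma sym_inverse: "sym i j * sym_inv i j = 1" "sym_inv i j * sym i j = 1"
  using q by (auto simp: sym_def sym_inv_def wsh_mult gam_add gam_diff
      simp flip: power_int_add intro!: wsh_one)

lemma lead_tor: "lead (tor i j) (unit_exp i j) (sym i j)"
  unfolding tor_def sym_def by (rule lead_wsh)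

lemma lead_tor_inv: "lead (tor_inv i j) (- unit_exp i j) (sym_inv i j)"
  unfolding tor_inv_def sym_inv_def by (rule lead_wsh)

lemma tor_mult: "tor i j * tor k l =
   wsh (\<lambda>a. Poly_Mapping.single (unit_exp i j + unit_exp k l)
       (q powi (gam n i j a + gam n k l a - gam n k l (mu i j))))
     (\<lambda>a x. a x - mu i j x - mu k l x)"
proof -
  have "gam n i j a + gam n k l (\<lambda>x. a x - mu i j x) = gam n i j a + gam n k l a - gam n k l (mu i j)" for a
    by (simp add: gam_diff)
  then have "q powi gam n i j a * q powi gam n k l (\<lambda>x. a x - mu i j x) =
      q powi (gam n i j a + gam n k l a - gam n k l (mu i j))" for a
    using q by (metis power_int_add)
  then show ?thesis unfolding tor_def wsh_mult mult_single by simp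
qed

lemma tor_commute:
  assumes "gam n i j (mu k l) - gam n k l (mu i j) = e"
  shows "tor i j * tor k l = scl (cst (q powi e)) (tor k l * tor i j)"
proof -
  have e: "q powi (gam n i j a + gam n k l a - gam n k l (mu i j)) =
      q powi e * q powi (gam n k l a + gam n i j a - gam n i j (mu k l))" for a
  proof -
    have "gam n i j a + gam n k l a - gam n k l (mu i j) =
        e + (gam n k l a + gam n i j a - gam n i j (mu k l))" using assms by simp
    then show ?thesis using q by (metis power_int_add)
  qed
  have s: "a x - mu k l x - mu i j x = a x - mu i j x - mu k l x" for a :: "nat \<times> nat \<Rightarrow> int" and x
    by simp
  show ?thesis
    unfolding tor_mult scl_wsh mult_single e s add_0 add.commute[of "unit_exp k l"] by (rule refl)
qed

end

section \<open>A quantum matrix over the torus\<close>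

lemma less_poly_mappingI:
  fixes f g :: "'a::linorder \<Rightarrow>\<^sub>0 'b::{zero,linorder}"
  assumes "Poly_Mapping.lookup f k < Poly_Mapping.lookup g k" "\<And>k'. k' < k \<Longrightarrow> Poly_Mapping.lookup f k' = Poly_Mapping.lookup g k'"
  shows "f < g"
  using assms unfolding less_poly_mapping.rep_eq less_fun_def by blast

text \<open>Exponents are compared at the first position where they differ. Here this is
  \<open>(i, j)\<close>: it precedes the other three corners and occurs on the right only.\<close>

lemma unit_exp_corner_less:
  assumes "i < k" "j < s"
  shows "unit_exp i s + - unit_exp k s + unit_exp k j < unit_exp i j"
  by (rule less_poly_mappingI[of _ "(i, j)"])
    (use assms in \<open>auto simp: lookup_add lookup_minus lookup_single when_def\<close>)

context quantum_torus
begin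

definition scommute :: "('i, 'k laurent) lop \<Rightarrow> ('i, 'k laurent) lop \<Rightarrow> int \<Rightarrow> bool" where
  "scommute Y Z e \<longleftrightarrow> Y * Z = scl (cst (q powi e)) (Z * Y)"

lemma scommute_mult:
  assumes "scommute Y W e" "scommute Z W f"
  shows "scommute (Y * Z) W (e + f)"
proof -
  have "Y * Z * W = scl (cst (q powi f)) (Y * W * Z)"
    using assms(2) by (simp add: scommute_def scl_simps mult.assoc)
  then show ?thesis
    using assms(1) q
    by (simp add: scommute_def scl_simps mult_single power_int_add mult.commute[of "q powi e"] flip: mult.assoc)
qed

lemma scommute_sum:
  assumes "\<And>s. s \<in> A \<Longrightarrow> scommute (Y s) Z e"
  shows "scommute (\<Sum>s\<in>A. Y s) Z e"
  using assms by (simp add: scommute_def sum_distrib_left sum_distrib_right scl_sum)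

lemma scommute_inverse:
  assumes "scommute Y Z e" "Y * Y' = 1" "Y' * Y = 1"
  shows "scommute Y' Z (- e)"
proof -
  have "Z * Y' = Y' * (Y * Z) * Y'" using assms(3) by (simp flip: mult.assoc)
  also have "\<dots> = scl (cst (q powi e)) (Y' * Z * (Y * Y'))"
    using assms(1) by (simp add: scommute_def scl_simps mult.assoc)
  finally show ?thesis
    using assms(2) q by (simp add: scommute_def scl_simps mult_single scl_coeff_simps flip: power_int_add)
qed

lemma scommute_tor:
  assumes "i \<in> {1..n}" "j \<in> {1..n}" "k \<in> {1..n}" "l \<in> {1..n}" "i < k"
  shows "scommute (tor i j) (tor k l) (of_bool (j = l))"
  unfolding scommute_def using assms gam_mu_col[of i n j k] gam_mu_comm[of i n j k l]
  by (intro tor_commute) auto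

text \<open>\<open>xr r\<close> is meant for row indices from 1 to \<open>r\<close>; the value 0 for
  the matrix without rows is a dummy.\<close>

fun xr :: "nat \<Rightarrow> nat \<Rightarrow> nat \<Rightarrow> (nat \<times> nat \<Rightarrow> int, 'k laurent) lop" where
  "xr 0 i j = 0"
| "xr (Suc r) i j =
    (if i \<le> r then (\<Sum>s\<in>{j..n}. xr r i s * tor_inv (Suc r) s) * tor (Suc r) j else tor (Suc r) j)"

text \<open>In each summand the factors \<open>xr r i s\<close> and \<open>tor_inv (Suc r) s\<close>
  have opposite exponents against \<open>tor k l\<close>, so they cancel and only the last factor
  \<open>tor (Suc r) j\<close> counts. This supplies the hypotheses of \<open>row_extension\<close>
  for the next row.\<close>

lemma scommute_xr:
  assumes "i \<in> {1..r}" "j \<in> {1..n}" "k \<in> {1..n}" "l \<in> {1..n}" "r < k"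
  shows "scommute (xr r i j) (tor k l) (of_bool (j = l))"
  using assms
proof (induction r arbitrary: i j)
  case (Suc r)
  show ?case
  proof (cases "i \<le> r")
    case True
    have "scommute (xr r i s * tor_inv (Suc r) s) (tor k l) 0" if s: "s \<in> {j..n}" for s
    proof -
      have "scommute (xr r i s) (tor k l) (of_bool (s = l))"
        using Suc True s by auto
      moreover have "scommute (tor_inv (Suc r) s) (tor k l) (- of_bool (s = l))"
        using Suc.prems s by (intro scommute_inverse[OF scommute_tor tor_inverse]) auto
      ultimately show ?thesis using scommute_mult by fastforce
    qed
    moreover have "scommute (tor (Suc r) j) (tor k l) (of_bool (j = l))"
      using Suc.prems by (intro scommute_tor) auto
    ultimately show ?thesis
      using True scommute_mult[OF scommute_sum, of "{j..n}" _ _ 0] by fastforce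
  next
    case False
    then have "i = Suc r" using Suc.prems by auto
    then show ?thesis using Suc.prems scommute_tor[of "Suc r" j k l] by simp
  qed
qed simp

sublocale us: unit_scalar "cst q :: 'k laurent" "cst (inverse q)"
  using q by unfold_locales (simp add: mult_single)

lemma qmat_xr: "r \<le> n \<Longrightarrow> us.qmat r n (xr r)"
proof (induction r)
  case 0
  show ?case by (simp add: us.qmat_def)
next
  case (Suc r)
  interpret row_extension "cst q" "cst (inverse q)" r n "xr r" "tor (Suc r)" "tor_inv (Suc r)"
  proof
    show "us.qmat r n (xr r)" using Suc by simp
    show "tor (Suc r) j * tor (Suc r) l = scl (cst q) (tor (Suc r) l * tor (Suc r) j)"
      if "j \<in> {1..n}" "l \<in> {1..n}" "j < l" for j l
      using tor_commute[OF gam_mu_row[of "Suc r" n j l]] that Suc.prems by simp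
    show "xr r i j * tor (Suc r) j = scl (cst q) (tor (Suc r) j * xr r i j)"
      if "i \<in> {1..r}" "j \<in> {1..n}" for i j
      using scommute_xr[of i r j "Suc r" j] that Suc.prems by (simp add: scommute_def)
    show "xr r i j * tor (Suc r) l = tor (Suc r) l * xr r i j"
      if "i \<in> {1..r}" "j \<in> {1..n}" "l \<in> {1..n}" "j \<noteq> l" for i j l
      using scommute_xr[of i r j "Suc r" l] that Suc.prems by (simp add: scommute_def scl_coeff_simps)
  qed (simp_all add: tor_inverse)
  have "X' = xr (Suc r)"
    by (intro ext) (simp add: X'_def S_def U_def)
  then show ?case using qmat_X' by (simp del: xr.simps)
qed

text \<open>The summand \<open>s = j\<close> collapses to the previous \<open>xr r i j\<close>;
  every summand with \<open>s > j\<close> moves to the opposite corners and has smaller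
  degree.\<close>

lemma lead_xr: "i \<in> {1..r} \<Longrightarrow> j \<in> {1..n} \<Longrightarrow> lead (xr r i j) (unit_exp i j) (sym i j)"
proof (induction r arbitrary: i j)
  case (Suc r)
  show ?case
  proof (cases "i \<le> r")
    case True
    let ?Y = "\<lambda>s. xr r i s * tor_inv (Suc r) s * tor (Suc r) j"
    have "lead (?Y s) (unit_exp i j) 0" if s: "s \<in> {Suc j..n}" for s
    proof (rule lead_lower)
      show "lead (?Y s) (unit_exp i s + - unit_exp (Suc r) s + unit_exp (Suc r) j)
          (sym i s * sym_inv (Suc r) s * sym (Suc r) j)"
        using Suc True s by (intro lead_mult lead_tor lead_tor_inv) auto
      show "unit_exp i s + - unit_exp (Suc r) s + unit_exp (Suc r) j < unit_exp i j"
        using True s by (intro unit_exp_corner_less) auto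
    qed
    then have "lead (\<Sum>s\<in>{Suc j..n}. ?Y s) (unit_exp i j) (\<Sum>s\<in>{Suc j..n}. 0)"
      by (rule lead_sum)
    moreover have "?Y j = xr r i j" by (simp add: mult.assoc tor_inverse)
    then have "lead (?Y j) (unit_exp i j) (sym i j)" using Suc True by auto
    moreover have "xr (Suc r) i j = (\<Sum>s\<in>{j..n}. ?Y s)" using True by (simp add: sum_distrib_right)
    moreover have "\<dots> = ?Y j + (\<Sum>s\<in>{Suc j..n}. ?Y s)"
      using Suc.prems by (intro sum.atLeast_Suc_atMost) auto
    ultimately show ?thesis
      using lead_add[of "?Y j" "unit_exp i j" "sym i j"] by fastforce
  next
    case False
    then show ?thesis using Suc.prems lead_tor[of i j] by auto (metis le_SucE)
  qed
qed simp

end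

section \<open>Matrices whose powers have trace zero\<close>

lemma fps_deriv_prod:
  fixes f :: "'i \<Rightarrow> 'c::comm_ring_1 fps"
  shows "finite A \<Longrightarrow> fps_deriv (\<Prod>i\<in>A. f i) = (\<Sum>i\<in>A. fps_deriv (f i) * (\<Prod>k\<in>A - {i}. f k))"
proof (induction A rule: finite_induct)
  case (insert x A)
  have "(\<Sum>i\<in>A. fps_deriv (f i) * (\<Prod>k\<in>insert x A - {i}. f k)) =
      (\<Sum>i\<in>A. f x * (fps_deriv (f i) * (\<Prod>k\<in>A - {i}. f k)))"
  proof (rule sum.cong[OF refl])
    fix i assume "i \<in> A"
    then have "insert x A - {i} = insert x (A - {i})" using insert by auto
    then show "fps_deriv (f i) * (\<Prod>k\<in>insert x A - {i}. f k) =
        f x * (fps_deriv (f i) * (\<Prod>k\<in>A - {i}. f k))"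
      using insert by (simp add: ac_simps)
  qed
  then show ?case using insert by (simp add: sum_distrib_left ac_simps)
qed simp

lemma fps_nth_of_int_mult: "fps_nth (of_int c * f) k = of_int c * fps_nth f k"
  by (simp flip: fps_of_int)

lemma fps_prod_linear_nth:
  fixes f :: "'i \<Rightarrow> 'c::comm_ring_1 fps"
  shows "finite A \<Longrightarrow> (\<And>i k. i \<in> A \<Longrightarrow> 1 < k \<Longrightarrow> fps_nth (f i) k = 0) \<Longrightarrow> card A < k \<Longrightarrow>
    fps_nth (\<Prod>i\<in>A. f i) k = 0"
proof (induction A arbitrary: k rule: finite_induct)
  case (insert x A)
  have "fps_nth (f x) i * fps_nth (prod f A) (k - i) = 0" if "i \<in> {0..k}" for i
  proof (cases "1 < i")
    case False
    then have "card A < k - i" using insert by auto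
    then show ?thesis using insert by simp
  qed (use insert in auto)
  then show ?case using insert by (simp add: fps_mult_nth)
qed auto

lemma fps_det_linear_nth:
  fixes M :: "'c::comm_ring_1 fps mat"
  assumes M: "M \<in> carrier_mat n n"
    and lin: "\<And>i j k. i < n \<Longrightarrow> j < n \<Longrightarrow> 1 < k \<Longrightarrow> fps_nth (M $$ (i, j)) k = 0" and k: "n < k"
  shows "fps_nth (det M) k = 0"
proof -
  have "fps_nth (\<Prod>i = 0..<n. M $$ (i, p i)) k = 0" if "p permutes {0..<n}" for p
    using k lin permutes_in_image[OF that] by (intro fps_prod_linear_nth) auto
  then show ?thesis
    using M by (simp add: det_def fps_sum_nth fps_nth_of_int_mult)
qed

text \<open>The product rule differentiates one row at a time. \<open>R i\<close> is
  \<open>M\<close> with row \<open>i\<close> differentiated, and expanding its determinant along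
  that row meets only cofactors of \<open>M\<close>.\<close>

lemma fps_deriv_det:
  fixes M :: "'c::comm_ring_1 fps mat"
  assumes M: "M \<in> carrier_mat n n"
  shows "fps_deriv (det M) = (\<Sum>i<n. \<Sum>j<n. fps_deriv (M $$ (i, j)) * cofactor M i j)"
proof -
  define R where "R i = mat n n (\<lambda>(k, j). if k = i then fps_deriv (M $$ (i, j)) else M $$ (k, j))" for i
  have R: "R i \<in> carrier_mat n n" for i by (simp add: R_def)
  let ?P = "{p. p permutes {0..<n}}"
  have "fps_deriv (\<Prod>k = 0..<n. M $$ (k, p k)) = (\<Sum>i = 0..<n. \<Prod>k = 0..<n. R i $$ (k, p k))"
    if "p \<in> ?P" for p
  proof -
    have "fps_deriv (M $$ (i, p i)) * (\<Prod>k\<in>{0..<n} - {i}. M $$ (k, p k)) =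
        (\<Prod>k = 0..<n. R i $$ (k, p k))" if i: "i \<in> {0..<n}" for i
    proof -
      have p: "k \<in> {0..<n} \<Longrightarrow> p k < n" for k using permutes_in_image \<open>p \<in> ?P\<close> by fastforce
      have "(\<Prod>k = 0..<n. R i $$ (k, p k)) = R i $$ (i, p i) * (\<Prod>k\<in>{0..<n} - {i}. R i $$ (k, p k))"
        using i by (intro prod.remove) auto
      moreover have "(\<Prod>k\<in>{0..<n} - {i}. R i $$ (k, p k)) = (\<Prod>k\<in>{0..<n} - {i}. M $$ (k, p k))"
        using p by (intro prod.cong) (auto simp: R_def)
      ultimately show ?thesis using i p by (simp add: R_def)
    qed
    then show ?thesis by (simp add: fps_deriv_prod)
  qed
  then have "fps_deriv (det M) = (\<Sum>p\<in>?P. of_int (sign p) * (\<Sum>i = 0..<n. \<Prod>k = 0..<n. R i $$ (k, p k)))"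
    using M by (simp add: det_def fps_deriv_sum flip: fps_of_int)
  also have "\<dots> = (\<Sum>i = 0..<n. det (R i))"
    unfolding det_def'[OF R] by (subst sum_distrib_left, subst sum.swap) (rule refl)
  also have "\<dots> = (\<Sum>i<n. \<Sum>j<n. fps_deriv (M $$ (i, j)) * cofactor M i j)"
    unfolding atLeast0LessThan
  proof (rule sum.cong[OF refl])
    fix i assume i: "i \<in> {..<n}"
    have "mat_delete (R i) i j = mat_delete M i j" if "j < n" for j
      using M i that by (auto simp: mat_delete_def R_def)
    then show "det (R i) = (\<Sum>j<n. fps_deriv (M $$ (i, j)) * cofactor M i j)"
      using i by (subst laplace_expansion_row[OF R, of i]) (auto simp: cofactor_def R_def)
  qed
  finally show ?thesis .
qed

text \<open>
  With \<open>M = 1 - tB\<close>, Jacobi's formula gives \<open>(det M)' = - det M \<cdot> (\<Sum>k. tr (B ^ (k + 1)) t ^ k) = 0\<close>.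
  Hence \<open>det M = 1\<close> and \<open>\<Sum>k. B ^ k t ^ k\<close> is the adjugate of \<open>M\<close>, which has degree less than \<open>N\<close>.
\<close>

theorem nilpotent_if_traces_zero:
  fixes B :: "'c::comm_ring_1 mat"
  assumes B: "B \<in> carrier_mat N N"
    and tf: "\<And>k x. of_nat (Suc k) * x = (0::'c) \<Longrightarrow> x = 0"
    and tr: "\<And>k. 0 < k \<Longrightarrow> (\<Sum>i<N. (B ^\<^sub>m k) $$ (i, i)) = 0"
  shows "B ^\<^sub>m N = 0\<^sub>m N N"
proof -
  define M where "M = mat N N (\<lambda>(i, j). (if i = j then 1 else 0) - fps_X * fps_const (B $$ (i, j)))"
  define G where "G = mat N N (\<lambda>(i, j). Abs_fps (\<lambda>k. (B ^\<^sub>m k) $$ (i, j)))"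
  have M: "M \<in> carrier_mat N N" and G: "G \<in> carrier_mat N N" by (simp_all add: M_def G_def)
  have Bk: "B ^\<^sub>m k \<in> carrier_mat N N" for k using B by simp
  have GM: "G * M = 1\<^sub>m N"
  proof (rule eq_matI)
    fix i j assume "i < dim_row (1\<^sub>m N)" "j < dim_col (1\<^sub>m N)"
    then have ij: "i < N" "j < N" by simp_all
    have "(G * M) $$ (i, j) = (\<Sum>l<N. G $$ (i, l) * M $$ (l, j))"
      using ij M G by (simp add: scalar_prod_def lessThan_atLeast0)
    also have "\<dots> = (\<Sum>l<N. (if l = j then G $$ (i, l) else 0) - fps_X * (G $$ (i, l) * fps_const (B $$ (l, j))))"
      using ij by (intro sum.cong) (auto simp: M_def algebra_simps)
    also have "\<dots> = G $$ (i, j) - fps_X * (\<Sum>l<N. G $$ (i, l) * fps_const (B $$ (l, j)))"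
      using ij by (simp add: sum_subtractf sum_distrib_left)
    also have "\<dots> = 1\<^sub>m N $$ (i, j)"
    proof (rule fps_ext)
      fix k
      show "fps_nth (G $$ (i, j) - fps_X * (\<Sum>l<N. G $$ (i, l) * fps_const (B $$ (l, j)))) k =
          fps_nth (1\<^sub>m N $$ (i, j)) k"
      proof (cases k)
        case 0
        then show ?thesis using ij B by (simp add: G_def)
      next
        case (Suc k')
        have "(B ^\<^sub>m Suc k') $$ (i, j) = (\<Sum>l<N. (B ^\<^sub>m k') $$ (i, l) * B $$ (l, j))"
          using ij B Bk[of k'] by (simp add: scalar_prod_def lessThan_atLeast0)
        then show ?thesis using ij Suc by (simp add: G_def fps_sum_nth del: pow_mat.simps)
      qed
    qed
    finally show "(G * M) $$ (i, j) = 1\<^sub>m N $$ (i, j)" .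
  qed (use M G in simp_all)
  define D where "D = det M"
  note adj = adj_mat[OF M]
  have DG: "D \<cdot>\<^sub>m G = adj_mat M"
  proof -
    have "adj_mat M = G * M * adj_mat M" using adj(1) by (simp add: GM)
    also have "\<dots> = G * (D \<cdot>\<^sub>m 1\<^sub>m N)"
      using adj(1,2) M G by (simp add: D_def assoc_mult_mat[OF G M adj(1)])
    also have "\<dots> = D \<cdot>\<^sub>m G" using G by (simp add: mult_smult_distrib[OF G one_carrier_mat])
    finally show ?thesis by simp
  qed
  have cof: "cofactor M i j = D * G $$ (j, i)" if "i < N" "j < N" for i j
  proof -
    have "adj_mat M $$ (j, i) = cofactor M i j" using that M by (simp add: adj_mat_def)
    then show ?thesis using that G by (simp flip: DG)
  qed
  have dM: "fps_deriv (M $$ (i, j)) = - fps_const (B $$ (i, j))" if "i < N" "j < N" for i j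
    using that by (simp add: M_def)
  have "fps_deriv D = (\<Sum>i<N. \<Sum>j<N. - fps_const (B $$ (i, j)) * (D * G $$ (j, i)))"
    unfolding fps_deriv_det[OF M, folded D_def]
    by (intro sum.cong refl) (simp only: cof dM lessThan_iff)
  also have "\<dots> = - D * (\<Sum>i<N. \<Sum>j<N. fps_const (B $$ (i, j)) * G $$ (j, i))"
    by (simp add: sum_distrib_left sum_negf ac_simps del: fps_const_neg)
  also have "(\<Sum>i<N. \<Sum>j<N. fps_const (B $$ (i, j)) * G $$ (j, i)) = 0"
  proof (rule fps_ext)
    fix k
    have "(\<Sum>j<N. (B ^\<^sub>m Suc k) $$ (j, j)) = (\<Sum>j<N. \<Sum>i<N. (B ^\<^sub>m k) $$ (j, i) * B $$ (i, j))"
      using B Bk[of k] by (intro sum.cong) (auto simp: scalar_prod_def lessThan_atLeast0)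
    also have "\<dots> = (\<Sum>i<N. \<Sum>j<N. B $$ (i, j) * (B ^\<^sub>m k) $$ (j, i))"
      by (subst sum.swap) (simp add: mult.commute)
    also have "\<dots> = fps_nth (\<Sum>i<N. \<Sum>j<N. fps_const (B $$ (i, j)) * G $$ (j, i)) k"
      by (simp add: fps_sum_nth G_def)
    finally show "fps_nth (\<Sum>i<N. \<Sum>j<N. fps_const (B $$ (i, j)) * G $$ (j, i)) k = fps_nth 0 k"
      using tr[of "Suc k"] by simp
  qed
  finally have "fps_nth (fps_deriv D) k = 0" for k by simp
  \<comment> \<open>Only \<open>Suc k\<close> times the coefficient is known to vanish, which is why
    multiples must be cancellable in the coefficient ring.\<close>
  then have D_Suc: "fps_nth D (Suc k) = 0" for k
    using tf[of k] by (simp add: fps_deriv_nth)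
  have D0: "fps_nth D 0 = 1"
  proof -
    interpret h: comm_ring_hom "\<lambda>f :: 'c fps. fps_nth f 0"
      by unfold_locales (simp_all add: fps_mult_nth)
    have "map_mat (\<lambda>f. fps_nth f 0) M = 1\<^sub>m N"
      by (rule eq_matI) (simp_all add: M_def)
    then show ?thesis unfolding D_def by (simp flip: h.hom_det)
  qed
  have "D = 1"
  proof (rule fps_ext)
    show "fps_nth D k = fps_nth 1 k" for k using D0 D_Suc by (cases k) simp_all
  qed
  moreover have "1 \<cdot>\<^sub>m G = G" by (rule eq_matI) simp_all
  ultimately have GA: "G = adj_mat M" using DG by simp
  show ?thesis
  proof (rule eq_matI)
    fix i j assume "i < dim_row (0\<^sub>m N N :: 'c mat)" "j < dim_col (0\<^sub>m N N :: 'c mat)"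
    then have ij: "i < N" "j < N" by simp_all
    have "(B ^\<^sub>m N) $$ (i, j) = fps_nth (G $$ (i, j)) N" using ij by (simp add: G_def)
    also have "\<dots> = fps_nth ((- 1) ^ (j + i) * det (mat_delete M j i)) N"
      using ij M unfolding GA by (simp add: adj_mat_def cofactor_def)
    also have "\<dots> = (- 1) ^ (j + i) * fps_nth (det (mat_delete M j i)) N"
      using fps_nth_of_int_mult[of "(- 1) ^ (j + i)" "det (mat_delete M j i)" N] by simp
    also have "fps_nth (det (mat_delete M j i)) N = 0"
    proof (rule fps_det_linear_nth)
      show "mat_delete M j i \<in> carrier_mat (N - 1) (N - 1)"
        using M by (simp add: mat_delete_def)
      show "fps_nth (mat_delete M j i $$ (i', j')) k = 0" if "i' < N - 1" "j' < N - 1" "1 < k" for i' j' k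
        using that M by (auto simp: mat_delete_def M_def)
      show "N - 1 < N" using ij by simp
    qed
    finally show "(B ^\<^sub>m N) $$ (i, j) = 0\<^sub>m N N $$ (i, j)" using ij by simp
  qed (use B in simp_all)
qed

section \<open>The even part of the Grassmann algebra\<close>

text \<open>In an exterior algebra with basis vectors e_T, the product of e_T and e_U for disjoint
  finite \<open>T\<close> and \<open>U\<close> is this sign times the basis vector of the
  union.\<close>

definition shuffle_sign :: "nat set \<Rightarrow> nat set \<Rightarrow> 'c::comm_ring_1" where
  "shuffle_sign T U = (- 1) ^ card {(t, u). t \<in> T \<and> u \<in> U \<and> u < t}"

lemma finite_shuffle_pairs: "finite T \<Longrightarrow> finite U \<Longrightarrow> finite {(t, u). t \<in> T \<and> u \<in> U \<and> u < t}"
  by (rule finite_subset[of _ "T \<times> U"]) auto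

lemma shuffle_sign_union_left:
  assumes "finite T" "finite T'" "finite U" "T \<inter> T' = {}"
  shows "shuffle_sign (T \<union> T') U = shuffle_sign T U * shuffle_sign T' U"
proof -
  have "{(t, u). t \<in> T \<union> T' \<and> u \<in> U \<and> u < t} =
      {(t, u). t \<in> T \<and> u \<in> U \<and> u < t} \<union> {(t, u). t \<in> T' \<and> u \<in> U \<and> u < t}" by auto
  then have "card {(t, u). t \<in> T \<union> T' \<and> u \<in> U \<and> u < t} =
      card {(t, u). t \<in> T \<and> u \<in> U \<and> u < t} + card {(t, u). t \<in> T' \<and> u \<in> U \<and> u < t}"
    using assms by (auto intro!: card_Un_disjoint finite_shuffle_pairs)
  then show ?thesis by (simp add: shuffle_sign_def power_add)
qed

lemma shuffle_sign_union_right: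
  assumes "finite T" "finite U" "finite U'" "U \<inter> U' = {}"
  shows "shuffle_sign T (U \<union> U') = shuffle_sign T U * shuffle_sign T U'"
proof -
  have "{(t, u). t \<in> T \<and> u \<in> U \<union> U' \<and> u < t} =
      {(t, u). t \<in> T \<and> u \<in> U \<and> u < t} \<union> {(t, u). t \<in> T \<and> u \<in> U' \<and> u < t}" by auto
  then have "card {(t, u). t \<in> T \<and> u \<in> U \<union> U' \<and> u < t} =
      card {(t, u). t \<in> T \<and> u \<in> U \<and> u < t} + card {(t, u). t \<in> T \<and> u \<in> U' \<and> u < t}"
    using assms by (auto intro!: card_Un_disjoint finite_shuffle_pairs)
  then show ?thesis by (simp add: shuffle_sign_def power_add)
qed

lemma shuffle_sign_empty [simp]: "shuffle_sign {} U = 1" "shuffle_sign T {} = 1"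
  by (simp_all add: shuffle_sign_def)

lemma shuffle_sign_square [simp]: "shuffle_sign T U * shuffle_sign T U = 1"
  by (simp add: shuffle_sign_def flip: power_mult_distrib)

text \<open>As the sets are disjoint, each pair in \<open>T \<times> U\<close> is an inversion for
  exactly one of the two orders.\<close>

lemma shuffle_sign_swap:
  assumes "finite T" "finite U" "T \<inter> U = {}"
  shows "shuffle_sign U T = (- 1) ^ (card T * card U) * (shuffle_sign T U :: 'c::comm_ring_1)"
proof -
  let ?A = "{(t, u). t \<in> T \<and> u \<in> U \<and> u < t}" and ?B = "{(u, t). u \<in> U \<and> t \<in> T \<and> t < u}"
  have un: "?A \<union> prod.swap ` ?B = T \<times> U"
  proof (intro equalityI subsetI)
    fix z assume "z \<in> T \<times> U"
    then obtain t u where z: "z = (t, u)" "t \<in> T" "u \<in> U" by blast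
    then have "t \<noteq> u" using assms by blast
    then consider "u < t" | "t < u" by linarith
    then show "z \<in> ?A \<union> prod.swap ` ?B"
    proof cases
      case 2
      then have "z = prod.swap (u, t)" "(u, t) \<in> ?B" using z by auto
      then show ?thesis by blast
    qed (use z in auto)
  qed auto
  have "card (T \<times> U) = card ?A + card (prod.swap ` ?B)"
    unfolding un[symmetric] using finite_shuffle_pairs[of T U] finite_shuffle_pairs[of U T] assms
    by (intro card_Un_disjoint) auto
  also have "card (prod.swap ` ?B) = card ?B" by (simp add: card_image)
  finally have c: "card T * card U = card ?A + card ?B" by (simp add: card_cartesian_product)
  have "(- 1) ^ (card T * card U) = (shuffle_sign T U * shuffle_sign U T :: 'c)"
    unfolding shuffle_sign_def c power_add by (rule refl)
  then have "(- 1) ^ (card T * card U) * shuffle_sign T U =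
      shuffle_sign U T * (shuffle_sign T U * shuffle_sign T U :: 'c)"
    by (simp only: mult_ac)
  then show ?thesis by simp
qed

text \<open>Only even degrees are kept, so that the product is commutative and determinants make
  sense; rational coefficients allow cancelling multiples. Infinitely many coefficients may be
  nonzero, since each coefficient of a product involves only the subsets of one finite set.\<close>

typedef even_grassmann = "{f :: nat set \<Rightarrow> rat. \<forall>S. f S \<noteq> 0 \<longrightarrow> finite S \<and> even (card S)}"
  morphisms gcoeff Grassmann
  by (rule exI[of _ "\<lambda>S. 0"]) simp

setup_lifting type_definition_even_grassmann

lemma gcoeff_support: "gcoeff f S \<noteq> 0 \<Longrightarrow> finite S \<and> even (card S)"
  using gcoeff[of f] by blast

lemma gcoeff_eqI: "(\<And>S. finite S \<Longrightarrow> gcoeff f S = gcoeff g S) \<Longrightarrow> f = g"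
  by (metis gcoeff_inject gcoeff_support ext)

lemma grassmann_mult_support:
  fixes f g :: "nat set \<Rightarrow> rat"
  assumes f: "\<And>S. f S \<noteq> 0 \<Longrightarrow> finite S \<and> even (card S)" and g: "\<And>S. g S \<noteq> 0 \<Longrightarrow> finite S \<and> even (card S)"
    and S: "(if finite S then \<Sum>T\<in>Pow S. shuffle_sign T (S - T) * f T * g (S - T) else 0) \<noteq> 0"
  shows "finite S \<and> even (card S)"
proof -
  have fin: "finite S" by (rule ccontr) (use S in simp)
  then have "(\<Sum>T\<in>Pow S. shuffle_sign T (S - T) * f T * g (S - T)) \<noteq> 0" using S by simp
  then obtain T where "T \<in> Pow S" "shuffle_sign T (S - T) * f T * g (S - T) \<noteq> 0"
    by (rule sum.not_neutral_contains_not_neutral)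
  then have T: "T \<subseteq> S" "f T \<noteq> 0" "g (S - T) \<noteq> 0" by simp_all
  have "card (T \<union> (S - T)) = card T + card (S - T)"
    using T fin by (intro card_Un_disjoint) (auto intro: finite_subset)
  moreover have "T \<union> (S - T) = S" using T by blast
  ultimately show ?thesis using fin f[OF T(2)] g[OF T(3)] by simp
qed

instantiation even_grassmann :: comm_ring_1
begin

lift_definition zero_even_grassmann :: even_grassmann is "\<lambda>S. 0" by simp
lift_definition one_even_grassmann :: even_grassmann is "\<lambda>S. of_bool (S = {})" by simp
lift_definition plus_even_grassmann :: "even_grassmann \<Rightarrow> even_grassmann \<Rightarrow> even_grassmann"
  is "\<lambda>f g S. f S + g S" by (metis add.right_neutral)
lift_definition minus_even_grassmann :: "even_grassmann \<Rightarrow> even_grassmann \<Rightarrow> even_grassmann"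
  is "\<lambda>f g S. f S - g S" by (metis diff_zero right_minus_eq)
lift_definition uminus_even_grassmann :: "even_grassmann \<Rightarrow> even_grassmann"
  is "\<lambda>f S. - f S" by simp
lift_definition times_even_grassmann :: "even_grassmann \<Rightarrow> even_grassmann \<Rightarrow> even_grassmann"
  is "\<lambda>f g S. if finite S then \<Sum>T\<in>Pow S. shuffle_sign T (S - T) * f T * g (S - T) else 0"
  by (rule grassmann_mult_support)

lemma gcoeff_simps:
  "gcoeff 0 S = 0" "gcoeff 1 S = of_bool (S = {})"
  "gcoeff (f + g) S = gcoeff f S + gcoeff g S"
  "gcoeff (f - g) S = gcoeff f S - gcoeff g S"
  "gcoeff (- f) S = - gcoeff f S"
  by (simp_all add: zero_even_grassmann.rep_eq one_even_grassmann.rep_eq plus_even_grassmann.rep_eq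
      minus_even_grassmann.rep_eq uminus_even_grassmann.rep_eq)

lemma gcoeff_mult:
  "finite S \<Longrightarrow> gcoeff (f * g) S = (\<Sum>T\<in>Pow S. shuffle_sign T (S - T) * gcoeff f T * gcoeff g (S - T))"
  by (simp add: times_even_grassmann.rep_eq)

instance
proof
  fix f g h :: even_grassmann
  show "f * g * h = f * (g * h)"
  proof (rule gcoeff_eqI)
    fix S :: "nat set" assume S: "finite S"
    \<comment> \<open>Both bracketings become sums over ordered partitions of \<open>S\<close> into
      three blocks, with the product of the three pairwise shuffle signs.\<close>
    let ?t = "\<lambda>A B C. shuffle_sign A B * shuffle_sign A C * shuffle_sign B C *
      gcoeff f A * gcoeff g B * gcoeff h C"
    have fin: "T \<subseteq> S \<Longrightarrow> finite T" for T using S finite_subset by blast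
    have "gcoeff (f * g * h) S = (\<Sum>T\<in>Pow S. \<Sum>A\<in>Pow T. ?t A (T - A) (S - T))"
    proof (subst gcoeff_mult[OF S], rule sum.cong[OF refl])
      fix T assume T: "T \<in> Pow S"
      have "shuffle_sign T (S - T) = shuffle_sign A (S - T) * (shuffle_sign (T - A) (S - T) :: rat)"
        if "A \<subseteq> T" for A
        using shuffle_sign_union_left[of A "T - A" "S - T"] that T fin[of A] fin[of T] fin
        by (auto simp: Un_absorb1)
      then show "shuffle_sign T (S - T) * gcoeff (f * g) T * gcoeff h (S - T) =
          (\<Sum>A\<in>Pow T. ?t A (T - A) (S - T))"
        using T fin by (simp add: gcoeff_mult sum_distrib_left sum_distrib_right ac_simps)
    qed
    also have "\<dots> = (\<Sum>(T, A)\<in>(SIGMA T:Pow S. Pow T). ?t A (T - A) (S - T))"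
      using S fin by (intro sum.Sigma) auto
    also have "\<dots> = (\<Sum>(A, B)\<in>(SIGMA A:Pow S. Pow (S - A)). ?t A B (S - A - B))"
    proof (rule sum.reindex_bij_witness[where i = "\<lambda>(A, B). (A \<union> B, A)" and j = "\<lambda>(T, A). (A, T - A)"], goal_cases)
      case (3 x)
      then show ?case by (cases x) (simp, blast)
    next
      case (5 x)
      then obtain T A where x: "x = (T, A)" "A \<subseteq> T" by (cases x) auto
      then have "S - A - (T - A) = S - T" by blast
      then show ?case using x by simp
    qed (auto simp: Un_absorb1)
    also have "\<dots> = (\<Sum>A\<in>Pow S. \<Sum>B\<in>Pow (S - A). ?t A B (S - A - B))"
      using S fin by (intro sum.Sigma[symmetric]) auto
    also have "\<dots> = gcoeff (f * (g * h)) S"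
    proof (subst gcoeff_mult[OF S], rule sum.cong[OF refl])
      fix A assume A: "A \<in> Pow S"
      have "shuffle_sign A (S - A) = shuffle_sign A B * (shuffle_sign A (S - A - B) :: rat)"
        if "B \<subseteq> S - A" for B
      proof -
        have "S - A = B \<union> (S - A - B)" using that by auto
        moreover have "finite A" "finite B" "finite (S - A - B)"
          using A that S fin[of A] fin[of B] by blast+
        ultimately show ?thesis using shuffle_sign_union_right[of A B "S - A - B"] by auto
      qed
      then show "(\<Sum>B\<in>Pow (S - A). ?t A B (S - A - B)) = shuffle_sign A (S - A) * gcoeff f A * gcoeff (g * h) (S - A)"
        using S by (simp add: gcoeff_mult sum_distrib_left sum_distrib_right ac_simps)
    qed
    finally show "gcoeff (f * g * h) S = gcoeff (f * (g * h)) S" .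
  qed
  show "f * g = g * f"
  proof (rule gcoeff_eqI)
    fix S :: "nat set" assume S: "finite S"
    have "gcoeff (f * g) S = (\<Sum>T\<in>Pow S. shuffle_sign (S - T) T * gcoeff f (S - T) * gcoeff g T)"
      unfolding gcoeff_mult[OF S]
      by (rule sum.reindex_bij_witness[where i = "\<lambda>T. S - T" and j = "\<lambda>T. S - T"])
        (auto simp: double_diff)
    also have "\<dots> = gcoeff (g * f) S"
      unfolding gcoeff_mult[OF S]
    proof (rule sum.cong[OF refl])
      fix T assume T: "T \<in> Pow S"
      \<comment> \<open>Odd \<open>T\<close> contribute nothing because their coefficient is zero;
        for even \<open>T\<close> the swap has sign 1.\<close>
      have "(shuffle_sign (S - T) T :: rat) = shuffle_sign T (S - T)" if "gcoeff g T \<noteq> 0"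
        using shuffle_sign_swap[of T "S - T"] gcoeff_support[OF that] S T by auto
      then show "shuffle_sign (S - T) T * gcoeff f (S - T) * gcoeff g T =
          shuffle_sign T (S - T) * gcoeff g T * gcoeff f (S - T)" by auto
    qed
    finally show "gcoeff (f * g) S = gcoeff (g * f) S" .
  qed
  show "1 * f = f"
  proof (rule gcoeff_eqI)
    fix S :: "nat set" assume S: "finite S"
    have "gcoeff (1 * f) S = (\<Sum>T\<in>Pow S. if T = {} then gcoeff f S else 0)"
      unfolding gcoeff_mult[OF S] by (intro sum.cong) (auto simp: gcoeff_simps)
    then show "gcoeff (1 * f) S = gcoeff f S" using S by simp
  qed
  show "(f + g) * h = f * h + g * h"
    by (rule gcoeff_eqI) (simp add: gcoeff_mult gcoeff_simps algebra_simps sum.distrib)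
  show "(0 :: even_grassmann) \<noteq> 1"
  proof
    assume "(0 :: even_grassmann) = 1"
    then have "gcoeff 0 {} = gcoeff 1 {}" by simp
    then show False by (simp add: gcoeff_simps)
  qed
qed (auto intro!: gcoeff_eqI simp: gcoeff_simps)

end

lemma gcoeff_sum: "gcoeff (\<Sum>x\<in>A. f x) S = (\<Sum>x\<in>A. gcoeff (f x) S)"
  by (induction A rule: infinite_finite_induct) (simp_all add: gcoeff_simps)

lemma even_grassmann_torsion_free:
  assumes "of_nat (Suc k) * x = (0 :: even_grassmann)"
  shows "x = 0"
proof (rule gcoeff_eqI)
  fix S
  have "gcoeff (of_nat k * x) S = of_nat k * gcoeff x S" for k
    by (induction k) (simp_all add: gcoeff_simps algebra_simps)
  from this[of "Suc k"] show "gcoeff x S = gcoeff 0 S"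
    using assms by (simp add: gcoeff_simps del: of_nat_Suc)
qed

section \<open>The Amitsur--Levitzki theorem\<close>

fun word_sign :: "nat list \<Rightarrow> 'c::comm_ring_1" where
  "word_sign [] = 1"
| "word_sign (x # w) = shuffle_sign {x} (set w) * word_sign w"

lemma word_sign_append:
  "distinct (u @ v) \<Longrightarrow> word_sign (u @ v) = shuffle_sign (set u) (set v) * word_sign u * word_sign v"
proof (induction u)
  case (Cons x u)
  have "shuffle_sign {x} (set u \<union> set v) = shuffle_sign {x} (set u) * (shuffle_sign {x} (set v) :: 'a)"
    using Cons.prems by (intro shuffle_sign_union_right) auto
  moreover have "shuffle_sign (insert x (set u)) (set v) = shuffle_sign {x} (set v) * (shuffle_sign (set u) (set v) :: 'a)"
    using shuffle_sign_union_left[of "{x}" "set u" "set v"] Cons.prems by simp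
  ultimately show ?case using Cons by (simp add: ac_simps)
qed simp

fun word_entry :: "nat \<Rightarrow> (nat \<Rightarrow> nat \<Rightarrow> nat \<Rightarrow> 'c::comm_ring_1) \<Rightarrow> nat list \<Rightarrow> nat \<Rightarrow> nat \<Rightarrow> 'c" where
  "word_entry N a [] i j = of_bool (i = j)"
| "word_entry N a (x # w) i j = (\<Sum>k<N. a x i k * word_entry N a w k j)"

lemma word_entry_append:
  "i < N \<Longrightarrow> word_entry N a (u @ v) i j = (\<Sum>k<N. word_entry N a u i k * word_entry N a v k j)"
proof (induction u arbitrary: i)
  case Nil
  have "(\<Sum>k<N. word_entry N a [] i k * word_entry N a v k j) = (\<Sum>k<N. if k = i then word_entry N a v k j else 0)"
    by (intro sum.cong) auto
  then show ?case using Nil by simp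
next
  case (Cons x u)
  have "word_entry N a ((x # u) @ v) i j =
      (\<Sum>l<N. \<Sum>k<N. a x i l * (word_entry N a u l k * word_entry N a v k j))"
    using Cons.IH by (simp add: sum_distrib_left)
  also have "\<dots> = (\<Sum>k<N. word_entry N a (x # u) i k * word_entry N a v k j)"
    by (subst sum.swap) (simp add: sum_distrib_right mult.assoc)
  finally show ?case .
qed

lemma word_entry_cong:
  "(\<And>x. x \<in> set w \<Longrightarrow> a x = b x) \<Longrightarrow> word_entry N a w i j = word_entry N b w i j"
  by (induction w arbitrary: i) auto

text \<open>An entry of the standard polynomial in the matrices indexed by \<open>S\<close>, with
  signs relative to the increasing order of \<open>S\<close>. Matrices are functions of their
  indices, so that coefficients of operators fit directly.\<close>

definition alt_entry :: "nat \<Rightarrow> (nat \<Rightarrow> nat \<Rightarrow> nat \<Rightarrow> 'c::comm_ring_1) \<Rightarrow> nat set \<Rightarrow> nat \<Rightarrow> nat \<Rightarrow> 'c" where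
  "alt_entry N a S i j = (\<Sum>w\<in>permutations_of_set S. word_sign w * word_entry N a w i j)"

lemma sum_permutations_split:
  assumes "finite S" "p \<le> card S"
  shows "(\<Sum>w\<in>permutations_of_set S. f w) =
    (\<Sum>T\<in>{T. T \<subseteq> S \<and> card T = p}. \<Sum>u\<in>permutations_of_set T. \<Sum>v\<in>permutations_of_set (S - T). f (u @ v))"
proof -
  let ?P = "\<lambda>T. permutations_of_set T \<times> permutations_of_set (S - T)"
  have fin: "finite {T. T \<subseteq> S \<and> card T = p}" using assms by simp
  have "(\<Sum>w\<in>permutations_of_set S. f w) =
      (\<Sum>(T, u, v)\<in>(SIGMA T:{T. T \<subseteq> S \<and> card T = p}. ?P T). f (u @ v))"
  proof (rule sum.reindex_bij_witness[where i = "\<lambda>(T, u, v). u @ v"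
        and j = "\<lambda>w. (set (take p w), take p w, drop p w)"])
    fix w assume w: "w \<in> permutations_of_set S"
    then have "set w = S" "distinct w" "length w = card S"
      by (auto simp: permutations_of_set_def distinct_card)
    moreover have "set w = set (take p w) \<union> set (drop p w)" by (metis append_take_drop_id set_append)
    moreover have "set (take p w) \<inter> set (drop p w) = {}"
      using \<open>distinct w\<close> by (metis append_take_drop_id distinct_append)
    ultimately show "(set (take p w), take p w, drop p w) \<in> (SIGMA T:{T. T \<subseteq> S \<and> card T = p}. ?P T)"
      using assms by (auto simp: permutations_of_set_def distinct_card)
  next
    fix x assume "x \<in> (SIGMA T:{T. T \<subseteq> S \<and> card T = p}. ?P T)"
    then obtain T u v where x: "x = (T, u, v)" "T \<subseteq> S" "card T = p" "set u = T" "distinct u"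
        "set v = S - T" "distinct v"
      by (auto simp: permutations_of_set_def)
    then have "length u = p" by (metis distinct_card)
    then show "(set (take p (case x of (T, u, v) \<Rightarrow> u @ v)), take p (case x of (T, u, v) \<Rightarrow> u @ v),
        drop p (case x of (T, u, v) \<Rightarrow> u @ v)) = x"
      and "(case x of (T, u, v) \<Rightarrow> u @ v) \<in> permutations_of_set S"
      using x by (auto simp: permutations_of_set_def)
  qed auto
  also have "\<dots> = (\<Sum>T\<in>{T. T \<subseteq> S \<and> card T = p}. \<Sum>(u, v)\<in>?P T. f (u @ v))"
    using fin by (subst sum.Sigma) (auto simp: case_prod_unfold)
  finally show ?thesis by (simp add: sum.cartesian_product)
qed

text \<open>A Laplace type expansion: cutting a permutation after \<open>p\<close> letters leaves
  two shorter permutations and a shuffle sign.\<close>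

lemma alt_entry_split:
  assumes "finite S" "p \<le> card S" "i < N"
  shows "alt_entry N a S i j =
    (\<Sum>T\<in>{T. T \<subseteq> S \<and> card T = p}. shuffle_sign T (S - T) *
      (\<Sum>k<N. alt_entry N a T i k * alt_entry N a (S - T) k j))"
  unfolding alt_entry_def[of N a S] sum_permutations_split[OF assms(1,2)]
proof (rule sum.cong[OF refl])
  fix T assume T: "T \<in> {T. T \<subseteq> S \<and> card T = p}"
  have "word_sign (u @ v) * word_entry N a (u @ v) i j =
      (\<Sum>k<N. shuffle_sign T (S - T) * ((word_sign u * word_entry N a u i k) * (word_sign v * word_entry N a v k j)))"
    if "u \<in> permutations_of_set T" "v \<in> permutations_of_set (S - T)" for u v
    using that T assms(3)
    by (subst word_sign_append)
      (auto simp: permutations_of_set_def word_entry_append sum_distrib_left ac_simps)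
  then have "(\<Sum>u\<in>permutations_of_set T. \<Sum>v\<in>permutations_of_set (S - T). word_sign (u @ v) * word_entry N a (u @ v) i j) =
    (\<Sum>u\<in>permutations_of_set T. \<Sum>v\<in>permutations_of_set (S - T). \<Sum>k<N.
      shuffle_sign T (S - T) * ((word_sign u * word_entry N a u i k) * (word_sign v * word_entry N a v k j)))"
    by (intro sum.cong) auto
  also have "\<dots> = (\<Sum>u\<in>permutations_of_set T. \<Sum>k<N. \<Sum>v\<in>permutations_of_set (S - T).
      shuffle_sign T (S - T) * ((word_sign u * word_entry N a u i k) * (word_sign v * word_entry N a v k j)))"
    by (intro sum.cong[OF refl] sum.swap)
  also have "\<dots> = (\<Sum>k<N. \<Sum>u\<in>permutations_of_set T. \<Sum>v\<in>permutations_of_set (S - T).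
      shuffle_sign T (S - T) * ((word_sign u * word_entry N a u i k) * (word_sign v * word_entry N a v k j)))"
    by (rule sum.swap)
  also have "\<dots> = shuffle_sign T (S - T) * (\<Sum>k<N. alt_entry N a T i k * alt_entry N a (S - T) k j)"
    unfolding alt_entry_def sum_product by (simp add: sum_distrib_left)
  finally show "(\<Sum>u\<in>permutations_of_set T. \<Sum>v\<in>permutations_of_set (S - T). word_sign (u @ v) * word_entry N a (u @ v) i j) = \<dots>" .
qed

text \<open>Moving the last letter of a word to the front preserves the trace, but for an even
  number of letters it is an odd permutation. Comparing the splits after one letter and before the
  last letter shows that the trace is its own negative.\<close>

lemma alt_entry_trace:
  fixes a :: "nat \<Rightarrow> nat \<Rightarrow> nat \<Rightarrow> rat"
  assumes S: "finite S" "even (card S)" "S \<noteq> {}"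
  shows "(\<Sum>i<N. alt_entry N a S i i) = 0"
proof -
  define tr where "tr T U = (\<Sum>i<N. \<Sum>k<N. alt_entry N a T i k * alt_entry N a U k i)" for T U
  have tr_swap: "tr T U = tr U T" for T U
    unfolding tr_def by (subst sum.swap) (simp add: mult.commute)
  have c: "1 \<le> card S" using S by (simp add: Suc_leI card_gt_0_iff)
  have split: "(\<Sum>i<N. alt_entry N a S i i) =
      (\<Sum>T\<in>{T. T \<subseteq> S \<and> card T = p}. shuffle_sign T (S - T) * tr T (S - T))" if "p \<le> card S" for p
  proof -
    have "(\<Sum>i<N. alt_entry N a S i i) = (\<Sum>i<N. \<Sum>T\<in>{T. T \<subseteq> S \<and> card T = p}. shuffle_sign T (S - T) *
        (\<Sum>k<N. alt_entry N a T i k * alt_entry N a (S - T) k i))"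
      using alt_entry_split[OF S(1) that] by (intro sum.cong) auto
    then show ?thesis unfolding tr_def sum_distrib_left by (subst (asm) sum.swap)
  qed
  have "(\<Sum>i<N. alt_entry N a S i i) =
      (\<Sum>T\<in>{T. T \<subseteq> S \<and> card T = card S - 1}. shuffle_sign T (S - T) * tr T (S - T))"
    by (rule split) simp
  also have "\<dots> = (\<Sum>T\<in>{T. T \<subseteq> S \<and> card T = 1}. shuffle_sign (S - T) T * tr (S - T) T)"
    using S(1) c
    by (intro sum.reindex_bij_witness[where i = "\<lambda>T. S - T" and j = "\<lambda>T. S - T"])
      (auto simp: double_diff card_Diff_subset finite_subset)
  also have "\<dots> = (\<Sum>T\<in>{T. T \<subseteq> S \<and> card T = 1}. - (shuffle_sign T (S - T) * tr T (S - T)))"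
  proof (rule sum.cong[OF refl])
    fix T assume T: "T \<in> {T. T \<subseteq> S \<and> card T = 1}"
    have "odd (card T * card (S - T))"
      using T S c by (auto simp: card_Diff_subset finite_subset)
    then have "shuffle_sign (S - T) T = - (shuffle_sign T (S - T) :: rat)"
      using shuffle_sign_swap[of T "S - T"] T S(1) by (auto simp: finite_subset)
    then show "shuffle_sign (S - T) T * tr (S - T) T = - (shuffle_sign T (S - T) * tr T (S - T))"
      by (simp add: tr_swap)
  qed
  also have "\<dots> = - (\<Sum>i<N. alt_entry N a S i i)"
    by (simp add: sum_negf split[OF c])
  finally show ?thesis by simp
qed

text \<open>Rosset's argument: the square of the generic odd element has entries in a commutative ring.\<close>

lemma alt_entry_rat:
  fixes a :: "nat \<Rightarrow> nat \<Rightarrow> nat \<Rightarrow> rat"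
  assumes S: "finite S" "card S = 2 * N" and ij: "i < N" "j < N"
  shows "alt_entry N a S i j = 0"
proof -
  \<comment> \<open>With A the sum of the matrices \<open>a x\<close> times the odd generators e_x,
    the coefficient of e_S in the power of A with exponent 2k is the alternating sum over the
    permutations of \<open>S\<close>. So \<open>g 1\<close> is the square of A, and
    \<open>g k\<close> is the \<open>k\<close>-th power of that.\<close>
  define g where "g k i j = Grassmann (\<lambda>S. if finite S \<and> card S = 2 * k then alt_entry N a S i j else 0)" for k i j
  have g: "gcoeff (g k i j) S = (if finite S \<and> card S = 2 * k then alt_entry N a S i j else 0)" for k i j S
    unfolding g_def by (subst Grassmann_inverse) auto
  define B where "B = mat N N (\<lambda>(i, j). g 1 i j)"
  have B: "B \<in> carrier_mat N N" by (simp add: B_def)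
  have pow: "(B ^\<^sub>m k) $$ (i, j) = g k i j" if "i < N" "j < N" for k i j
    using that
  proof (induction k arbitrary: i j)
    case 0
    then show ?case by (auto intro!: gcoeff_eqI simp: g gcoeff_simps alt_entry_def B_def)
  next
    case (Suc k)
    have "(B ^\<^sub>m Suc k) $$ (i, j) = (\<Sum>l<N. g k i l * g 1 l j)"
      using Suc B by (simp add: scalar_prod_def lessThan_atLeast0) (simp add: B_def)
    also have "\<dots> = g (Suc k) i j"
    proof (rule gcoeff_eqI)
      fix S :: "nat set" assume S: "finite S"
      let ?t = "\<lambda>T. shuffle_sign T (S - T) * (\<Sum>l<N. alt_entry N a T i l * alt_entry N a (S - T) l j)"
      have "gcoeff (\<Sum>l<N. g k i l * g 1 l j) S =
          (\<Sum>T\<in>Pow S. \<Sum>l<N. shuffle_sign T (S - T) * gcoeff (g k i l) T * gcoeff (g 1 l j) (S - T))"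
        unfolding gcoeff_sum gcoeff_mult[OF S] by (rule sum.swap)
      also have "\<dots> = (\<Sum>T\<in>Pow S. if card T = 2 * k \<and> card (S - T) = 2 then ?t T else 0)"
        using S by (intro sum.cong) (auto simp: g sum_distrib_left mult.assoc finite_subset)
      also have "\<dots> = (\<Sum>T\<in>{T \<in> Pow S. card T = 2 * k \<and> card (S - T) = 2}. ?t T)"
        using S by (subst sum.inter_filter) auto
      also have "\<dots> = (if card S = 2 * Suc k then \<Sum>T\<in>{T. T \<subseteq> S \<and> card T = 2 * k}. ?t T else 0)"
      proof (cases "card S = 2 * Suc k")
        case True
        then have "{T \<in> Pow S. card T = 2 * k \<and> card (S - T) = 2} = {T. T \<subseteq> S \<and> card T = 2 * k}"
          using S by (auto simp: card_Diff_subset finite_subset)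
        then show ?thesis using True by simp
      next
        case False
        have "\<not> (card T = 2 * k \<and> card (S - T) = 2)" if "T \<subseteq> S" for T
          using False S that by (auto simp: card_Diff_subset finite_subset)
        then have e: "{T \<in> Pow S. card T = 2 * k \<and> card (S - T) = 2} = {}" by auto
        show ?thesis unfolding e using False by simp
      qed
      also have "\<dots> = gcoeff (g (Suc k) i j) S"
        using alt_entry_split[of S "2 * k" i N a j] Suc.prems S by (auto simp: g)
      finally show "gcoeff (\<Sum>l<N. g k i l * g 1 l j) S = gcoeff (g (Suc k) i j) S" .
    qed
    finally show ?case .
  qed
  have tr: "(\<Sum>i<N. (B ^\<^sub>m k) $$ (i, i)) = 0" if k: "0 < k" for k
  proof (rule gcoeff_eqI)
    fix S :: "nat set"
    have "(\<Sum>i<N. alt_entry N a S i i) = 0" if "finite S" "card S = 2 * k"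
      using that k by (intro alt_entry_trace) auto
    then show "gcoeff (\<Sum>i<N. (B ^\<^sub>m k) $$ (i, i)) S = gcoeff 0 S"
      by (cases "finite S \<and> card S = 2 * k") (auto simp: gcoeff_sum pow g gcoeff_simps)
  qed
  have "B ^\<^sub>m N = 0\<^sub>m N N"
    by (rule nilpotent_if_traces_zero[OF B even_grassmann_torsion_free tr])
  then have "g N i j = 0" using pow[OF ij, of N] ij by simp
  then show ?thesis using g[of N i j S] S by (simp add: gcoeff_simps)
qed

lemma of_int_shuffle_sign [simp]: "of_int (shuffle_sign T U) = shuffle_sign T U"
  by (simp add: shuffle_sign_def)

lemma of_int_word_sign [simp]: "of_int (word_sign w) = word_sign w"
  by (induction w) simp_all

lemma of_int_alt_entry:
  "(of_int (alt_entry N a S i j) :: 'c::comm_ring_1) = alt_entry N (\<lambda>x k l. of_int (a x k l)) S i j"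
proof -
  have "(of_int (word_entry N a w i j) :: 'c) = word_entry N (\<lambda>x k l. of_int (a x k l)) w i j" for w
    by (induction w arbitrary: i) simp_all
  then show ?thesis by (simp add: alt_entry_def)
qed

text \<open>Multilinearity: \<open>c\<close> chooses a matrix unit for each letter. Distinct letters
  make the choice a function on the set of letters.\<close>

lemma word_entry_expand:
  assumes "distinct w" "i < N"
  shows "word_entry N a w i j =
    (\<Sum>c\<in>PiE (set w) (\<lambda>_. {..<N} \<times> {..<N}).
      (\<Prod>x\<in>set w. a x (fst (c x)) (snd (c x))) * word_entry N (\<lambda>x k l. of_bool (c x = (k, l))) w i j)"
  using assms
proof (induction w arbitrary: i)
  case (Cons x w)
  let ?R = "{..<N} \<times> {..<N}" and ?E = "\<lambda>c. word_entry N (\<lambda>x k l. of_bool (c x = (k, l)))"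
  let ?p = "\<lambda>c w. \<Prod>x\<in>set w. a x (fst (c x)) (snd (c x))"
  let ?P = "PiE (set w) (\<lambda>_. ?R)"
  have xw: "x \<notin> set w" using Cons.prems by simp
  have p: "?p (c(x := r)) (x # w) = a x (fst r) (snd r) * ?p c w" for c r
  proof -
    have "?p (c(x := r)) w = ?p c w" using xw by (intro prod.cong) auto
    then show ?thesis using xw by simp
  qed
  have E: "?E (c(x := r)) (x # w) i j = (if fst r = i then ?E c w (snd r) j else 0)" if "r \<in> ?R" for c r
  proof -
    have w: "?E (c(x := r)) w k j = ?E c w k j" for k using xw by (intro word_entry_cong) auto
    have "?E (c(x := r)) (x # w) i j = (\<Sum>k<N. of_bool (r = (i, k)) * ?E (c(x := r)) w k j)" by simp
    also have "\<dots> = (\<Sum>k<N. of_bool (r = (i, k)) * ?E c w k j)" by (simp only: w)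
    also have "\<dots> = (\<Sum>k<N. if k = snd r then (if fst r = i then ?E c w k j else 0) else 0)"
      by (intro sum.cong) (auto simp: prod_eq_iff)
    finally show ?thesis using that by auto
  qed
  have inj: "inj_on (\<lambda>(y, g). g(x := y)) (?R \<times> ?P)"
    using inj_combinator[OF xw, of "\<lambda>_. ?R"] by simp
  have "(\<Sum>c\<in>PiE (set (x # w)) (\<lambda>_. ?R). ?p c (x # w) * ?E c (x # w) i j) =
      (\<Sum>(r, c)\<in>?R \<times> ?P. ?p (c(x := r)) (x # w) * ?E (c(x := r)) (x # w) i j)"
    unfolding list.set PiE_insert_eq sum.reindex[OF inj] by (simp only: o_def case_prod_unfold)
  also have "\<dots> = (\<Sum>r\<in>?R. \<Sum>c\<in>?P. ?p (c(x := r)) (x # w) * ?E (c(x := r)) (x # w) i j)"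
    by (rule sum.cartesian_product[symmetric])
  also have "\<dots> = (\<Sum>r\<in>?R. if fst r = i then a x i (snd r) * (\<Sum>c\<in>?P. ?p c w * ?E c w (snd r) j) else 0)"
  proof (rule sum.cong[OF refl])
    fix r assume r: "r \<in> ?R"
    show "(\<Sum>c\<in>?P. ?p (c(x := r)) (x # w) * ?E (c(x := r)) (x # w) i j) =
        (if fst r = i then a x i (snd r) * (\<Sum>c\<in>?P. ?p c w * ?E c w (snd r) j) else 0)"
      unfolding p E[OF r] by (auto simp: sum_distrib_left mult.assoc)
  qed
  also have "\<dots> = (\<Sum>k<N. \<Sum>l<N. if k = i then a x i l * (\<Sum>c\<in>?P. ?p c w * ?E c w l j) else 0)"
    by (subst sum.cartesian_product) (auto intro!: sum.cong)
  also have "\<dots> = (\<Sum>l<N. \<Sum>k<N. if k = i then a x i l * (\<Sum>c\<in>?P. ?p c w * ?E c w l j) else 0)"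
    by (rule sum.swap)
  also have "\<dots> = (\<Sum>l<N. a x i l * (\<Sum>c\<in>?P. ?p c w * ?E c w l j))"
    using Cons.prems by simp
  also have "\<dots> = word_entry N a (x # w) i j"
    using Cons by simp
  finally show ?case by (rule sym)
qed simp

text \<open>By multilinearity it suffices to treat matrix units. Their alternating sums are integers
  that vanish in the rationals, hence they are 0 and stay 0 in every commutative ring.\<close>

theorem Amitsur_Levitzki:
  fixes a :: "nat \<Rightarrow> nat \<Rightarrow> nat \<Rightarrow> 'a::comm_ring_1"
  assumes S: "finite S" "card S = 2 * N" and ij: "i < N" "j < N"
  shows "alt_entry N a S i j = 0"
proof -
  let ?P = "PiE S (\<lambda>_. {..<N} \<times> {..<N})" and ?u = "\<lambda>c x k l. of_bool (c x = (k, l))"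
  have z: "alt_entry N (?u c :: nat \<Rightarrow> nat \<Rightarrow> nat \<Rightarrow> int) S i j = 0" for c
  proof -
    have "of_int (alt_entry N (?u c) S i j) = alt_entry N (\<lambda>x k l. of_int (?u c x k l) :: rat) S i j"
      by (rule of_int_alt_entry)
    then show ?thesis using alt_entry_rat[OF S ij] by simp
  qed
  have z': "alt_entry N (?u c :: nat \<Rightarrow> nat \<Rightarrow> nat \<Rightarrow> 'a) S i j = 0" for c
    using of_int_alt_entry[of N "?u c" S i j, where ?'c = 'a] by (simp add: z)
  have "alt_entry N a S i j = (\<Sum>w\<in>permutations_of_set S. \<Sum>c\<in>?P.
      (\<Prod>x\<in>S. a x (fst (c x)) (snd (c x))) * (word_sign w * word_entry N (?u c) w i j))"
    unfolding alt_entry_def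
  proof (rule sum.cong[OF refl])
    fix w assume "w \<in> permutations_of_set S"
    then have "distinct w" "set w = S" by (auto simp: permutations_of_set_def)
    then show "word_sign w * word_entry N a w i j = (\<Sum>c\<in>?P.
        (\<Prod>x\<in>S. a x (fst (c x)) (snd (c x))) * (word_sign w * word_entry N (?u c) w i j))"
      using ij by (subst word_entry_expand) (auto simp: sum_distrib_left ac_simps)
  qed
  also have "\<dots> = (\<Sum>c\<in>?P. (\<Prod>x\<in>S. a x (fst (c x)) (snd (c x))) * alt_entry N (?u c) S i j)"
    by (subst sum.swap) (simp add: alt_entry_def sum_distrib_left)
  also have "\<dots> = 0"
    by (simp add: z')
  finally show ?thesis .
qed

section \<open>Type-class rings as rings with carriers\<close>

text \<open>Lets the carrier-based notion of polynomial identity be evaluated in the type-class ring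
  of operators.\<close>

definition univ_ring :: "'a::ring_1 ring" where
  "univ_ring = \<lparr>carrier = UNIV, monoid.mult = (*), one = 1, zero = 0, add = (+)\<rparr>"

lemma univ_ring_simps [simp]:
  "carrier univ_ring = UNIV" "x \<otimes>\<^bsub>univ_ring\<^esub> y = x * y" "\<one>\<^bsub>univ_ring\<^esub> = 1"
  "\<zero>\<^bsub>univ_ring\<^esub> = 0" "x \<oplus>\<^bsub>univ_ring\<^esub> y = x + y"
  by (simp_all add: univ_ring_def)

lemma ring_univ_ring: "ring (univ_ring :: 'a::ring_1 ring)"
proof (rule ringI)
  show "abelian_group (univ_ring :: 'a ring)"
  proof (rule abelian_groupI)
    show "\<exists>y\<in>carrier univ_ring. y \<oplus>\<^bsub>univ_ring\<^esub> x = \<zero>\<^bsub>univ_ring\<^esub>" for x :: 'a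
      by (intro bexI[of _ "- x"]) simp_all
  qed (simp_all add: ac_simps)
  show "monoid (univ_ring :: 'a ring)"
    by (rule monoidI) (simp_all add: mult.assoc)
qed (simp_all add: algebra_simps)

lemma a_inv_univ_ring: "\<ominus>\<^bsub>univ_ring\<^esub> x = - (x :: 'a::ring_1)"
proof -
  interpret ring "univ_ring :: 'a ring" by (rule ring_univ_ring)
  have "- x + x = 0" by simp
  then show ?thesis using minus_equality[of "- x" x] by simp
qed

lemma finsum_univ_ring: "finite A \<Longrightarrow> finsum univ_ring f A = (sum f A :: 'a::ring_1)"
proof (induction A rule: finite_induct)
  interpret ring "univ_ring :: 'a ring" by (rule ring_univ_ring)
  case empty
  show ?case by simp
next
  interpret ring "univ_ring :: 'a ring" by (rule ring_univ_ring)
  case (insert x A)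
  then show ?case by (simp add: finsum_insert)
qed

lemma add_pow_univ_ring: "[k] \<cdot>\<^bsub>univ_ring\<^esub> x = of_int (k::int) * (x :: 'a::ring_1)"
proof -
  interpret ring "univ_ring :: 'a ring" by (rule ring_univ_ring)
  have nat: "[m] \<cdot>\<^bsub>univ_ring\<^esub> x = of_nat (m::nat) * x" for m
    by (induction m) (simp_all add: algebra_simps)
  show ?thesis
  proof (cases "k \<ge> 0")
    case True
    then have "[k] \<cdot>\<^bsub>univ_ring\<^esub> x = [nat k] \<cdot>\<^bsub>univ_ring\<^esub> x"
      by (simp add: add_pow_int_ge)
    then show ?thesis using True by (simp add: nat)
  next
    case False
    then have "[k] \<cdot>\<^bsub>univ_ring\<^esub> x = \<ominus>\<^bsub>univ_ring\<^esub> ([nat (- k)] \<cdot>\<^bsub>univ_ring\<^esub> x)"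
      by (simp add: add_pow_int_lt)
    then show ?thesis using False by (simp add: nat a_inv_univ_ring)
  qed
qed

section \<open>Evaluation of noncommutative polynomials at operators\<close>

lemma cst_simps:
  "cst (a + b) = cst a + cst b" "cst (a * b) = cst a * cst b" "cst (- a) = - cst a"
  "cst (a - b) = cst a - cst b"
  by (simp_all add: single_add mult_single single_uminus single_diff)

lemma cst_sum: "cst (\<Sum>x\<in>A. f x) = (\<Sum>x\<in>A. cst (f x))"
  by (induction A rule: infinite_finite_induct) (simp_all add: cst_simps)

definition evl :: "('x \<Rightarrow> ('i, 'g::comm_monoid_add \<Rightarrow>\<^sub>0 'k::comm_ring_1) lop) \<Rightarrow> ('x list \<Rightarrow> 'k) \<Rightarrow> ('i, 'g \<Rightarrow>\<^sub>0 'k) lop" where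
  "evl x f = (\<Sum>w\<in>{w. f w \<noteq> 0}. scl (cst (f w)) (prod_list (map x w)))"

lemma evl_superset:
  assumes "finite A" "{w. f w \<noteq> 0} \<subseteq> A"
  shows "evl x f = (\<Sum>w\<in>A. scl (cst (f w)) (prod_list (map x w)))"
  unfolding evl_def using assms by (intro sum.mono_neutral_left) (auto simp: scl_coeff_simps)

lemma evl_add:
  assumes "finite {w. f w \<noteq> 0}" "finite {w. g w \<noteq> 0}"
  shows "evl x (\<lambda>w. f w + g w) = evl x f + evl x g"
proof -
  let ?A = "{w. f w \<noteq> 0} \<union> {w. g w \<noteq> 0}"
  have A: "finite ?A" "{w. f w + g w \<noteq> 0} \<subseteq> ?A" "{w. f w \<noteq> 0} \<subseteq> ?A" "{w. g w \<noteq> 0} \<subseteq> ?A"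
    using assms by auto
  show ?thesis
    unfolding evl_superset[OF A(1,2)] evl_superset[OF A(1,3)] evl_superset[OF A(1,4)]
    by (simp add: cst_simps scl_coeff_simps sum.distrib)
qed

lemma evl_smult:
  assumes "finite {w. f w \<noteq> 0}"
  shows "evl x (\<lambda>w. c * f w) = scl (cst c) (evl x f)"
proof -
  have "{w. c * f w \<noteq> 0} \<subseteq> {w. f w \<noteq> 0}" by auto
  then show ?thesis
    by (subst evl_superset[OF assms]) (simp_all add: evl_def scl_sum scl_simps cst_simps)
qed

definition wmon :: "'x list \<Rightarrow> 'x list \<Rightarrow> 'k::comm_ring_1" where
  "wmon w = (\<lambda>v. of_bool (v = w))"

lemma evl_wmon [simp]: "evl x (wmon w) = prod_list (map x w)"
proof (cases "(1::'c) = 0")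
  case False
  have "{v. wmon w v \<noteq> (0::'c)} = {w}" by (auto simp: wmon_def)
  then show ?thesis unfolding evl_def by (simp only:) (simp add: wmon_def scl_coeff_simps)
qed simp

lemma evl_mult:
  fixes f g :: "'x list \<Rightarrow> 'k::comm_ring_1" and x :: "'x \<Rightarrow> ('i, 'g::comm_monoid_add \<Rightarrow>\<^sub>0 'k) lop"
  assumes f: "f \<in> carrier (free_algebra S)" and g: "g \<in> carrier (free_algebra S)"
  shows "evl x (f \<otimes>\<^bsub>free_algebra S\<^esub> g) = evl x f * evl x g"
proof -
  let ?A = "{w. f w \<noteq> 0}" and ?B = "{w. g w \<noteq> 0}"
  let ?T = "(\<lambda>(u, v). u @ v) ` (?A \<times> ?B)" and ?fg = "f \<otimes>\<^bsub>free_algebra S\<^esub> g"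
  let ?h = "\<lambda>u v. scl (cst (f u * g v)) (prod_list (map x (u @ v)))"
  have fin: "finite ?A" "finite ?B" using f g by (simp_all add: free_algebra_carrier_iff)
  have fg: "?fg w = (\<Sum>i\<le>length w. f (take i w) * g (drop i w))" for w
    by (simp add: free_algebra_def)
  have sub: "{w. ?fg w \<noteq> 0} \<subseteq> ?T"
  proof
    fix w assume "w \<in> {w. ?fg w \<noteq> 0}"
    then obtain i where "f (take i w) * g (drop i w) \<noteq> 0"
      unfolding fg by (metis (mono_tags, lifting) mem_Collect_eq sum.neutral)
    then have "(take i w, drop i w) \<in> ?A \<times> ?B" by auto
    then show "w \<in> ?T" by (metis (mono_tags, lifting) append_take_drop_id case_prod_conv imageI)
  qed
  have "evl x ?fg = (\<Sum>w\<in>?T. \<Sum>i\<le>length w. ?h (take i w) (drop i w))"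
    using fin by (subst evl_superset[OF _ sub])
      (auto simp: fg scl_sum_left cst_sum intro!: sum.cong simp del: map_append)
  also have "\<dots> = (\<Sum>(w, i)\<in>(SIGMA w:?T. {..length w}). ?h (take i w) (drop i w))"
    using fin by (intro sum.Sigma) auto
  also have "\<dots> = (\<Sum>(u, v)\<in>?A \<times> ?B. ?h u v)"
  \<comment> \<open>A cut of a word need not land in the two supports, so cuts correspond to pairs
    of words only after discarding vanishing summands.\<close>
  proof (rule sum.reindex_bij_witness_not_neutral[where
        S' = "{p \<in> (SIGMA w:?T. {..length w}). ?h (take (snd p) (fst p)) (drop (snd p) (fst p)) = 0}"
        and T' = "{p \<in> ?A \<times> ?B. ?h (fst p) (snd p) = 0}"
        and i = "\<lambda>(u, v). (u @ v, length u)" and j = "\<lambda>(w, i). (take i w, drop i w)"], goal_cases)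
    case (4 p)
    then obtain w i where wi: "p = (w, i)" "i \<le> length w" "?h (take i w) (drop i w) \<noteq> 0" by auto
    then have "f (take i w) * g (drop i w) \<noteq> 0" by (auto simp: scl_coeff_simps)
    then show ?case using wi by (auto simp del: map_append)
  next
    case (6 p)
    then obtain u v where uv: "p = (u, v)" "u \<in> ?A" "v \<in> ?B" "?h u v \<noteq> 0" by auto
    then have "u @ v \<in> ?T" by blast
    then show ?case using uv by simp
  next
    case (3 p)
    then show ?case by (cases p) (simp del: take_append drop_append)
  next
    case (5 p)
    then show ?case by (cases p) simp
  next
    case (9 p)
    then show ?case by (cases p) (simp del: take_append drop_append map_append)
  qed (use fin in \<open>simp_all add: case_prod_unfold\<close>)
  also have "\<dots> = evl x f * evl x g"
    unfolding evl_def sum_product sum.cartesian_product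
    by (intro sum.cong) (auto simp: scl_simps cst_simps mult.commute)
  finally show ?thesis .
qed

lemma evl_ring_hom_ring:
  fixes x :: "'x \<Rightarrow> ('i, 'g::comm_monoid_add \<Rightarrow>\<^sub>0 'k::comm_ring_1) lop"
  shows "ring_hom_ring (free_algebra S) univ_ring (evl x)"
proof (rule ring_hom_ringI[OF ring_free_algebra ring_univ_ring])
  fix f g :: "'x list \<Rightarrow> 'k"
  assume f: "f \<in> carrier (free_algebra S)" and g: "g \<in> carrier (free_algebra S)"
  show "evl x (f \<otimes>\<^bsub>free_algebra S\<^esub> g) = evl x f \<otimes>\<^bsub>univ_ring\<^esub> evl x g"
    using evl_mult[OF f g] by simp
  show "evl x (f \<oplus>\<^bsub>free_algebra S\<^esub> g) = evl x f \<oplus>\<^bsub>univ_ring\<^esub> evl x g"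
    using evl_add[of f g x] f g by (simp add: free_algebra_def)
next
  have "\<one>\<^bsub>free_algebra S\<^esub> = (wmon [] :: 'x list \<Rightarrow> 'k)" by (auto simp: free_algebra_def wmon_def)
  then show "evl x \<one>\<^bsub>free_algebra S\<^esub> = \<one>\<^bsub>univ_ring\<^esub>" by simp
qed simp

section \<open>Straightening in the quantum coordinate ring\<close>

lemma free_algebra_simps:
  "f \<oplus>\<^bsub>free_algebra S\<^esub> g = (\<lambda>w. f w + g w)"
  "c \<odot>\<^bsub>free_algebra S\<^esub> f = (\<lambda>w. c * f w)"
  "\<zero>\<^bsub>free_algebra S\<^esub> = (\<lambda>w. 0)"
  by (simp_all add: free_algebra_def)

lemma free_algebra_a_inv:
  fixes f :: "'b list \<Rightarrow> 'a::comm_ring_1"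
  assumes "f \<in> carrier (free_algebra S)"
  shows "\<ominus>\<^bsub>free_algebra S\<^esub> f = (\<lambda>w. - f w)"
proof -
  interpret ring "free_algebra S :: ('a, 'b list \<Rightarrow> 'a) module" by (rule ring_free_algebra)
  have "(\<lambda>w. - f w) \<in> carrier (free_algebra S)"
    using assms by (simp add: free_algebra_carrier_iff)
  then show ?thesis
    using assms minus_equality[of "\<lambda>w. - f w" f] by (simp add: free_algebra_simps)
qed

lemma free_algebra_minus:
  assumes "g \<in> carrier (free_algebra S)"
  shows "f \<ominus>\<^bsub>free_algebra S\<^esub> g = (\<lambda>w. f w - g w)"
  using free_algebra_a_inv[OF assms] by (simp add: a_minus_def free_algebra_simps)

lemma wmon_carrier: "set w \<subseteq> S \<Longrightarrow> wmon w \<in> carrier (free_algebra S)"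
  by (auto simp: free_algebra_carrier_iff wmon_def of_bool_def)

lemma free_gen_wmon: "free_gen x = wmon [x]"
  by (auto simp: free_gen_def wmon_def)

lemma wmon_mult: "wmon u \<otimes>\<^bsub>free_algebra S\<^esub> wmon v = wmon (u @ v)"
proof
  fix w
  have "(wmon u \<otimes>\<^bsub>free_algebra S\<^esub> wmon v) w =
      (\<Sum>i\<le>length w. if i = length u then of_bool (take i w = u \<and> drop i w = v) else 0)"
    unfolding free_algebra_def monoid.simps ring.simps wmon_def
    by (intro sum.cong) (auto simp: min_absorb2)
  also have "\<dots> = of_bool (length u \<le> length w \<and> take (length u) w = u \<and> drop (length u) w = v)"
    by simp
  also have "(length u \<le> length w \<and> take (length u) w = u \<and> drop (length u) w = v) \<longleftrightarrow> w = u @ v"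
    by (auto, metis append_take_drop_id)
  finally show "(wmon u \<otimes>\<^bsub>free_algebra S\<^esub> wmon v) w = wmon (u @ v) w" by (simp add: wmon_def)
qed

lemma free_algebra_mult_linear:
  "f \<otimes>\<^bsub>free_algebra S\<^esub> (\<lambda>w. g w - c * h w) =
    (\<lambda>w. (f \<otimes>\<^bsub>free_algebra S\<^esub> g) w - c * (f \<otimes>\<^bsub>free_algebra S\<^esub> h) w)"
  "(\<lambda>w. g w - c * h w) \<otimes>\<^bsub>free_algebra S\<^esub> f =
    (\<lambda>w. (g \<otimes>\<^bsub>free_algebra S\<^esub> f) w - c * (h \<otimes>\<^bsub>free_algebra S\<^esub> f) w)"
  by (auto simp: free_algebra_def algebra_simps sum_subtractf sum_distrib_left)

locale free_algebra_ideal =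
  fixes S :: "'x::linorder set" and J :: "('x list \<Rightarrow> 'k::comm_ring_1) set"
  assumes ideal: "ideal J (free_algebra S)"
begin

sublocale F: ring "free_algebra S :: ('k, 'x list \<Rightarrow> 'k) module"
  by (rule ring_free_algebra)

sublocale J: ideal J "free_algebra S"
  by (rule ideal)

lemma J_carrier: "f \<in> J \<Longrightarrow> f \<in> carrier (free_algebra S)"
  by (rule J.a_Hcarr)

lemma J_add: "f \<in> J \<Longrightarrow> g \<in> J \<Longrightarrow> (\<lambda>w. f w + g w) \<in> J"
  using J.a_closed by (simp add: free_algebra_simps)

lemma J_smult: "f \<in> J \<Longrightarrow> (\<lambda>w. c * f w) \<in> J"
proof -
  assume f: "f \<in> J"
  let ?c = "\<lambda>w. c * \<one>\<^bsub>free_algebra S\<^esub> w"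
  have "?c \<in> carrier (free_algebra S)"
    using smult_free_algebra_closed[OF F.one_closed, of c] by (simp add: free_algebra_simps)
  then have "?c \<otimes>\<^bsub>free_algebra S\<^esub> f \<in> J" using f J.I_l_closed by blast
  moreover have "?c \<otimes>\<^bsub>free_algebra S\<^esub> f = (\<lambda>w. c * (\<one>\<^bsub>free_algebra S\<^esub> \<otimes>\<^bsub>free_algebra S\<^esub> f) w)"
    by (auto simp: free_algebra_def sum_distrib_left mult.assoc)
  ultimately show ?thesis using J_carrier[OF f] by simp
qed

lemma J_linear: "f \<in> J \<Longrightarrow> g \<in> J \<Longrightarrow> (\<lambda>w. f w + c * g w) \<in> J"
  using J_add[OF _ J_smult] .

lemma J_zero: "(\<lambda>w. 0) \<in> J"
  using J.zero_closed by (simp add: free_algebra_simps)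

definition sorted_supp :: "('x list \<Rightarrow> 'k) \<Rightarrow> bool" where
  "sorted_supp g \<longleftrightarrow> g \<in> carrier (free_algebra S) \<and> (\<forall>w. g w \<noteq> 0 \<longrightarrow> sorted w)"

definition straight :: "('x list \<Rightarrow> 'k) \<Rightarrow> bool" where
  "straight f \<longleftrightarrow> (\<exists>g. sorted_supp g \<and> (\<lambda>w. f w - g w) \<in> J)"

lemma sorted_supp_linear:
  assumes "sorted_supp f" "sorted_supp g"
  shows "sorted_supp (\<lambda>w. f w + c * g w)"
proof -
  have "(\<lambda>w. f w + c * g w) \<in> carrier (free_algebra S)"
    using assms free_algebra_add_closed[OF _ smult_free_algebra_closed, of f S g c]
    by (simp add: sorted_supp_def free_algebra_simps)
  moreover have "sorted w" if "f w + c * g w \<noteq> 0" for w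
    using that assms unfolding sorted_supp_def by (metis add_0 mult_zero_right)
  ultimately show ?thesis by (simp add: sorted_supp_def)
qed

lemma straight_linear:
  assumes "straight f" "straight g"
  shows "straight (\<lambda>w. f w + c * g w)"
proof -
  obtain f' g' where f': "sorted_supp f'" "(\<lambda>w. f w - f' w) \<in> J"
    and g': "sorted_supp g'" "(\<lambda>w. g w - g' w) \<in> J"
    using assms unfolding straight_def by blast
  have "(\<lambda>w. f w - f' w + c * (g w - g' w)) \<in> J" by (rule J_linear[OF f'(2) g'(2)])
  moreover have "(\<lambda>w. f w - f' w + c * (g w - g' w)) = (\<lambda>w. f w + c * g w - (f' w + c * g' w))"
    by (simp add: algebra_simps)
  ultimately have "(\<lambda>w. f w + c * g w - (f' w + c * g' w)) \<in> J" by (simp only:)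
  then show ?thesis
    using sorted_supp_linear[OF f'(1) g'(1), of c] unfolding straight_def by blast
qed

lemma straight_J:
  assumes "straight g" "(\<lambda>w. f w - g w) \<in> J"
  shows "straight f"
proof -
  obtain h where h: "sorted_supp h" "(\<lambda>w. g w - h w) \<in> J"
    using assms(1) unfolding straight_def by blast
  have "(\<lambda>w. f w - h w) \<in> J"
    using J_add[OF assms(2) h(2)] by simp
  then show ?thesis using h(1) unfolding straight_def by blast
qed

lemma straight_zero: "straight (\<lambda>w. 0)"
  unfolding straight_def sorted_supp_def using J_zero F.zero_closed
  by (intro exI[of _ "\<lambda>w. 0"]) (simp add: free_algebra_simps)

lemma straight_sorted_wmon: "sorted w \<Longrightarrow> set w \<subseteq> S \<Longrightarrow> straight (wmon w)"
  unfolding straight_def sorted_supp_def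
  by (intro exI[of _ "wmon w"] conjI wmon_carrier) (auto simp: J_zero wmon_def of_bool_def split: if_splits)

text \<open>
  Each relation rewrites a descent \<open>x > y\<close> to words with a smaller first letter, so words of a fixed
  length decrease lexicographically.
\<close>

lemma straight_all:
  assumes fin: "finite S"
    and rel: "\<And>x y. x \<in> S \<Longrightarrow> y \<in> S \<Longrightarrow> y < x \<Longrightarrow> \<exists>u v u' v' c d. {u, v, u', v'} \<subseteq> S \<and> u < x \<and> u' < x \<and>
      (\<lambda>w. wmon [x, y] w - c * wmon [u, v] w - d * wmon [u', v'] w) \<in> J"
    and f: "f \<in> carrier (free_algebra S)"
  shows "straight f"
proof -
  have word: "straight (wmon w)" if "set w \<subseteq> S" for w
  proof -
    \<comment> \<open>Restricted to the finite set \<open>S\<close>, the strict order on letters is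
      well-founded.\<close>
    let ?r = "{(a, b). a \<in> S \<and> b \<in> S \<and> a < b}"
    have "?r \<subseteq> S \<times> S" by auto
    then have "finite ?r" using fin finite_subset by blast
    moreover have "acyclic (?r\<inverse>)"
      by (rule acyclicI_order[of _ "\<lambda>x. x"]) auto
    then have "acyclic ?r" by simp
    ultimately have "wf ?r" by (rule finite_acyclic_wf)
    then have "wf (lenlex ?r)" by (rule wf_lenlex)
    then show ?thesis using that
    proof (induction w rule: wf_induct_rule)
      case (less w)
      show ?case
      proof (cases "sorted w")
        case True
        then show ?thesis using less straight_sorted_wmon by blast
      next
        case False
        then obtain i where i: "Suc i < length w" "w ! Suc i < w ! i"
          by (metis not_le sorted_iff_nth_Suc)
        define x y a b where "x = w ! i" and "y = w ! Suc i" and "a = take i w" and "b = drop (Suc (Suc i)) w"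
        have w: "w = a @ [x, y] @ b"
          using i unfolding x_def y_def a_def b_def
          by (simp add: Cons_nth_drop_Suc id_take_nth_drop)
        have S: "x \<in> S" "y \<in> S" "set a \<subseteq> S" "set b \<subseteq> S" using less.prems w by auto
        have yx: "y < x" using i by (simp add: x_def y_def)
        obtain u v u' v' c d where *: "{u, v, u', v'} \<subseteq> S \<and> u < x \<and> u' < x \<and>
            (\<lambda>w. wmon [x, y] w - c * wmon [u, v] w - d * wmon [u', v'] w) \<in> J"
          using rel[OF S(1,2) yx] by (elim exE)
        note uv = *[THEN conjunct1] *[THEN conjunct2, THEN conjunct1]
          *[THEN conjunct2, THEN conjunct2, THEN conjunct1]
        note J = *[THEN conjunct2, THEN conjunct2, THEN conjunct2]
        have lex: "(a @ [u, v] @ b, w) \<in> lenlex ?r" if "u \<in> S" "u < x" for u v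
          unfolding w lenlex_conv lex_conv using that S by auto
        have "wmon a \<otimes>\<^bsub>free_algebra S\<^esub> (\<lambda>w. wmon [x, y] w - c * wmon [u, v] w - d * wmon [u', v'] w)
            \<otimes>\<^bsub>free_algebra S\<^esub> wmon b \<in> J"
          using J S by (intro J.I_r_closed J.I_l_closed wmon_carrier)
        then have J': "(\<lambda>t. wmon w t - (c * wmon (a @ [u, v] @ b) t + d * wmon (a @ [u', v'] @ b) t)) \<in> J"
          unfolding free_algebra_mult_linear wmon_mult by (simp add: w diff_diff_eq)
        have "straight (wmon (a @ [u, v] @ b))" "straight (wmon (a @ [u', v'] @ b))"
          using uv S less.prems by (auto intro!: less.IH lex[simplified])
        then have "straight (\<lambda>t. c * wmon (a @ [u, v] @ b) t + d * wmon (a @ [u', v'] @ b) t)"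
          using straight_linear[OF straight_linear[OF straight_zero], of _ _ c d] by simp
        then show ?thesis using J' by (rule straight_J)
      qed
    qed
  qed
  have "straight (\<lambda>w. \<Sum>v\<in>A. f v * wmon v w)" if "finite A" "\<forall>v\<in>A. set v \<subseteq> S" for A
    using that
  proof (induction A rule: finite_induct)
    case (insert v A)
    then show ?case using straight_linear[of "\<lambda>w. \<Sum>v\<in>A. f v * wmon v w" "wmon v" "f v"] word[of v]
      by (simp add: add.commute)
  qed (simp add: straight_zero)
  then have "straight (\<lambda>w. \<Sum>v\<in>{v. f v \<noteq> 0}. f v * wmon v w)"
    using f by (auto simp: free_algebra_carrier_iff)
  moreover have "(\<Sum>v\<in>{v. f v \<noteq> 0}. f v * wmon v w) = f w" for w
  proof -
    have "(\<Sum>v\<in>{v. f v \<noteq> 0}. f v * wmon v w) = (\<Sum>v\<in>{v. f v \<noteq> 0}. if v = w then f w else 0)"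
      by (intro sum.cong) (auto simp: wmon_def)
    then show ?thesis using f by (simp add: free_algebra_carrier_iff)
  qed
  ultimately show ?thesis by simp
qed

end

section \<open>The representation of the quantum coordinate ring\<close>

context quantum_torus
begin

abbreviation FA :: "('k, (nat \<times> nat) list \<Rightarrow> 'k) module" where
  "FA \<equiv> free_algebra (matrix_indices n)"

definition gens :: "nat \<times> nat \<Rightarrow> (nat \<times> nat \<Rightarrow> int, 'k laurent) lop" where
  "gens = (\<lambda>(i, j). xr n i j)"

abbreviation par :: "nat \<Rightarrow> nat \<Rightarrow> 'k" where
  "par \<equiv> \<lambda>i j. if i > j then q else if i = j then 1 else inverse q"

abbreviation rels :: "((nat \<times> nat) list \<Rightarrow> 'k) set" where
  "rels \<equiv> quantum_matrix_relators n (inverse (q ^ 2)) par"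

definition qideal :: "((nat \<times> nat) list \<Rightarrow> 'k) set" where
  "qideal = genideal FA rels"

sublocale FA: ring FA by (rule ring_free_algebra)

lemma word2_carrier:
  "{l, m, i, j} \<subseteq> {1..n} \<Longrightarrow> wmon [(l, m), (i, j)] \<in> carrier FA"
  by (rule wmon_carrier) (auto simp: matrix_indices_def)

lemma smult_word2_carrier:
  "{l, m, i, j} \<subseteq> {1..n} \<Longrightarrow> (\<lambda>w. c * wmon [(l, m), (i, j)] w) \<in> carrier FA"
  using smult_free_algebra_closed[OF word2_carrier] by (simp add: free_algebra_simps)

lemma free_gen_mult:
  "free_gen x \<otimes>\<^bsub>FA\<^esub> free_gen y = wmon [x, y]"
  by (simp add: free_gen_wmon wmon_mult)

text \<open>For one parameter the diagonal coefficients are q times its inverse, that is 1, and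
  \<open>(inverse (q ^ 2) - 1) * q = inverse q - q\<close>. The explicit factor 1 matches the
  three-term shape expected by the straightening lemma.\<close>

lemma relator_diag:
  assumes "{l, m, i, j} \<subseteq> {1..n}" "l > i" "m > j"
  shows "(\<lambda>w. wmon [(l, m), (i, j)] w - 1 * wmon [(i, j), (l, m)] w
      - (inverse q - q) * wmon [(i, m), (l, j)] w) \<in> rels"
proof -
  have c: "(\<lambda>w. c * wmon [(i, j), (l, m)] w + d * wmon [(i, m), (l, j)] w) \<in> carrier FA" for c d
    using free_algebra_add_closed[OF smult_word2_carrier[of i j l m c] smult_word2_carrier[of i m l j d]] assms
    by (simp add: free_algebra_simps)
  have e: "par l i * par j m = 1" "(inverse (q ^ 2) - 1) * par l i = inverse q - q"
    using q assms by (simp_all add: field_simps power2_eq_square)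
  have "wmon [(l, m), (i, j)] \<ominus>\<^bsub>FA\<^esub> ((par l i * par j m) \<odot>\<^bsub>FA\<^esub> wmon [(i, j), (l, m)] \<oplus>\<^bsub>FA\<^esub>
      ((inverse (q ^ 2) - 1) * par l i) \<odot>\<^bsub>FA\<^esub> wmon [(i, m), (l, j)]) \<in> rels"
    unfolding quantum_matrix_relators_def Let_def free_gen_mult using assms by blast
  then show ?thesis
    unfolding e free_algebra_simps free_algebra_minus[OF c] by (simp add: diff_diff_eq)
qed

lemma relator_anti:
  assumes "{l, m, i, j} \<subseteq> {1..n}" "l > i" "m \<le> j"
  shows "(\<lambda>w. wmon [(l, m), (i, j)] w - (if m = j then inverse q else 1) * wmon [(i, j), (l, m)] w) \<in> rels"
proof -
  have e: "inverse (q ^ 2) * par l i * par j m = (if m = j then inverse q else 1)"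
    using q assms by (simp add: field_simps power2_eq_square)
  have "wmon [(l, m), (i, j)] \<ominus>\<^bsub>FA\<^esub> (inverse (q ^ 2) * par l i * par j m) \<odot>\<^bsub>FA\<^esub> wmon [(i, j), (l, m)] \<in> rels"
    unfolding quantum_matrix_relators_def Let_def free_gen_mult using assms by blast
  moreover have "{i, j, l, m} \<subseteq> {1..n}" using assms by auto
  ultimately show ?thesis
    unfolding e free_algebra_simps by (simp only: free_algebra_minus[OF smult_word2_carrier])
qed

lemma relator_row:
  assumes "{l, m, i, j} \<subseteq> {1..n}" "l = i" "m > j"
  shows "(\<lambda>w. wmon [(l, m), (i, j)] w - inverse q * wmon [(i, j), (l, m)] w) \<in> rels"
proof -
  have e: "par j m = inverse q" using assms by simp
  have "wmon [(l, m), (i, j)] \<ominus>\<^bsub>FA\<^esub> par j m \<odot>\<^bsub>FA\<^esub> wmon [(i, j), (l, m)] \<in> rels"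
    unfolding quantum_matrix_relators_def Let_def free_gen_mult using assms by blast
  moreover have "{i, j, l, m} \<subseteq> {1..n}" using assms by auto
  ultimately show ?thesis
    unfolding e free_algebra_simps by (simp only: free_algebra_minus[OF smult_word2_carrier])
qed

lemma relator_cases:
  assumes "f \<in> rels"
  obtains (diag) l m i j where "{l, m, i, j} \<subseteq> {1..n}" "l > i" "m > j"
      "f = (\<lambda>w. wmon [(l, m), (i, j)] w - 1 * wmon [(i, j), (l, m)] w
        - (inverse q - q) * wmon [(i, m), (l, j)] w)"
  | (anti) l m i j where "{l, m, i, j} \<subseteq> {1..n}" "l > i" "m \<le> j"
      "f = (\<lambda>w. wmon [(l, m), (i, j)] w - (if m = j then inverse q else 1) * wmon [(i, j), (l, m)] w)"
  | (row) l m i j where "{l, m, i, j} \<subseteq> {1..n}" "l = i" "m > j"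
      "f = (\<lambda>w. wmon [(l, m), (i, j)] w - inverse q * wmon [(i, j), (l, m)] w)"
proof -
  have "((\<exists>l m i j. f = wmon [(l, m), (i, j)] \<ominus>\<^bsub>FA\<^esub> ((par l i * par j m) \<odot>\<^bsub>FA\<^esub> wmon [(i, j), (l, m)] \<oplus>\<^bsub>FA\<^esub>
        ((inverse (q ^ 2) - 1) * par l i) \<odot>\<^bsub>FA\<^esub> wmon [(i, m), (l, j)]) \<and>
        {l, m, i, j} \<subseteq> {1..n} \<and> l > i \<and> m > j) \<or>
      (\<exists>l m i j. f = wmon [(l, m), (i, j)] \<ominus>\<^bsub>FA\<^esub>
        (inverse (q ^ 2) * par l i * par j m) \<odot>\<^bsub>FA\<^esub> wmon [(i, j), (l, m)] \<and>
        {l, m, i, j} \<subseteq> {1..n} \<and> l > i \<and> m \<le> j)) \<or>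
      (\<exists>l m i j. f = wmon [(l, m), (i, j)] \<ominus>\<^bsub>FA\<^esub> par j m \<odot>\<^bsub>FA\<^esub> wmon [(i, j), (l, m)] \<and>
        {l, m, i, j} \<subseteq> {1..n} \<and> l = i \<and> m > j)"
    using assms unfolding quantum_matrix_relators_def Let_def free_gen_mult by (simp only: Un_iff mem_Collect_eq)
  then show ?thesis
  proof (elim disjE exE conjE, goal_cases)
    case (1 l m i j)
    note 1 = 1(2-4,1)
    have c: "(\<lambda>w. c * wmon [(i, j), (l, m)] w + d * wmon [(i, m), (l, j)] w) \<in> carrier FA" for c d
      using free_algebra_add_closed[OF smult_word2_carrier[of i j l m c] smult_word2_carrier[of i m l j d]] 1
      by (simp add: free_algebra_simps)
    have e: "par l i * par j m = 1" "(inverse (q ^ 2) - 1) * par l i = inverse q - q"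
      using q 1 by (simp_all add: field_simps power2_eq_square)
    show ?thesis using 1(4)
      unfolding e free_algebra_simps free_algebra_minus[OF c] by (intro diag[OF 1(1-3)]) (simp add: diff_diff_eq)
  next
    case (2 l m i j)
    note 2 = 2(2-4,1)
    have e: "inverse (q ^ 2) * par l i * par j m = (if m = j then inverse q else 1)"
      using q 2 by (simp add: field_simps power2_eq_square)
    have "{i, j, l, m} \<subseteq> {1..n}" using 2 by auto
    then show ?thesis using 2(4)
      unfolding e free_algebra_simps by (intro anti[OF 2(1-3)]) (simp only: free_algebra_minus[OF smult_word2_carrier])
  next
    case (3 l m i j)
    note 3 = 3(2-4,1)
    have e: "par j m = inverse q" using 3 by simp
    have "{i, j, l, m} \<subseteq> {1..n}" using 3 by auto
    then show ?thesis using 3(4)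
      unfolding e free_algebra_simps by (intro row[OF 3(1-3)]) (simp only: free_algebra_minus[OF smult_word2_carrier])
  qed
qed

lemma evl_sub:
  assumes "f \<in> carrier FA" "g \<in> carrier FA"
  shows "evl x (\<lambda>w. f w - c * g w) = evl x f - scl (cst c) (evl x g)"
proof -
  have "finite {w. f w \<noteq> 0}" and g: "finite {w. g w \<noteq> 0}"
    using assms by (simp_all add: free_algebra_carrier_iff)
  moreover have "finite {w. (- c) * g w \<noteq> 0}" using g by (rule rev_finite_subset) auto
  ultimately show ?thesis
    using evl_add[of f "\<lambda>w. (- c) * g w" x] evl_smult[OF g, of x "- c"]
    by (simp add: cst_simps scl_coeff_simps)
qed

lemma rels_carrier: "rels \<subseteq> carrier FA"
proof
  have *: "(\<lambda>w. f w - c * g w) \<in> carrier FA" if "f \<in> carrier FA" "g \<in> carrier FA" for f g c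
    using free_algebra_add_closed[OF that(1) smult_free_algebra_closed[OF that(2), of "- c"]]
    by (simp add: free_algebra_simps)
  fix f assume "f \<in> rels"
  then show "f \<in> carrier FA"
  proof (cases rule: relator_cases)
    case (diag l m i j)
    then show ?thesis unfolding diag(4) by (intro * word2_carrier) auto
  next
    case (anti l m i j)
    then show ?thesis unfolding anti(4) by (intro * word2_carrier) auto
  next
    case (row l m i j)
    then show ?thesis unfolding row(4) by (intro * word2_carrier) auto
  qed
qed

lemma evl_rels:
  assumes "f \<in> rels" shows "evl gens f = 0"
proof -
  have c: "(\<lambda>w. f w - c * g w) \<in> carrier FA" if "f \<in> carrier FA" "g \<in> carrier FA" for f g c
    using free_algebra_add_closed[OF that(1) smult_free_algebra_closed[OF that(2), of "- c"]]
    by (simp add: free_algebra_simps)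
  note Q = us.qmatD[OF qmat_xr[OF order_refl]]
  from assms show ?thesis
  proof (cases rule: relator_cases)
    case (diag l m i j)
    have "xr n i j * xr n l m = xr n l m * xr n i j + scl (cst q - cst (inverse q)) (xr n i m * xr n l j)"
      using diag by (intro Q(4)) auto
    then show ?thesis
      unfolding diag(4) using diag(1)
      by (subst evl_sub, (intro c word2_carrier; simp)+, subst evl_sub, (intro c word2_carrier; simp)+)
        (simp add: gens_def cst_simps scl_coeff_simps)
  next
    case (anti l m i j)
    have "xr n i j * xr n l m = xr n l m * xr n i j" if "m < j"
      using anti that by (intro Q(3)) auto
    moreover have "xr n i j * xr n l j = scl (cst q) (xr n l j * xr n i j)" if "m = j"
      using anti that by (intro Q(2)) auto
    ultimately show ?thesis
      unfolding anti(4) using anti(1,3) q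
      by (subst evl_sub, (intro c word2_carrier; simp)+)
        (auto simp add: gens_def scl_simps scl_coeff_simps mult_single)
  next
    case (row l m i j)
    have "xr n i j * xr n i m = scl (cst q) (xr n i m * xr n i j)"
      using row by (intro Q(1)) auto
    then show ?thesis
      unfolding row(4) using row(1,2) q
      by (subst evl_sub, (intro c word2_carrier; simp)+)
        (auto simp add: gens_def scl_simps scl_coeff_simps mult_single)
  qed
qed

lemma evl_gens_hom: "ring_hom_ring FA univ_ring (evl gens)"
  by (rule evl_ring_hom_ring)

lemma evl_kernel: "a_kernel FA univ_ring (evl gens) = {f \<in> carrier FA. evl gens f = 0}"
  by (simp add: a_kernel_def')

lemma qideal_sub_kernel: "qideal \<subseteq> {f \<in> carrier FA. evl gens f = 0}"
  unfolding qideal_def evl_kernel[symmetric]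
  by (rule FA.genideal_minimal[OF ring_hom_ring.kernel_is_ideal[OF evl_gens_hom]]) (use rels_carrier evl_rels in \<open>auto simp: evl_kernel\<close>)

sublocale qi: free_algebra_ideal "matrix_indices n" qideal
  unfolding qideal_def by (intro free_algebra_ideal.intro FA.genideal_ideal rels_carrier)

lemma rels_qideal: "f \<in> rels \<Longrightarrow> f \<in> qideal"
  unfolding qideal_def using FA.genideal_self[OF rels_carrier] by blast

lemma straight_all:
  assumes "f \<in> carrier FA" shows "qi.straight f"
proof (rule qi.straight_all[OF _ _ assms])
  show "finite (matrix_indices n)" by (simp add: matrix_indices_def)
  fix x y assume xy: "x \<in> matrix_indices n" "y \<in> matrix_indices n" "y < x"
  obtain l m i j where e: "x = (l, m)" "y = (i, j)" by (cases x, cases y)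
  have n: "{l, m, i, j} \<subseteq> {1..n}" using xy e by (auto simp: matrix_indices_def)
  have less: "i < l \<or> i = l \<and> j < m" using xy e by (auto simp: less_prod_def)
  have sub: "{y, x, (i, m), (l, j)} \<subseteq> matrix_indices n"
    using n e by (auto simp: matrix_indices_def)
  have I: "\<exists>u v u' v' c d. {u, v, u', v'} \<subseteq> matrix_indices n \<and> u < x \<and> u' < x \<and>
      (\<lambda>w. wmon [x, y] w - c * wmon [u, v] w - d * wmon [u', v'] w) \<in> qideal"
    if "{u, v, u', v'} \<subseteq> matrix_indices n" "u < x" "u' < x"
      "(\<lambda>w. wmon [x, y] w - c * wmon [u, v] w - d * wmon [u', v'] w) \<in> qideal" for u v u' v' c d
    using that by (intro exI conjI)
  have yx: "{y, x, y, x} \<subseteq> matrix_indices n" using xy by simp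
  consider "l > i" "m > j" | "l > i" "m \<le> j" | "l = i" "m > j" using less by linarith
  then show "\<exists>u v u' v' c d. {u, v, u', v'} \<subseteq> matrix_indices n \<and> u < x \<and> u' < x \<and>
      (\<lambda>w. wmon [x, y] w - c * wmon [u, v] w - d * wmon [u', v'] w) \<in> qideal"
  proof cases
    case 1
    \<comment> \<open>Rows are compared first, so the correction word also starts with a letter
      smaller than \<open>x\<close>.\<close>
    then have "(i, m) < x" using e by (simp add: less_prod_def)
    moreover have "(\<lambda>w. wmon [x, y] w - 1 * wmon [y, x] w - (inverse q - q) * wmon [(i, m), (l, j)] w) \<in> qideal"
      unfolding e using 1 n by (intro rels_qideal relator_diag)
    ultimately show ?thesis by (intro I[OF sub xy(3)])
  next
    case 2
    have "(\<lambda>w. wmon [x, y] w - (if m = j then inverse q else 1) * wmon [y, x] w) \<in> qideal"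
      unfolding e using 2 n by (intro rels_qideal relator_anti)
    \<comment> \<open>A relation with one term on the right is padded by a second word with
      coefficient 0.\<close>
    then have "(\<lambda>w. wmon [x, y] w - (if m = j then inverse q else 1) * wmon [y, x] w - 0 * wmon [y, x] w) \<in> qideal"
      by simp
    then show ?thesis by (rule I[OF yx xy(3) xy(3)])
  next
    case 3
    have "(\<lambda>w. wmon [x, y] w - inverse q * wmon [y, x] w) \<in> qideal"
      unfolding e using 3 n by (intro rels_qideal relator_row)
    then have "(\<lambda>w. wmon [x, y] w - inverse q * wmon [y, x] w - 0 * wmon [y, x] w) \<in> qideal"
      by simp
    then show ?thesis by (rule I[OF yx xy(3) xy(3)])
  qed
qed

text \<open>Being nonzero is not preserved by products of operators, but being invertible is; this
  is what makes the algebra a domain.\<close>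

definition invertible_lop :: "('i, 'k) lop \<Rightarrow> bool" where
  "invertible_lop s \<longleftrightarrow> (\<exists>t. s * t = 1 \<and> t * s = 1)"

lemma invertible_lop_mult:
  assumes "invertible_lop s" "invertible_lop s'" shows "invertible_lop (s * s')"
proof -
  obtain t t' where t: "s * t = 1" "t * s = 1" and t': "s' * t' = 1" "t' * s' = 1"
    using assms unfolding invertible_lop_def by blast
  have "s * s' * (t' * t) = s * (s' * t') * t" "t' * t * (s * s') = t' * (t * s) * s'"
    by (simp_all only: mult.assoc)
  then show ?thesis unfolding invertible_lop_def using t t' by (intro exI[of _ "t' * t"]) simp
qed

lemma invertible_lop_scl:
  assumes "c \<noteq> 0" "invertible_lop s" shows "invertible_lop (scl c s)"
proof -
  obtain t where t: "s * t = 1" "t * s = 1" using assms(2) unfolding invertible_lop_def by blast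
  then show ?thesis
    unfolding invertible_lop_def using assms(1)
    by (intro exI[of _ "scl (inverse c) t"]) (simp add: scl_simps scl_coeff_simps)
qed

lemma invertible_lop_nonzero:
  assumes "invertible_lop (s :: ('i, 'k) lop)" shows "app s (\<lambda>a. 1) \<noteq> (\<lambda>a. 0)"
proof
  assume z: "app s (\<lambda>a. 1) = (\<lambda>a. 0)"
  obtain t where "t * s = 1" using assms unfolding invertible_lop_def by blast
  then have "app t (app s (\<lambda>a. 1)) = (\<lambda>a. 1)" by (metis app_ring_simps(2,6))
  then show False using z by (simp add: fun_eq_iff)
qed

definition symb :: "nat \<times> nat \<Rightarrow> (nat \<times> nat \<Rightarrow> int, 'k) lop" where
  "symb = (\<lambda>(i, j). sym i j)"

definition wdeg :: "(nat \<times> nat) list \<Rightarrow> (nat \<times> nat) \<Rightarrow>\<^sub>0 int" where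
  "wdeg w = sum_list (map (\<lambda>x. Poly_Mapping.single x 1) w)"

lemma lookup_wdeg: "Poly_Mapping.lookup (wdeg w) x = int (count (mset w) x)"
  by (induction w) (auto simp: wdeg_def lookup_add lookup_single when_def)

lemma wdeg_inj:
  assumes "sorted v" "sorted w" "wdeg v = wdeg w" shows "v = w"
proof -
  have "mset v = mset w"
    by (rule multiset_eqI) (metis assms(3) lookup_wdeg of_nat_eq_iff)
  then show ?thesis using assms(1,2) by (metis properties_for_sort)
qed

lemma lead_word:
  assumes "set w \<subseteq> matrix_indices n"
  shows "lead (prod_list (map gens w)) (wdeg w) (prod_list (map symb w))"
  unfolding wdeg_def using assms
  by (intro lead_prod_list) (auto simp: gens_def symb_def matrix_indices_def intro!: lead_xr)

lemma invertible_word: "invertible_lop (prod_list (map symb w))"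
proof (induction w)
  case Nil
  show ?case by (simp add: invertible_lop_def)
next
  case (Cons x w)
  have "invertible_lop (symb x)"
    unfolding invertible_lop_def symb_def
    by (cases x) (auto intro!: exI[of _ "sym_inv (fst x) (snd x)"] simp: sym_inverse)
  then show ?case using Cons invertible_lop_mult by simp
qed

text \<open>Sorted words are determined by their degrees, so exactly one word of the support attains
  the maximal degree. Its leading part is a nonzero multiple of a product of invertible symbols and
  cannot be cancelled.\<close>

lemma lead_sorted_supp:
  assumes g: "qi.sorted_supp g" and nz: "g \<noteq> (\<lambda>w. 0)"
  shows "\<exists>d s. lead (evl gens g) d s \<and> invertible_lop s"
proof -
  let ?A = "{w. g w \<noteq> 0}"
  have A: "finite ?A" "\<And>w. w \<in> ?A \<Longrightarrow> set w \<subseteq> matrix_indices n" "\<And>w. w \<in> ?A \<Longrightarrow> sorted w"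
    using g by (auto simp: qi.sorted_supp_def free_algebra_carrier_iff)
  have "?A \<noteq> {}" using nz by auto
  then have "Max (wdeg ` ?A) \<in> wdeg ` ?A" using A(1) by (intro Max_in) auto
  then obtain v where v: "v \<in> ?A" "wdeg v = Max (wdeg ` ?A)" by auto
  let ?t = "\<lambda>w. scl (cst (g w)) (prod_list (map gens w))"
  have lower: "lead (?t w) (wdeg v) 0" if "w \<in> ?A - {v}" for w
  proof (rule lead_lower[OF lead_scl[OF lead_word]])
    show "set w \<subseteq> matrix_indices n" using A that by blast
    have "wdeg w \<le> wdeg v" using A(1) that v(2) by simp
    moreover have "wdeg w \<noteq> wdeg v" using wdeg_inj A(3) v(1) that by blast
    ultimately show "wdeg w < wdeg v" by simp
  qed
  have "lead (?t v + (\<Sum>w\<in>?A - {v}. ?t w)) (wdeg v)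
      (scl (g v) (prod_list (map symb v)) + (\<Sum>w\<in>?A - {v}. 0))"
    using A(2)[OF v(1)] by (intro lead_add lead_sum lead_scl lead_word lower)
  moreover have "?t v + (\<Sum>w\<in>?A - {v}. ?t w) = evl gens g"
    unfolding evl_def using A(1) v(1) by (simp add: sum.remove)
  moreover have "invertible_lop (scl (g v) (prod_list (map symb v)))"
    using v(1) by (intro invertible_lop_scl invertible_word) simp
  ultimately show ?thesis by auto
qed

text \<open>Straightening changes an element only within the ideal, on which evaluation vanishes.
  This one fact yields the injectivity of the representation, the absence of zero divisors and the
  transfer of the standard identity.\<close>

lemma lead_nonideal:
  assumes f: "f \<in> carrier FA" "f \<notin> qideal"
  shows "\<exists>d s. lead (evl gens f) d s \<and> invertible_lop s"
proof -
  obtain g where g: "qi.sorted_supp g" "(\<lambda>w. f w - g w) \<in> qideal"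
    using straight_all[OF f(1)] unfolding qi.straight_def by blast
  have gc: "g \<in> carrier FA" using g(1) by (simp add: qi.sorted_supp_def)
  have "evl gens (\<lambda>w. f w - 1 * g w) = 0" using qideal_sub_kernel g(2) by auto
  then have "evl gens f = evl gens g"
    unfolding evl_sub[OF f(1) gc] by (simp add: scl_coeff_simps)
  moreover have "g \<noteq> (\<lambda>w. 0)" using g(2) f(2) by auto
  ultimately show ?thesis using lead_sorted_supp[OF g(1)] by simp
qed

lemma kernel_qideal: "a_kernel FA univ_ring (evl gens) = qideal"
proof -
  have "f \<in> qideal" if f: "f \<in> carrier FA" "evl gens f = 0" for f
  proof (rule ccontr)
    assume "f \<notin> qideal"
    then obtain d s where "lead (0 :: (nat \<times> nat \<Rightarrow> int, 'k laurent) lop) d s" "invertible_lop s"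
      using lead_nonideal[OF f(1)] f(2) by auto
    then show False using lead_zeroD invertible_lop_nonzero by fastforce
  qed
  then show ?thesis using qideal_sub_kernel by (auto simp: evl_kernel)
qed

end

section \<open>Polynomial identities along injective homomorphisms\<close>

lemma (in ring_hom_ring) hom_add_pow:
  fixes k :: int
  assumes "x \<in> carrier R" shows "h ([k] \<cdot>\<^bsub>R\<^esub> x) = [k] \<cdot>\<^bsub>S\<^esub> h x"
proof -
  have nat: "h ([m] \<cdot>\<^bsub>R\<^esub> x) = [m] \<cdot>\<^bsub>S\<^esub> h x" for m :: nat
    using assms by (induction m) simp_all
  show ?thesis
    using assms by (cases "k \<ge> 0") (simp_all add: add_pow_int_ge add_pow_int_lt nat)
qed

lemma (in ring_hom_ring) hom_finsum_ring:
  "finite A \<Longrightarrow> (\<And>x. x \<in> A \<Longrightarrow> g x \<in> carrier R) \<Longrightarrow> h (\<Oplus>\<^bsub>R\<^esub>x\<in>A. g x) = (\<Oplus>\<^bsub>S\<^esub>x\<in>A. h (g x))"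
proof (induction A rule: finite_induct)
  case (insert x A)
  have "g \<in> A \<rightarrow> carrier R" "(\<lambda>x. h (g x)) \<in> A \<rightarrow> carrier S" using insert by auto
  then show ?case using insert by (simp add: R.finsum_insert S.finsum_insert)
qed simp

lemma (in ring_hom_ring) hom_nc_eval:
  assumes f: "finite {w. f w \<noteq> 0}" and r: "\<And>i. r i \<in> carrier R"
  shows "h (nc_eval R r f) = nc_eval S (\<lambda>i. h (r i)) f"
proof -
  have fold_closed: "foldr (\<lambda>i a. r i \<otimes>\<^bsub>R\<^esub> a) w \<one>\<^bsub>R\<^esub> \<in> carrier R" for w
    using r by (induction w) simp_all
  have fold: "h (foldr (\<lambda>i a. r i \<otimes>\<^bsub>R\<^esub> a) w \<one>\<^bsub>R\<^esub>) = foldr (\<lambda>i a. h (r i) \<otimes>\<^bsub>S\<^esub> a) w \<one>\<^bsub>S\<^esub>" for w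
    using r fold_closed by (induction w) simp_all
  have "h (nc_eval R r f) = (\<Oplus>\<^bsub>S\<^esub>w\<in>{w. f w \<noteq> 0}. h ([f w] \<cdot>\<^bsub>R\<^esub> foldr (\<lambda>i a. r i \<otimes>\<^bsub>R\<^esub> a) w \<one>\<^bsub>R\<^esub>))"
    unfolding nc_eval_def using f fold_closed by (intro hom_finsum_ring) auto
  then show ?thesis
    unfolding nc_eval_def by (simp add: hom_add_pow[OF fold_closed] fold)
qed

lemma nc_eval_univ_ring:
  assumes "finite {w. f w \<noteq> 0}"
  shows "nc_eval univ_ring r f = (\<Sum>w\<in>{w. f w \<noteq> 0}. of_int (f w) * prod_list (map r w))"
proof -
  have *: "foldr (\<lambda>i a. r i \<otimes>\<^bsub>univ_ring\<^esub> a) w \<one>\<^bsub>univ_ring\<^esub> = prod_list (map r w)" for w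
    by (induction w) simp_all
  show ?thesis
    unfolding nc_eval_def * finsum_univ_ring[OF assms] add_pow_univ_ring by (rule refl)
qed

locale univ_ring_embedding =
  fixes R :: "('b, 'c) ring_scheme" and h :: "'b \<Rightarrow> 'a::ring_1"
  assumes hom: "ring_hom_ring R univ_ring h" and inj: "inj_on h (carrier R)"
begin

sublocale ring_hom_ring R univ_ring h by (rule hom)

lemma h_eq_zero_iff: "x \<in> carrier R \<Longrightarrow> h x = 0 \<longleftrightarrow> x = \<zero>\<^bsub>R\<^esub>"
  using inj_onD[OF inj, of x "\<zero>\<^bsub>R\<^esub>"] hom_zero by auto

lemma prime_ringI:
  assumes "\<And>x y. x \<in> h ` carrier R \<Longrightarrow> y \<in> h ` carrier R \<Longrightarrow> x * y = 0 \<Longrightarrow> x = 0 \<or> y = 0"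
  shows "prime_ring R"
  unfolding prime_ring_def
proof (intro conjI ballI impI)
  show "ring R" by (rule R.ring_axioms)
  show "\<one>\<^bsub>R\<^esub> \<noteq> \<zero>\<^bsub>R\<^esub>"
    using h_eq_zero_iff[of "\<one>\<^bsub>R\<^esub>"] by auto
  fix a b assume a: "a \<in> carrier R" and b: "b \<in> carrier R"
    and ab: "\<forall>r\<in>carrier R. a \<otimes>\<^bsub>R\<^esub> r \<otimes>\<^bsub>R\<^esub> b = \<zero>\<^bsub>R\<^esub>"
  have "a \<otimes>\<^bsub>R\<^esub> b = \<zero>\<^bsub>R\<^esub>"
    using bspec[OF ab R.one_closed] a by simp
  then have "h a * h b = 0" using hom_mult[OF a b] by simp
  then have "h a = 0 \<or> h b = 0" using assms a b by blast
  then show "a = \<zero>\<^bsub>R\<^esub> \<or> b = \<zero>\<^bsub>R\<^esub>" using a b by (simp add: h_eq_zero_iff)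
qed

text \<open>Substitutions from the image lift by choosing preimages, so an identity can be tested on
  operators in the image.\<close>

lemma monic_polynomial_identity_iff:
  "monic_polynomial_identity R f \<longleftrightarrow>
    f \<in> carrier (free_algebra UNIV) \<and> nc_monic f \<and>
    (\<forall>r. range r \<subseteq> h ` carrier R \<longrightarrow> (\<Sum>w\<in>{w. f w \<noteq> 0}. of_int (f w) * prod_list (map r w)) = 0)"
proof -
  have "(\<forall>r\<in>UNIV \<rightarrow> carrier R. nc_eval R r f = \<zero>\<^bsub>R\<^esub>) \<longleftrightarrow>
    (\<forall>r. range r \<subseteq> h ` carrier R \<longrightarrow> (\<Sum>w\<in>{w. f w \<noteq> 0}. of_int (f w) * prod_list (map r w)) = 0)"
    (is "?A \<longleftrightarrow> ?B") if fin: "finite {w. f w \<noteq> 0}"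
  proof -
    have "nc_eval R r f \<in> carrier R" if "\<And>i. r i \<in> carrier R" for r
    proof -
      have "foldr (\<lambda>i a. r i \<otimes>\<^bsub>R\<^esub> a) w \<one>\<^bsub>R\<^esub> \<in> carrier R" for w
        using that by (induction w) simp_all
      then show ?thesis unfolding nc_eval_def by (intro R.finsum_closed) (simp add: R.add.int_pow_closed)
    qed
    then have eq: "nc_eval R r f = \<zero>\<^bsub>R\<^esub> \<longleftrightarrow>
        (\<Sum>w\<in>{w. f w \<noteq> 0}. of_int (f w) * prod_list (map (\<lambda>i. h (r i)) w)) = 0"
      if "\<And>i. r i \<in> carrier R" for r
      using h_eq_zero_iff[of "nc_eval R r f"] hom_nc_eval[OF fin, of r] nc_eval_univ_ring[OF fin, of "\<lambda>i. h (r i)"] that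
      by simp
    show ?thesis
    proof
      assume A: ?A
      show ?B
      proof (intro allI impI)
        fix r :: "nat \<Rightarrow> 'a" assume r: "range r \<subseteq> h ` carrier R"
        define s where "s i = (SOME x. x \<in> carrier R \<and> h x = r i)" for i
        have s: "s i \<in> carrier R \<and> h (s i) = r i" for i
        proof -
          have "r i \<in> h ` carrier R" using r by (rule subsetD) simp
          then have "\<exists>x. x \<in> carrier R \<and> h x = r i" by (elim imageE) auto
          then show ?thesis unfolding s_def by (rule someI_ex)
        qed
        then have "nc_eval R s f = \<zero>\<^bsub>R\<^esub>" by (intro bspec[OF A]) auto
        then show "(\<Sum>w\<in>{w. f w \<noteq> 0}. of_int (f w) * prod_list (map r w)) = 0"
          using eq[of s] s by simp
      qed
    next
      assume B: ?B
      show ?A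
      proof
        fix r :: "nat \<Rightarrow> 'b" assume "r \<in> UNIV \<rightarrow> carrier R"
        then have r: "r i \<in> carrier R" for i by auto
        then have "range (\<lambda>i. h (r i)) \<subseteq> h ` carrier R" by auto
        then show "nc_eval R r f = \<zero>\<^bsub>R\<^esub>" using B eq[of r] r by simp
      qed
    qed
  qed
  then show ?thesis
    unfolding monic_polynomial_identity_def by (auto simp: free_algebra_carrier_iff)
qed

end

section \<open>Polarization of a polynomial identity\<close>

lemma prod_list_sum_expand:
  fixes y :: "nat \<Rightarrow> 'a::ring_1"
  assumes "finite E"
  shows "prod_list (map (\<lambda>i. \<Sum>p\<in>{p \<in> E. g p = i}. y p) w) =
    (\<Sum>p\<in>{p. set p \<subseteq> E \<and> map g p = w}. prod_list (map y p))"
proof (induction w)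
  case Nil
  have "{p. set p \<subseteq> E \<and> map g p = []} = {[]}" by auto
  then show ?case by simp
next
  case (Cons i w)
  let ?A = "{p \<in> E. g p = i}" and ?B = "{p. set p \<subseteq> E \<and> map g p = w}"
  have "(\<Sum>p\<in>{p. set p \<subseteq> E \<and> map g p = i # w}. prod_list (map y p)) =
      (\<Sum>(a, p)\<in>?A \<times> ?B. y a * prod_list (map y p))"
    by (rule sum.reindex_bij_witness[where i = "\<lambda>(a, p). a # p" and j = "\<lambda>p. (hd p, tl p)"])
      (auto simp: Cons_eq_map_conv map_eq_Cons_conv)
  then show ?case
    using Cons assms by (simp add: sum_product sum.cartesian_product)
qed

text \<open>Each variable \<open>i\<close> is replaced by the sum of those \<open>y p\<close> with
  \<open>w0 ! p = i\<close>, restricted to \<open>p\<close> in a set \<open>E\<close> of positions.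
  The terms that use every \<open>y p\<close> exactly once are isolated by varying \<open>E\<close>.
  Only sums are substituted, so closure under addition is enough and no scalars are needed.\<close>

lemma polarization:
  fixes Im :: "'a::ring_1 set" and P :: "nat list \<Rightarrow> int"
  assumes Im: "0 \<in> Im" "\<And>x y. x \<in> Im \<Longrightarrow> y \<in> Im \<Longrightarrow> x + y \<in> Im"
    and P: "finite {w. P w \<noteq> 0}" "\<And>w. P w \<noteq> 0 \<Longrightarrow> length w \<le> d"
    and id: "\<And>r. range r \<subseteq> Im \<Longrightarrow> (\<Sum>w\<in>{w. P w \<noteq> 0}. of_int (P w) * prod_list (map r w)) = 0"
    and y: "\<And>p. p < d \<Longrightarrow> y p \<in> Im"
  shows "(\<Sum>p\<in>permutations_of_set {..<d}. of_int (P (map ((!) w0) p)) * prod_list (map y p)) = 0"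
proof -
  define L where "L E = {p. set p \<subseteq> E \<and> length p \<le> d}" for E :: "nat set"
  define t where "t p = of_int (P (map ((!) w0) p)) * prod_list (map y p)" for p
  have finL: "finite (L E)" if "finite E" for E
    unfolding L_def using that by (rule finite_lists_length_le)
  have ImS: "(\<Sum>p\<in>A. y p) \<in> Im" if "A \<subseteq> {..<d}" for A
    using finite_subset[OF that finite_lessThan] that by (induction A rule: finite_induct) (auto simp: Im y)
  have total: "(\<Sum>p\<in>L E. t p) = 0" if E: "E \<subseteq> {..<d}" for E
  proof -
    have fE: "finite E" using E finite_subset by blast
    define r where "r i = (\<Sum>p\<in>{p \<in> E. w0 ! p = i}. y p)" for i
    let ?S = "{p \<in> L E. P (map ((!) w0) p) \<noteq> 0}"
    have "range r \<subseteq> Im" unfolding r_def using E by (auto intro!: ImS)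
    then have "0 = (\<Sum>w\<in>{w. P w \<noteq> 0}. of_int (P w) * prod_list (map r w))" using id by simp
    also have "\<dots> = (\<Sum>w\<in>{w. P w \<noteq> 0}. \<Sum>p\<in>{p \<in> ?S. map ((!) w0) p = w}. t p)"
    proof (rule sum.cong[OF refl])
      fix w assume w: "w \<in> {w. P w \<noteq> 0}"
      then have "{p \<in> ?S. map ((!) w0) p = w} = {p. set p \<subseteq> E \<and> map ((!) w0) p = w}"
        using P(2)[of w] by (auto simp: L_def)
      then show "of_int (P w) * prod_list (map r w) = (\<Sum>p\<in>{p \<in> ?S. map ((!) w0) p = w}. t p)"
        unfolding r_def prod_list_sum_expand[OF fE] by (simp add: t_def sum_distrib_left)
    qed
    also have "\<dots> = (\<Sum>p\<in>?S. t p)"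
      using finL[OF fE] P(1) by (intro sum.group) auto
    also have "\<dots> = (\<Sum>p\<in>L E. t p)"
      using finL[OF fE] by (intro sum.mono_neutral_left) (auto simp: t_def)
    finally show ?thesis by simp
  qed
  \<comment> \<open>Inclusion-exclusion over sets of positions: once the contributions of all proper
    subsets vanish, so does that of the lists whose letters are exactly \<open>E\<close>.\<close>
  have exact: "(\<Sum>p\<in>{p \<in> L E. set p = E}. t p) = 0" if "finite E" "E \<subseteq> {..<d}" for E
    using that
  proof (induction E rule: finite_psubset_induct)
    case (psubset E)
    have "(\<Sum>p\<in>L E - {p \<in> L E. set p = E}. t p) =
        (\<Sum>E'\<in>Pow E - {E}. \<Sum>p\<in>{p \<in> L E - {p \<in> L E. set p = E}. set p = E'}. t p)"
      using finL[OF psubset(1)] psubset(1) by (intro sum.group[symmetric]) (auto simp: L_def)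
    also have "\<dots> = (\<Sum>E'\<in>Pow E - {E}. 0)"
    proof (rule sum.cong[OF refl])
      fix E' assume E': "E' \<in> Pow E - {E}"
      then have e: "{p \<in> L E - {p \<in> L E. set p = E}. set p = E'} = {p \<in> L E'. set p = E'}"
        by (auto simp: L_def)
      have "E' \<subset> E" "E' \<subseteq> {..<d}" using psubset.prems E' by auto
      then show "(\<Sum>p\<in>{p \<in> L E - {p \<in> L E. set p = E}. set p = E'}. t p) = 0"
        unfolding e by (rule psubset.IH)
    qed
    finally have "(\<Sum>p\<in>L E - {p \<in> L E. set p = E}. t p) = 0" by simp
    moreover have "(\<Sum>p\<in>L E. t p) = (\<Sum>p\<in>L E - {p \<in> L E. set p = E}. t p) + (\<Sum>p\<in>{p \<in> L E. set p = E}. t p)"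
      using finL[OF psubset(1)] by (intro sum.subset_diff) auto
    ultimately show ?case using total[OF psubset.prems] by simp
  qed
  \<comment> \<open>The length bound enters here: a list of length at most \<open>d\<close> that
    meets all \<open>d\<close> positions meets each of them once.\<close>
  have "{p \<in> L {..<d}. set p = {..<d}} = permutations_of_set {..<d}"
  proof (intro equalityI subsetI)
    fix p assume "p \<in> {p \<in> L {..<d}. set p = {..<d}}"
    then have p: "set p = {..<d}" "length p \<le> d" by (auto simp: L_def)
    then have "card (set p) = length p" using card_length[of p] by simp
    then have "distinct p" by (rule card_distinct)
    then show "p \<in> permutations_of_set {..<d}" using p by (simp add: permutations_of_set_def)
  next
    fix p assume "p \<in> permutations_of_set {..<d}"
    then have "set p = {..<d}" "length p = d"
      using length_finite_permutations_of_set[of p "{..<d}"] by (auto simp: permutations_of_set_def)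
    then show "p \<in> {p \<in> L {..<d}. set p = {..<d}}" by (simp add: L_def)
  qed
  then show ?thesis using exact[of "{..<d}"] by (simp add: t_def)
qed

section \<open>Periodic functions\<close>

definition Pos :: "nat \<Rightarrow> (nat \<times> nat) set" where
  "Pos n = {(r, d). 1 \<le> d \<and> d \<le> r \<and> r < n}"

lemma Pos_Suc: "Pos (Suc n) = Pos n \<union> (\<lambda>d. (n, d)) ` {1..n}"
  by (auto simp: Pos_def)

lemma finite_Pos [simp]: "finite (Pos n)"
  by (rule finite_subset[of _ "{..<n} \<times> {..<n}"]) (auto simp: Pos_def)

lemma card_Pos: "card (Pos n) = n * (n - 1) div 2"
proof -
  have "2 * card (Pos n) = n * (n - 1)"
  proof (induction n)
    case 0
    show ?case by (simp add: Pos_def)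
  next
    case (Suc n)
    have "card (Pos (Suc n)) = card (Pos n) + card ((\<lambda>d. (n, d)) ` {1..n})"
      unfolding Pos_Suc by (intro card_Un_disjoint finite_Pos) (auto simp: Pos_def)
    also have "card ((\<lambda>d. (n, d)) ` {1..n}) = n" by (simp add: card_image inj_on_def)
    finally show ?case using Suc by (cases n) simp_all
  qed
  then show ?thesis by simp
qed

lemma power_int_cong_root:
  fixes q :: "'k::field"
  assumes q: "q \<noteq> 0" "q ^ m = 1" and ab: "a mod int m = b mod int m"
  shows "q powi a = q powi b"
proof -
  obtain c where c: "a = b + int m * c" using ab by (metis mod_eqE mult.commute mod_mult_div_eq add.commute add_diff_cancel_left' diff_add_cancel mult_div_mod_eq)
  have "q powi (int m * c) = (q powi int m) powi c" by (rule power_int_mult)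
  also have "\<dots> = 1" using q by simp
  finally show ?thesis using q by (simp add: c power_int_add)
qed

locale root_torus = quantum_torus n q for n :: nat and q :: "'k::field" +
  fixes m :: nat
  assumes root: "primitive_root_of_unity m q"
begin

lemma m_pos: "m > 0" and q_m: "q ^ m = 1"
  using root by (simp_all add: primitive_root_of_unity_def)

definition peq :: "(nat \<times> nat \<Rightarrow> int) \<Rightarrow> (nat \<times> nat \<Rightarrow> int) \<Rightarrow> bool" where
  "peq a b \<longleftrightarrow> (\<forall>x\<in>Pos n. a x mod int m = b x mod int m)"

lemma peq_refl [simp]: "peq a a" by (simp add: peq_def)

lemma peq_trans: "peq a b \<Longrightarrow> peq b c \<Longrightarrow> peq a c" by (simp add: peq_def)

lemma peq_cong: "peq a b \<Longrightarrow> peq a c \<longleftrightarrow> peq b c" by (auto simp: peq_def)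

lemma peq_add: "peq a b \<Longrightarrow> peq c d \<Longrightarrow> peq (\<lambda>x. a x + c x) (\<lambda>x. b x + d x)"
  unfolding peq_def by (intro ballI mod_add_cong) (rule bspec, assumption+)+

lemma peq_diff: "peq a b \<Longrightarrow> peq c d \<Longrightarrow> peq (\<lambda>x. a x - c x) (\<lambda>x. b x - d x)"
  unfolding peq_def by (intro ballI mod_diff_cong) (rule bspec, assumption+)+

lemma sum_mod_cong:
  "(\<And>t. t \<in> A \<Longrightarrow> f t mod k = g t mod k) \<Longrightarrow> (\<Sum>t\<in>A. f t) mod k = (\<Sum>t\<in>A. g t) mod (k::int)"
  by (induction A rule: infinite_finite_induct) (auto intro!: mod_add_cong)

text \<open>The exponent reads coordinates in \<open>Pos n\<close> only: \<open>crd\<close>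
  suppresses row \<open>n\<close>, and every second index in the sums lies between 1 and its
  row.\<close>

lemma gam_cong:
  assumes "peq a b" "i \<in> {1..n}" "j \<in> {1..n}"
  shows "gam n i j a mod int m = gam n i j b mod int m"
proof -
  have crd: "crd n a r d mod int m = crd n b r d mod int m" if "1 \<le> d" "d \<le> r" for r d
    using assms(1) that by (auto simp: crd_def peq_def Pos_def)
  show ?thesis
    unfolding gam_def using assms(2,3)
    by (auto intro!: mod_diff_cong sum_mod_cong crd)
qed

definition periodic :: "((nat \<times> nat \<Rightarrow> int) \<Rightarrow> 'c) \<Rightarrow> bool" where
  "periodic F \<longleftrightarrow> (\<forall>a b. peq a b \<longrightarrow> F a = F b)"

lemma periodicD: "periodic F \<Longrightarrow> peq a b \<Longrightarrow> F a = F b"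
  by (simp add: periodic_def)

definition stable :: "(nat \<times> nat \<Rightarrow> int, 'c::comm_ring_1) lop \<Rightarrow> bool" where
  "stable Y \<longleftrightarrow> (\<forall>F. periodic F \<longrightarrow> periodic (app Y F))"

lemma stableD: "stable Y \<Longrightarrow> periodic F \<Longrightarrow> periodic (app Y F)"
  by (simp add: stable_def)

lemma stable_mult: "stable Y \<Longrightarrow> stable Z \<Longrightarrow> stable (Y * Z)"
  by (simp add: stable_def)

lemma stable_add: "stable Y \<Longrightarrow> stable Z \<Longrightarrow> stable (Y + Z)"
  unfolding stable_def periodic_def app_ring_simps by metis

lemma stable_zero: "stable 0" by (simp add: stable_def periodic_def)

lemma stable_one: "stable 1" by (simp add: stable_def)

lemma stable_scl: "stable Y \<Longrightarrow> stable (scl c Y)"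
  unfolding stable_def periodic_def app_scl by metis

lemma stable_sum: "(\<And>x. x \<in> A \<Longrightarrow> stable (Y x)) \<Longrightarrow> stable (\<Sum>x\<in>A. Y x)"
  by (induction A rule: infinite_finite_induct) (auto simp: stable_zero stable_add)

lemma stable_prod_list: "(\<And>x. x \<in> set w \<Longrightarrow> stable (Y x)) \<Longrightarrow> stable (prod_list (map Y w))"
  by (induction w) (auto simp: stable_one stable_mult)

lemma stable_wsh:
  assumes "\<And>a b. peq a b \<Longrightarrow> w a = w b" "\<And>a b. peq a b \<Longrightarrow> peq (s a) (s b)"
  shows "stable (wsh w s)"
  unfolding stable_def periodic_def app_wsh using assms by metis

lemma powi_gam_cong:
  assumes "peq a b" "i \<in> {1..n}" "j \<in> {1..n}"
  shows "q powi gam n i j a = q powi gam n i j b" "q powi - gam n i j a = q powi - gam n i j b"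
  using power_int_cong_root[OF q q_m gam_cong[OF assms]] by (simp_all add: power_int_minus)

lemma stable_tor:
  assumes "i \<in> {1..n}" "j \<in> {1..n}"
  shows "stable (tor i j)" "stable (tor_inv i j)" "stable (sym i j)"
  unfolding tor_def tor_inv_def sym_def
  using powi_gam_cong(1)[OF _ assms] powi_gam_cong(2)[OF peq_add[OF _ peq_refl] assms]
  by (auto intro!: stable_wsh peq_add peq_diff arg_cong[of _ _ "Poly_Mapping.single _"])

lemma stable_xr: "i \<in> {1..r} \<Longrightarrow> r \<le> n \<Longrightarrow> j \<in> {1..n} \<Longrightarrow> stable (xr r i j)"
proof (induction r arbitrary: i j)
  case (Suc r)
  show ?case
  proof (cases "i \<le> r")
    case True
    have "stable (\<Sum>s\<in>{j..n}. xr r i s * tor_inv (Suc r) s)"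
      using Suc True by (intro stable_sum stable_mult Suc.IH stable_tor) auto
    moreover have "stable (tor (Suc r) j)" using Suc by (intro stable_tor) auto
    ultimately show ?thesis using True by (simp add: stable_mult)
  next
    case False
    moreover have "stable (tor (Suc r) j)" using Suc by (intro stable_tor) auto
    ultimately show ?thesis by simp
  qed
qed simp

lemma stable_evl:
  assumes "f \<in> carrier FA" shows "stable (evl gens f)"
  unfolding evl_def
proof (intro stable_sum stable_scl stable_prod_list)
  fix w x assume "w \<in> {w. f w \<noteq> 0}" "x \<in> set w"
  then have "x \<in> matrix_indices n" using assms by (auto simp: free_algebra_carrier_iff)
  then show "stable (gens x)" by (auto simp: gens_def matrix_indices_def intro!: stable_xr)
qed

section \<open>A finite basis of the periodic functions\<close>

definition N :: nat where "N = m ^ card (Pos n)"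

definition reps :: "(nat \<times> nat \<Rightarrow> int) set" where
  "reps = PiE (Pos n) (\<lambda>_. {0..<int m})"

lemma card_reps: "card reps = N" and finite_reps: "finite reps"
  by (simp_all add: reps_def N_def card_PiE finite_PiE)

definition pt :: "nat \<Rightarrow> nat \<times> nat \<Rightarrow> int" where
  "pt = (SOME p. bij_betw p {..<N} reps)"

lemma bij_pt: "bij_betw pt {..<N} reps"
proof -
  have "\<exists>p. bij_betw p {0..<card reps} reps" by (rule ex_bij_betw_nat_finite[OF finite_reps])
  then have "\<exists>p. bij_betw p {..<N} reps" by (simp add: card_reps lessThan_atLeast0)
  then show ?thesis unfolding pt_def by (rule someI_ex)
qed

lemma peq_pt_iff: "a < N \<Longrightarrow> b < N \<Longrightarrow> peq (pt a) (pt b) \<longleftrightarrow> a = b"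
proof
  assume ab: "a < N" "b < N" "peq (pt a) (pt b)"
  then have r: "pt a \<in> reps" "pt b \<in> reps" using bij_pt by (auto simp: bij_betw_def)
  have "pt a = pt b"
  proof (rule PiE_ext[OF r[unfolded reps_def]])
    fix x assume x: "x \<in> Pos n"
    have "pt a x \<in> {0..<int m}" "pt b x \<in> {0..<int m}" using r x by (auto simp: reps_def)
    moreover have "pt a x mod int m = pt b x mod int m" using ab(3) x by (simp add: peq_def)
    ultimately show "pt a x = pt b x" by simp
  qed
  then show "a = b" using bij_pt ab by (auto simp: bij_betw_def inj_on_def)
qed simp

lemma ex_pt: "\<exists>a<N. peq c (pt a)"
proof -
  let ?c = "restrict (\<lambda>x. c x mod int m) (Pos n)"
  have "?c \<in> reps" using m_pos by (auto simp: reps_def)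
  then have "?c \<in> pt ` {..<N}" using bij_pt by (simp add: bij_betw_def)
  then obtain a where a: "?c = pt a" "a < N" by (elim imageE) simp
  have "peq c ?c" by (simp add: peq_def)
  then show ?thesis using a by auto
qed

definition delta :: "nat \<Rightarrow> (nat \<times> nat \<Rightarrow> int) \<Rightarrow> 'c::comm_ring_1" where
  "delta b = (\<lambda>c. of_bool (peq c (pt b)))"

lemma periodic_expand:
  assumes F: "periodic F" shows "F = (\<lambda>c. \<Sum>b<N. F (pt b) * delta b c)"
proof
  fix c
  obtain a where a: "a < N" "peq c (pt a)" using ex_pt by blast
  have "(\<Sum>b<N. F (pt b) * delta b c) = (\<Sum>b<N. if b = a then F (pt b) else 0)"
  proof (intro sum.cong refl)
    fix b assume "b \<in> {..<N}"
    then have "peq c (pt b) \<longleftrightarrow> b = a" using a peq_pt_iff[of a b] peq_cong[OF a(2), of "pt b"] by auto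
    then show "F (pt b) * delta b c = (if b = a then F (pt b) else 0)" by (simp add: delta_def)
  qed
  then show "F c = (\<Sum>b<N. F (pt b) * delta b c)" using a periodicD[OF F a(2)] by simp
qed

lemma app_periodic:
  assumes F: "periodic F"
  shows "app Y F c = (\<Sum>b<N. app Y (delta b) c * F (pt b))"
proof -
  have "app Y F c = app Y (\<lambda>c. \<Sum>b<N. F (pt b) * delta b c) c"
    using periodic_expand[OF F] by simp
  also have "\<dots> = (\<Sum>b<N. F (pt b) * app Y (delta b) c)" by (simp only: app_sum app_smult)
  finally show ?thesis by (simp add: mult.commute)
qed

text \<open>In the basis of indicator functions \<open>delta b\<close>, composition of stable
  operators becomes multiplication of N x N matrices over the coefficient ring.\<close>

lemma app_word_periodic:
  assumes r: "\<And>x. stable (r x)" and F: "periodic F" and a: "a < N"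
  shows "app (prod_list (map r w)) F (pt a) =
    (\<Sum>b<N. word_entry N (\<lambda>x c b. app (r x) (delta b) (pt c)) w a b * F (pt b))"
  using a
proof (induction w arbitrary: a)
  case Nil
  have "(\<Sum>b<N. word_entry N (\<lambda>x c b. app (r x) (delta b) (pt c)) [] a b * F (pt b)) =
      (\<Sum>b<N. if b = a then F (pt b) else 0)"
    by (intro sum.cong) auto
  then show ?case using Nil by simp
next
  case (Cons x w)
  let ?W = "word_entry N (\<lambda>x c b. app (r x) (delta b) (pt c))" and ?G = "app (prod_list (map r w)) F"
  have "periodic ?G" by (intro stableD[OF stable_prod_list] r F)
  then have "app (prod_list (map r (x # w))) F (pt a) =
      (\<Sum>c<N. app (r x) (delta c) (pt a) * ?G (pt c))"
    using app_periodic[of ?G "r x"] by simp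
  also have "\<dots> = (\<Sum>c<N. \<Sum>b<N. app (r x) (delta c) (pt a) * ?W w c b * F (pt b))"
    using Cons.IH by (simp add: sum_distrib_left mult.assoc)
  also have "\<dots> = (\<Sum>b<N. ?W (x # w) a b * F (pt b))"
    by (subst sum.swap) (simp add: sum_distrib_right)
  finally show ?case .
qed

text \<open>The value at \<open>pt a\<close> is a row sum of the standard polynomial in
  \<open>2 * N\<close> matrices of size \<open>N\<close>. Periodicity of the result extends the
  vanishing from the points \<open>pt a\<close> to all points.\<close>

lemma standard_identity_periodic:
  assumes r: "\<And>x. stable (r x)"
  shows "app (\<Sum>w\<in>permutations_of_set {..<2 * N}. of_int (word_sign w) * prod_list (map r w)) (\<lambda>a. 1) = (\<lambda>a. 0)"
    (is "app ?Y _ = _")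
proof
  fix c
  have p1: "periodic (\<lambda>a. 1)" by (simp add: periodic_def)
  have app_Y: "app ?Y F c = (\<Sum>w\<in>permutations_of_set {..<2 * N}. word_sign w * app (prod_list (map r w)) F c)" for F c
    by (simp add: app_sum_lop app_of_int)
  have z: "app ?Y (\<lambda>a. 1) (pt a) = 0" if a: "a < N" for a
  proof -
    let ?W = "word_entry N (\<lambda>x c b. app (r x) (delta b) (pt c))"
    have "app ?Y (\<lambda>a. 1) (pt a) = (\<Sum>w\<in>permutations_of_set {..<2 * N}. \<Sum>b<N. word_sign w * ?W w a b)"
      unfolding app_Y by (simp add: app_word_periodic[OF r p1 a] sum_distrib_left)
    also have "\<dots> = (\<Sum>b<N. alt_entry N (\<lambda>x c b. app (r x) (delta b) (pt c)) {..<2 * N} a b)"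
      by (subst sum.swap) (simp add: alt_entry_def)
    also have "\<dots> = 0" using a by (intro sum.neutral ballI Amitsur_Levitzki) auto
    finally show ?thesis .
  qed
  have "periodic (app (prod_list (map r w)) (\<lambda>a. 1))" for w
    by (intro stableD[OF stable_prod_list] r p1)
  then have per: "periodic (app ?Y (\<lambda>a. 1))"
    unfolding periodic_def app_Y by (metis (no_types, lifting) sum.cong)
  obtain a where a: "a < N" "peq c (pt a)" using ex_pt by blast
  show "app ?Y (\<lambda>a. 1) c = 0" unfolding periodicD[OF per a(2)] by (rule z[OF a(1)])
qed

section \<open>The standard polynomial as an identity of the algebra\<close>

definition std_poly :: "nat list \<Rightarrow> int" where
  "std_poly w = (if w \<in> permutations_of_set {..<2 * N} then word_sign w else 0)"

lemma std_poly_support: "{w. std_poly w \<noteq> 0} = permutations_of_set {..<2 * N}"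
proof -
  have "word_sign w \<noteq> (0 :: int)" for w
    by (induction w) (simp_all add: shuffle_sign_def)
  then show ?thesis by (auto simp: std_poly_def)
qed

lemma word_sign_sorted: "sorted w \<Longrightarrow> distinct w \<Longrightarrow> (word_sign w :: 'a::comm_ring_1) = 1"
proof (induction w)
  case (Cons x w)
  then have e: "{(t, u). t \<in> {x} \<and> u \<in> set w \<and> u < t} = {}" by auto
  have "shuffle_sign {x} (set w) = (1 :: 'a)" by (simp only: shuffle_sign_def e card.empty power_0)
  then show ?case using Cons by simp
qed simp

lemma nc_degree_std_poly: "nc_degree std_poly = 2 * N"
proof -
  have "length ` permutations_of_set {..<2 * N} = {2 * N}"
  proof (intro equalityI subsetI)
    fix l assume "l \<in> {2 * N}"
    moreover have "[0..<2 * N] \<in> permutations_of_set {..<2 * N}" by (auto simp: permutations_of_set_def)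
    ultimately show "l \<in> length ` permutations_of_set {..<2 * N}" by force
  qed (auto dest: length_finite_permutations_of_set)
  then show ?thesis by (simp add: nc_degree_def std_poly_support)
qed

lemma nc_monic_std_poly: "nc_monic std_poly"
  unfolding nc_monic_def nc_degree_std_poly
  by (intro exI[of _ "[0..<2 * N]"]) (auto simp: std_poly_def permutations_of_set_def word_sign_sorted)

lemma std_poly_carrier: "std_poly \<in> carrier (free_algebra UNIV)"
  by (simp add: free_algebra_carrier_iff std_poly_support)

text \<open>The value of the standard polynomial is so far known only to kill the constant function
  1. It is the image of an element of the free algebra; outside the ideal this element would have an
  invertible leading part, which does not kill 1.\<close>

lemma std_poly_identity:
  assumes "range r \<subseteq> evl gens ` carrier FA"
  shows "(\<Sum>w\<in>{w. std_poly w \<noteq> 0}. of_int (std_poly w) * prod_list (map r w)) = 0"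
proof -
  interpret h: ring_hom_ring FA univ_ring "evl gens" by (rule evl_gens_hom)
  define s where "s i = (SOME x. x \<in> carrier FA \<and> evl gens x = r i)" for i
  have s: "s i \<in> carrier FA \<and> evl gens (s i) = r i" for i
  proof -
    have "r i \<in> evl gens ` carrier FA" using assms by (rule subsetD) simp
    then have "\<exists>x. x \<in> carrier FA \<and> evl gens x = r i" by (elim imageE) auto
    then show ?thesis unfolding s_def by (rule someI_ex)
  qed
  have r: "stable (r i)" for i using stable_evl s by metis
  let ?g = "nc_eval FA s std_poly"
  have fin: "finite {w. std_poly w \<noteq> 0}" by (simp add: std_poly_support)
  have "foldr (\<lambda>i a. s i \<otimes>\<^bsub>FA\<^esub> a) w \<one>\<^bsub>FA\<^esub> \<in> carrier FA" for w
    using s by (induction w) simp_all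
  then have g: "?g \<in> carrier FA"
    unfolding nc_eval_def by (intro FA.finsum_closed) (simp add: FA.add.int_pow_closed)
  have "evl gens ?g = (\<Sum>w\<in>{w. std_poly w \<noteq> 0}. of_int (std_poly w) * prod_list (map r w))"
    using s by (subst h.hom_nc_eval[OF fin]) (simp_all add: nc_eval_univ_ring[OF fin])
  moreover have "\<dots> = (\<Sum>w\<in>permutations_of_set {..<2 * N}. of_int (word_sign w) * prod_list (map r w))"
    unfolding std_poly_support by (intro sum.cong) (simp_all add: std_poly_def)
  ultimately have e: "app (evl gens ?g) (\<lambda>a. 1) = (\<lambda>a. 0)"
    using standard_identity_periodic[OF r] by simp
  have "?g \<in> qideal"
  proof (rule ccontr)
    assume "?g \<notin> qideal"
    then obtain d t where "lead (evl gens ?g) d t" "invertible_lop t" using lead_nonideal[OF g] by blast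
    then show False using lead_eq_zero_imp[OF _ e] invertible_lop_nonzero by blast
  qed
  then have "evl gens ?g = 0" using qideal_sub_kernel by blast
  then show ?thesis
    using s by (subst (asm) h.hom_nc_eval[OF fin]) (simp_all add: nc_eval_univ_ring[OF fin])
qed

end

section \<open>Matrix units in the symbol algebra\<close>

lemma sum_telescope_nat:
  fixes f :: "nat \<Rightarrow> int"
  shows "(\<Sum>i\<in>{1..k}. f i - f (i - 1)) = f k - f 0"
  by (induction k) simp_all

text \<open>Along a subdiagonal, \<open>gam\<close> is a difference of consecutive partial row sums,
  so the sum telescopes to row \<open>r\<close>.\<close>

lemma gam_lower_sum:
  assumes "d \<le> r" "r < n"
  shows "(\<Sum>j\<in>{1..d}. gam n (j + r - d) j c) = (\<Sum>t\<in>{1..d}. c (r, t))"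
proof -
  define H where "H j = (\<Sum>t\<in>{1..j}. crd n c (j + r - d) t)" for j
  have "gam n (j + r - d) j c = H j - H (j - 1)" if "j \<in> {1..d}" for j
  proof -
    have i: "j + r - d - 1 = (j - 1) + r - d" using that assms by auto
    have "{1..<j} = {1..j - 1}" using that by auto
    then show ?thesis
      using that assms unfolding gam_def H_def i by simp
  qed
  then have "(\<Sum>j\<in>{1..d}. gam n (j + r - d) j c) = H d - H 0"
    using sum_telescope_nat[of H d] by simp
  also have "\<dots> = (\<Sum>t\<in>{1..d}. c (r, t))"
    using assms by (simp add: H_def crd_def)
  finally show ?thesis .
qed

lemma gam_upper_sum:
  assumes "d \<le> r" "r < n"
  shows "(\<Sum>i\<in>{1..r - d}. gam n i (i + d) c) = (\<Sum>t\<in>{d + 1..r}. c (r, t))"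
proof (cases "d = 0")
  \<comment> \<open>Entries on the main diagonal fall under the lower formula of
    \<open>gam\<close>.\<close>
  case True
  then show ?thesis using gam_lower_sum[of r r n c] assms by simp
next
  case False
  define K where "K i = (\<Sum>t\<in>{1..i}. crd n c (i + d) (i + d + 1 - t))" for i
  have "gam n i (i + d) c = K i - K (i - 1)" if "i \<in> {1..r - d}" for i
  proof -
    have i: "i - 1 + d = i + d - 1" "i + d - 1 + 1 - t = i + d - t" for t using that by auto
    have "{1..<i} = {1..i - 1}" using that by auto
    then show ?thesis
      using False unfolding gam_def K_def i by simp
  qed
  then have "(\<Sum>i\<in>{1..r - d}. gam n i (i + d) c) = K (r - d) - K 0"
    using sum_telescope_nat[of K "r - d"] by simp
  also have "\<dots> = (\<Sum>t\<in>{1..r - d}. c (r, r + 1 - t))"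
    using assms by (simp add: K_def crd_def)
  also have "\<dots> = (\<Sum>t\<in>{d + 1..r}. c (r, t))"
    by (rule sum.reindex_bij_witness[where i = "\<lambda>t. r + 1 - t" and j = "\<lambda>t. r + 1 - t"]) (use assms in auto)
  finally show ?thesis .
qed

text \<open>Both sides are indicators of the same region. The shifts of the two pieces of a wrapped
  diagonal therefore cancel when one piece is inverted, and only a multiplication operator
  remains.\<close>

lemma mu_diagonal_sum:
  assumes "d \<le> r"
  shows "(\<Sum>i\<in>{1..r - d}. mu i (i + d) x) = (\<Sum>j\<in>{1..d}. mu (j + r - d) j x)"
proof -
  obtain r' d' where x: "x = (r', d')" by (cases x)
  have "(\<Sum>i\<in>{1..r - d}. mu i (i + d) x) =
      of_bool ((d' \<le> r' + 1 \<and> d' \<le> d \<and> 0 < d') \<and> r' + 1 - d' \<in> {1..r - d})"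
    by (rule sum_eq_of_bool) (auto simp: mu_def x)
  moreover have "(\<Sum>j\<in>{1..d}. mu (j + r - d) j x) =
      of_bool ((d' \<le> r' \<and> r' < d' + r - d) \<and> d' \<in> {1..d})"
    using assms by (intro sum_eq_of_bool) (auto simp: mu_def x)
  ultimately show ?thesis using assms by (auto simp: of_bool_def)
qed

context root_torus
begin

section \<open>Shifts and exponents realized by words\<close>

definition muw :: "(nat \<times> nat) list \<Rightarrow> nat \<times> nat \<Rightarrow> int" where
  "muw w x = sum_list (map (\<lambda>(i, j). mu i j x) w)"

definition gamw :: "(nat \<times> nat) list \<Rightarrow> (nat \<times> nat \<Rightarrow> int) \<Rightarrow> int" where
  "gamw w c = sum_list (map (\<lambda>(i, j). gam n i j c) w)"

lemma gamw_diff: "gamw w (\<lambda>x. a x - b x) = gamw w a - gamw w b"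
  by (induction w) (auto simp: gamw_def gam_diff)

text \<open>A word acts as one weighted shift; the constant \<open>k\<close> collects the powers of
  q that arise from evaluating later weights at shifted points.\<close>

lemma app_symb_word:
  "\<exists>k. k \<noteq> 0 \<and> (\<forall>F c. app (prod_list (map symb w)) F c = k * q powi gamw w c * F (\<lambda>x. c x - muw w x))"
proof (induction w)
  case Nil
  show ?case by (intro exI[of _ 1]) (simp add: gamw_def muw_def)
next
  case (Cons y w)
  obtain i j where y: "y = (i, j)" by (cases y)
  obtain k where k: "k \<noteq> 0" "\<And>F c. app (prod_list (map symb w)) F c = k * q powi gamw w c * F (\<lambda>x. c x - muw w x)"
    using Cons by blast
  have "app (prod_list (map symb (y # w))) F c =
      (k * q powi - gamw w (mu i j)) * q powi gamw (y # w) c * F (\<lambda>x. c x - muw (y # w) x)" for F c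
  proof -
    have "gamw (y # w) c = gam n i j c + gamw w c" "muw (y # w) x = mu i j x + muw w x" for x
      by (simp_all add: gamw_def muw_def y)
    moreover have "q powi gamw w (\<lambda>x. c x - mu i j x) = q powi - gamw w (mu i j) * q powi gamw w c"
      using q by (simp add: gamw_diff flip: power_int_add)
    moreover have "app (prod_list (map symb (y # w))) F c =
        q powi gam n i j c * app (prod_list (map symb w)) F (\<lambda>x. c x - mu i j x)"
      by (simp add: symb_def y sym_def)
    ultimately show ?thesis
      unfolding k(2) using q by (simp add: power_int_add diff_diff_eq ac_simps)
  qed
  then show ?case using k(1) q by (intro exI[of _ "k * q powi - gamw w (mu i j)"]) simp
qed

text \<open>On periodic functions only residues modulo \<open>m\<close> of shifts and exponents
  matter. Scalar factors are ignored because the symbol algebra contains all scalars.\<close>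

definition realizable :: "(nat \<times> nat \<Rightarrow> int) \<Rightarrow> ((nat \<times> nat \<Rightarrow> int) \<Rightarrow> int) \<Rightarrow> bool" where
  "realizable M G \<longleftrightarrow> (\<exists>w. set w \<subseteq> matrix_indices n \<and> peq (muw w) M \<and>
    (\<forall>c. gamw w c mod int m = G c mod int m))"

lemma realizable_zero: "realizable (\<lambda>x. 0) (\<lambda>c. 0)"
  unfolding realizable_def by (intro exI[of _ "[]"]) (simp add: peq_def muw_def gamw_def)

lemma realizable_letter:
  "i \<in> {1..n} \<Longrightarrow> j \<in> {1..n} \<Longrightarrow> realizable (mu i j) (gam n i j)"
  unfolding realizable_def
  by (intro exI[of _ "[(i, j)]"]) (simp add: peq_def muw_def gamw_def matrix_indices_def)

lemma realizable_add:
  assumes "realizable M G" "realizable M' G'"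
  shows "realizable (\<lambda>x. M x + M' x) (\<lambda>c. G c + G' c)"
proof -
  obtain w w' where w: "set w \<subseteq> matrix_indices n" "peq (muw w) M" "\<And>c. gamw w c mod int m = G c mod int m"
    and w': "set w' \<subseteq> matrix_indices n" "peq (muw w') M'" "\<And>c. gamw w' c mod int m = G' c mod int m"
    using assms unfolding realizable_def by blast
  have "muw (w @ w') = (\<lambda>x. muw w x + muw w' x)" "gamw (w @ w') c = gamw w c + gamw w' c" for c
    by (simp_all add: muw_def gamw_def fun_eq_iff)
  then show ?thesis
    unfolding realizable_def using w w'
    by (intro exI[of _ "w @ w'"]) (auto intro!: mod_add_cong peq_add)
qed

lemma realizable_cong:
  assumes "realizable M G" "peq M M'" "\<And>c. G c mod int m = G' c mod int m"
  shows "realizable M' G'"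
proof -
  obtain w where w: "set w \<subseteq> matrix_indices n" "peq (muw w) M" "\<And>c. gamw w c mod int m = G c mod int m"
    using assms(1) unfolding realizable_def by blast
  then show ?thesis
    unfolding realizable_def using assms(3) peq_trans[OF w(2) assms(2)] by (intro exI[of _ w]) simp
qed

lemma realizable_nat_mult:
  assumes "realizable M G" shows "realizable (\<lambda>x. int k * M x) (\<lambda>c. int k * G c)"
proof (induction k)
  case (Suc k)
  have "(\<lambda>x. M x + int k * M x) = (\<lambda>x. int (Suc k) * M x)" "(\<lambda>c. G c + int k * G c) = (\<lambda>c. int (Suc k) * G c)"
    by (simp_all add: algebra_simps)
  then show ?case using realizable_add[OF assms Suc] by simp
qed (simp add: realizable_zero)

text \<open>A multiplier may be replaced by its nonnegative residue modulo \<open>m\<close>. Words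
  in the generators thus also provide inverses.\<close>

lemma realizable_mult:
  assumes "realizable M G" shows "realizable (\<lambda>x. k * M x) (\<lambda>c. k * G c)"
proof (rule realizable_cong[OF realizable_nat_mult[OF assms, of "nat (k mod int m)"]])
  have k: "int (nat (k mod int m)) = k mod int m" using m_pos by simp
  show "peq (\<lambda>x. int (nat (k mod int m)) * M x) (\<lambda>x. k * M x)"
    unfolding peq_def k by (simp add: mod_mult_left_eq)
  show "int (nat (k mod int m)) * G c mod int m = k * G c mod int m" for c
    unfolding k by (simp add: mod_mult_left_eq)
qed

lemma realizable_diff:
  assumes "realizable M G" "realizable M' G'"
  shows "realizable (\<lambda>x. M x - M' x) (\<lambda>c. G c - G' c)"
  using realizable_add[OF assms(1) realizable_mult[OF assms(2), of "-1"]] by simp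

lemma realizable_sum:
  "(\<And>i. i \<in> A \<Longrightarrow> realizable (M i) (G i)) \<Longrightarrow> realizable (\<lambda>x. \<Sum>i\<in>A. M i x) (\<lambda>c. \<Sum>i\<in>A. G i c)"
  by (induction A rule: infinite_finite_induct) (simp_all add: realizable_zero realizable_add)

text \<open>
  The alternating products of the generators along the wrapped diagonals of the upper left
  \<open>r \<times> r\<close> block act by multiplication operators only: they are central in the torus of that block.
\<close>

lemma realizable_diagonal:
  assumes "d \<le> r" "r < n"
  shows "realizable (\<lambda>x. 0) (\<lambda>c. (\<Sum>t\<in>{d + 1..r}. c (r, t)) - (\<Sum>t\<in>{1..d}. c (r, t)))"
proof -
  have "realizable (\<lambda>x. (\<Sum>i\<in>{1..r - d}. mu i (i + d) x) - (\<Sum>j\<in>{1..d}. mu (j + r - d) j x))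
      (\<lambda>c. (\<Sum>i\<in>{1..r - d}. gam n i (i + d) c) - (\<Sum>j\<in>{1..d}. gam n (j + r - d) j c))"
    using assms by (intro realizable_diff realizable_sum realizable_letter) auto
  then show ?thesis
    unfolding mu_diagonal_sum[OF assms(1)] gam_lower_sum[OF assms] gam_upper_sum[OF assms] by simp
qed

text \<open>Consecutive wrapped diagonals differ by twice the coordinate \<open>c (r, d)\<close>.
  For odd \<open>m\<close> the factor 2 has the inverse \<open>(m + 1) div 2\<close> modulo
  \<open>m\<close>.\<close>

lemma realizable_clock:
  assumes m: "odd m" and p: "(r, d) \<in> Pos n"
  shows "realizable (\<lambda>x. 0) (\<lambda>c. c (r, d))"
proof -
  have rd: "1 \<le> d" "d \<le> r" "r < n" using p by (auto simp: Pos_def)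
  let ?U = "\<lambda>d c. (\<Sum>t\<in>{d + 1..r}. c (r, t)) - (\<Sum>t\<in>{1..d}. c (r, t)) :: int"
  have "realizable (\<lambda>x. 0 - 0) (\<lambda>c. ?U (d - 1) c - ?U d c)"
    using rd by (intro realizable_diff realizable_diagonal) auto
  moreover have "?U (d - 1) c - ?U d c = 2 * c (r, d)" for c
  proof -
    have "{d - 1 + 1..r} = insert d {d + 1..r}" "{1..d} = insert d {1..d - 1}" using rd by auto
    then show ?thesis using rd by simp
  qed
  ultimately have "realizable (\<lambda>x. 0) (\<lambda>c. 2 * c (r, d))" by simp
  then have R: "realizable (\<lambda>x. (int m + 1) div 2 * 0) (\<lambda>c. (int m + 1) div 2 * (2 * c (r, d)))"
    by (rule realizable_mult)
  have half: "(int m + 1) div 2 * (2 * c (r, d)) mod int m = c (r, d) mod int m" for c :: "nat \<times> nat \<Rightarrow> int"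
  proof -
    have "(int m + 1) div 2 * 2 = int m + 1" using m by (elim oddE) simp
    then have "(int m + 1) div 2 * (2 * c (r, d)) = (int m + 1) * c (r, d)" by (simp flip: mult.assoc)
    also have "\<dots> = c (r, d) + int m * c (r, d)" by (simp add: algebra_simps)
    finally show ?thesis by simp
  qed
  show ?thesis
  proof (rule realizable_cong[OF R])
    show "(int m + 1) div 2 * (2 * c (r, d)) mod int m = c (r, d) mod int m" for c by (rule half)
  qed (simp add: peq_def)
qed

text \<open>Moving one row down within column \<open>d\<close>, from row \<open>r\<close>, changes
  the shift exactly at the coordinate \<open>(r, d)\<close>. The accompanying exponent
  \<open>G\<close> can stay unspecified, since projectors later reduce it to a nonzero
  scalar.\<close>

lemma realizable_shift:
  assumes p: "(r, d) \<in> Pos n"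
  shows "\<exists>G. realizable (\<lambda>x. of_bool (x = (r, d))) G"
proof -
  have rd: "1 \<le> d" "d \<le> r" "r < n" using p by (auto simp: Pos_def)
  have "realizable (\<lambda>x. mu (r + 1) d x - mu r d x) (\<lambda>c. gam n (r + 1) d c - gam n r d c)"
    using rd by (intro realizable_diff realizable_letter) auto
  moreover have "(\<lambda>x. mu (r + 1) d x - mu r d x) = (\<lambda>x. of_bool (x = (r, d)))"
    using rd by (auto simp: mu_def fun_eq_iff of_bool_def)
  ultimately show ?thesis by auto
qed

lemma realizable_target: "\<exists>G. realizable t G"
proof -
  have "\<exists>G. realizable (\<lambda>x. \<Sum>y\<in>A. t y * of_bool (x = y)) G" if "finite A" "A \<subseteq> Pos n" for A
    using that
  proof (induction A rule: finite_induct)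
    case empty
    then show ?case using realizable_zero by auto
  next
    case (insert y A)
    obtain G where G: "realizable (\<lambda>x. \<Sum>y\<in>A. t y * of_bool (x = y)) G" using insert by auto
    obtain G' where G': "realizable (\<lambda>x. of_bool (x = y)) G'"
      using realizable_shift[of "fst y" "snd y"] insert.prems by auto
    show ?case
      unfolding sum.insert[OF insert.hyps] by (intro exI) (rule realizable_add[OF realizable_mult[OF G'] G])
  qed
  from this[OF finite_Pos order_refl]
  obtain G where G: "realizable (\<lambda>x. \<Sum>y\<in>Pos n. t y * of_bool (x = y)) G" by (elim exE)
  have "(\<Sum>y\<in>Pos n. t y * of_bool (x = y)) = t x" if "x \<in> Pos n" for x
  proof -
    have "(\<Sum>y\<in>Pos n. t y * of_bool (x = y)) = (\<Sum>y\<in>Pos n. if y = x then t y else 0)"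
      by (intro sum.cong) auto
    then show ?thesis using that by simp
  qed
  then have "realizable t G" by (intro realizable_cong[OF G]) (auto simp: peq_def)
  then show ?thesis by blast
qed

end

lemma of_int_times_lop: "of_int k * Y = scl (of_int k) Y"
  by (rule lop_eqI) (simp add: app_of_int)

text \<open>Otherwise the nonzero polynomial with coefficients 1 in degrees 0 to
  \<open>m - 1\<close> would vanish at 1 as well as at the other powers of \<open>q\<close>, and so
  would have \<open>m\<close> distinct roots.\<close>

lemma primitive_root_order_nonzero:
  assumes "primitive_root_of_unity m (q :: 'k::field)"
  shows "of_nat m \<noteq> (0 :: 'k)"
proof
  assume z: "of_nat m = (0 :: 'k)"
  have m: "m > 0" "q ^ m = 1" "\<And>j. 0 < j \<Longrightarrow> j < m \<Longrightarrow> q ^ j \<noteq> 1"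
    using assms by (auto simp: primitive_root_of_unity_def)
  then have q0: "q \<noteq> 0" by (metis power_0_left zero_neq_one less_not_refl)
  define P :: "'k poly" where "P = (\<Sum>i<m. monom 1 i)"
  have poly_P: "poly P x = (\<Sum>i<m. x ^ i)" for x by (simp add: P_def poly_sum poly_monom)
  have "poly P (q ^ j) = 0" if "j < m" for j
  proof (cases "j = 0")
    case True
    then show ?thesis using z by (simp add: poly_P)
  next
    case False
    then have "q ^ j \<noteq> 1" using m that by simp
    moreover have "(q ^ j) ^ m = 1" using m by (metis power_commutes power_mult power_one mult.commute)
    ultimately show ?thesis by (simp add: poly_P sum_gp_strict)
  qed
  then have sub: "(\<lambda>j. q ^ j) ` {..<m} \<subseteq> {x. poly P x = 0}" by auto
  have "inj_on (\<lambda>j. q ^ j) {..<m}"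
  proof (rule linorder_inj_onI)
    fix i j assume ij: "i < j" "i \<in> {..<m}" "j \<in> {..<m}"
    have "q ^ j = q ^ i * q ^ (j - i)" using ij by (simp flip: power_add)
    then show "q ^ i \<noteq> q ^ j" using m(3)[of "j - i"] ij q0 by auto
  qed auto
  then have "card ((\<lambda>j. q ^ j) ` {..<m}) = m" by (simp add: card_image)
  moreover have "coeff P 0 = 1" using m by (simp add: P_def coeff_sum)
  then have P0: "P \<noteq> 0" by auto
  moreover have "degree P \<le> m - 1"
    unfolding P_def by (rule degree_sum_le) (auto intro: degree_monom_le[THEN order_trans])
  moreover have "card {x. poly P x = 0} \<le> degree P" by (rule card_poly_roots_bound[OF P0])
  moreover have "card ((\<lambda>j. q ^ j) ` {..<m}) \<le> card {x. poly P x = 0}"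
    using sub poly_roots_finite[OF P0] by (rule card_mono[rotated])
  ultimately show False using m by linarith
qed

context root_torus
begin

inductive_set symbol_algebra :: "(nat \<times> nat \<Rightarrow> int, 'k) lop set" where
  word: "set w \<subseteq> matrix_indices n \<Longrightarrow> prod_list (map symb w) \<in> symbol_algebra"
| scl: "s \<in> symbol_algebra \<Longrightarrow> scl c s \<in> symbol_algebra"
| add: "s \<in> symbol_algebra \<Longrightarrow> t \<in> symbol_algebra \<Longrightarrow> s + t \<in> symbol_algebra"

lemma symbol_algebra_mult:
  assumes "s \<in> symbol_algebra" "t \<in> symbol_algebra"
  shows "s * t \<in> symbol_algebra"
  using assms(1)
proof (induction rule: symbol_algebra.induct)
  case (word v)
  show ?case using assms(2)
  proof (induction rule: symbol_algebra.induct)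
    case (word w)
    then show ?case using symbol_algebra.word[of "v @ w"] \<open>set v \<subseteq> _\<close> by simp
  qed (simp_all add: scl_simps distrib_left symbol_algebra.intros)
qed (simp_all add: scl_simps distrib_right symbol_algebra.intros)

lemma symbol_algebra_one: "1 \<in> symbol_algebra"
  using symbol_algebra.word[of "[]"] by simp

lemma symbol_algebra_zero: "0 \<in> symbol_algebra"
  using symbol_algebra.scl[OF symbol_algebra_one, of 0] by (simp add: scl_coeff_simps)

lemma symbol_algebra_sum: "(\<And>x. x \<in> A \<Longrightarrow> f x \<in> symbol_algebra) \<Longrightarrow> (\<Sum>x\<in>A. f x) \<in> symbol_algebra"
  by (induction A rule: infinite_finite_induct) (auto simp: symbol_algebra_zero symbol_algebra.add)

lemma symbol_algebra_power: "s \<in> symbol_algebra \<Longrightarrow> s ^ k \<in> symbol_algebra"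
  by (induction k) (simp_all add: symbol_algebra_one symbol_algebra_mult)

lemma stable_symb_word: "set w \<subseteq> matrix_indices n \<Longrightarrow> stable (prod_list (map symb w))"
  by (intro stable_prod_list) (auto simp: symb_def matrix_indices_def intro!: stable_tor)

lemma stable_symbol_algebra: "s \<in> symbol_algebra \<Longrightarrow> stable s"
  by (induction rule: symbol_algebra.induct) (simp_all add: stable_symb_word stable_scl stable_add)

section \<open>Clock operators, projectors and matrix units\<close>

lemma ex_clock:
  assumes "odd m" "x \<in> Pos n"
  shows "\<exists>s\<in>symbol_algebra. \<forall>F. periodic F \<longrightarrow> (\<forall>c. app s F c = q powi c x * F c)"
proof -
  obtain w where w: "set w \<subseteq> matrix_indices n" "peq (muw w) (\<lambda>x. 0)" "\<And>c. gamw w c mod int m = c x mod int m"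
    using realizable_clock[OF assms(1), of "fst x" "snd x"] assms(2) unfolding realizable_def by auto
  obtain k where k: "k \<noteq> 0" "\<And>F c. app (prod_list (map symb w)) F c = k * q powi gamw w c * F (\<lambda>x. c x - muw w x)"
    using app_symb_word by blast
  have "app (scl (inverse k) (prod_list (map symb w))) F c = q powi c x * F c" if F: "periodic F" for F c
  proof -
    have "peq (\<lambda>x. c x - muw w x) (\<lambda>x. c x - 0)" by (rule peq_diff[OF peq_refl w(2)])
    then have "F (\<lambda>x. c x - muw w x) = F c" using periodicD[OF F] by simp
    moreover have "q powi gamw w c = q powi c x" by (rule power_int_cong_root[OF q q_m w(3)])
    ultimately show ?thesis using k by simp
  qed
  then show ?thesis using symbol_algebra.scl[OF symbol_algebra.word[OF w(1)]] by blast
qed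

lemma power_int_eq_one_iff: "q powi e = 1 \<longleftrightarrow> int m dvd e"
proof
  assume "int m dvd e"
  then show "q powi e = 1" using power_int_cong_root[OF q q_m, of e 0] by (simp add: dvd_eq_mod_eq_0)
next
  assume e: "q powi e = 1"
  have "q powi e = q powi (e mod int m)" by (rule power_int_cong_root[OF q q_m]) simp
  also have "\<dots> = q ^ nat (e mod int m)" using m_pos by (simp add: power_int_def)
  finally have "q ^ nat (e mod int m) = 1" using e by simp
  moreover have "nat (e mod int m) < m" using m_pos by (simp add: nat_less_iff)
  ultimately have "\<not> 0 < nat (e mod int m)"
    using root[unfolded primitive_root_of_unity_def, THEN conjunct2, THEN conjunct2, rule_format,
        of "nat (e mod int m)"] by auto
  moreover have "0 \<le> e mod int m" using m_pos by simp
  ultimately have "e mod int m = 0" by simp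
  then show "int m dvd e" by (simp add: dvd_eq_mod_eq_0)
qed

lemma sum_powers_root: "(\<Sum>j<m. (q powi e) ^ j) = of_nat m * of_bool (int m dvd e)"
proof (cases "int m dvd e")
  case True
  then have "q powi e = 1" by (simp add: power_int_eq_one_iff)
  then show ?thesis using True by simp
next
  case False
  then have "q powi e \<noteq> 1" by (simp add: power_int_eq_one_iff)
  moreover have "(q powi e) ^ m = (q ^ m) powi e" by (metis power_int_mult power_int_of_nat mult.commute)
  ultimately show ?thesis using False q_m by (simp add: sum_gp_strict)
qed

text \<open>Finite Fourier inversion: the powers of the clock operator, weighted by the character
  with value \<open>q powi - v\<close>, are averaged over the residues modulo
  \<open>m\<close>.\<close>

lemma ex_projector1:
  assumes "odd m" "x \<in> Pos n"
  shows "\<exists>s\<in>symbol_algebra. \<forall>F. periodic F \<longrightarrow> (\<forall>c. app s F c = of_bool (c x mod int m = v mod int m) * F c)"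
proof -
  obtain s where s: "s \<in> symbol_algebra" "\<And>F c. periodic F \<Longrightarrow> app s F c = q powi c x * F c"
    using ex_clock[OF assms] by blast
  have per: "periodic (app (s ^ j) F)" if "periodic F" for j F
    using stable_symbol_algebra[OF symbol_algebra_power[OF s(1)]] that by (rule stableD)
  have pow: "app (s ^ j) F c = (q powi c x) ^ j * F c" if F: "periodic F" for j F c
    by (induction j arbitrary: c) (simp_all add: s(2)[OF per[OF F]])
  define t where "t = scl (inverse (of_nat m)) (\<Sum>j<m. scl ((q powi - v) ^ j) (s ^ j))"
  have "t \<in> symbol_algebra"
    unfolding t_def by (intro symbol_algebra.scl symbol_algebra_sum symbol_algebra_power s)
  moreover have "app t F c = of_bool (c x mod int m = v mod int m) * F c" if F: "periodic F" for F c
  proof -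
    have "app t F c = inverse (of_nat m) * (\<Sum>j<m. (q powi - v) ^ j * ((q powi c x) ^ j * F c))"
      by (simp add: t_def app_sum_lop pow[OF F])
    also have "(\<Sum>j<m. (q powi - v) ^ j * ((q powi c x) ^ j * F c)) = (\<Sum>j<m. (q powi (c x - v)) ^ j) * F c"
      using q by (simp add: sum_distrib_right power_mult_distrib[symmetric] mult.assoc[symmetric] power_int_add[symmetric])
    also have "\<dots> = of_nat m * of_bool (int m dvd c x - v) * F c" by (simp add: sum_powers_root)
    finally show ?thesis using primitive_root_order_nonzero[OF root] by (simp add: mod_eq_dvd_iff)
  qed
  ultimately show ?thesis by blast
qed

lemma ex_projector:
  assumes m: "odd m"
  shows "\<exists>s\<in>symbol_algebra. \<forall>F. periodic F \<longrightarrow> (\<forall>c. app s F c = of_bool (peq c v) * F c)"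
proof -
  have "\<exists>s\<in>symbol_algebra. \<forall>F. periodic F \<longrightarrow>
      (\<forall>c. app s F c = of_bool (\<forall>x\<in>A. c x mod int m = v x mod int m) * F c)"
    if "finite A" "A \<subseteq> Pos n" for A
    using that
  proof (induction A rule: finite_induct)
    case empty
    then show ?case by (intro bexI[OF _ symbol_algebra_one]) simp
  next
    case (insert y A)
    obtain s where s: "s \<in> symbol_algebra" "\<And>F c. periodic F \<Longrightarrow>
        app s F c = of_bool (\<forall>x\<in>A. c x mod int m = v x mod int m) * F c"
      using insert by auto
    obtain t where t: "t \<in> symbol_algebra" "\<And>F c. periodic F \<Longrightarrow>
        app t F c = of_bool (c y mod int m = v y mod int m) * F c"
      using ex_projector1[OF m, of y "v y"] insert by auto
    have "app (t * s) F c = of_bool (\<forall>x\<in>insert y A. c x mod int m = v x mod int m) * F c" if F: "periodic F" for F c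
      using t(2)[OF stableD[OF stable_symbol_algebra[OF s(1)] F]] s(2)[OF F] by simp
    then show ?case using symbol_algebra_mult[OF t(1) s(1)] by blast
  qed
  from this[OF finite_Pos order_refl] show ?thesis unfolding peq_def .
qed

text \<open>A word that shifts by \<open>u - v\<close> is followed by the projector onto the class
  of \<open>u\<close>. On that class the weight of the word is a nonzero scalar and can be divided
  out.\<close>

lemma ex_matrix_unit:
  assumes m: "odd m"
  shows "\<exists>s\<in>symbol_algebra. \<forall>F. periodic F \<longrightarrow> (\<forall>c. app s F c = of_bool (peq c u) * F v)"
proof -
  obtain P where P: "P \<in> symbol_algebra" "\<And>F c. periodic F \<Longrightarrow> app P F c = of_bool (peq c u) * F c"
    using ex_projector[OF m, of u] by blast
  obtain w where w: "set w \<subseteq> matrix_indices n" "peq (muw w) (\<lambda>x. u x - v x)"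
    using realizable_target[of "\<lambda>x. u x - v x"] unfolding realizable_def by blast
  obtain k where k: "k \<noteq> 0" "\<And>F c. app (prod_list (map symb w)) F c = k * q powi gamw w c * F (\<lambda>x. c x - muw w x)"
    using app_symb_word by blast
  let ?W = "prod_list (map symb w)" and ?k = "k * q powi gamw w u"
  have k0: "?k \<noteq> 0" using k(1) q by simp
  have "app (scl (inverse ?k) (P * ?W)) F c = of_bool (peq c u) * F v" if F: "periodic F" for F c
  proof -
    have W: "periodic (app ?W F)" by (intro stableD[OF stable_symb_word] w F)
    have "peq (\<lambda>x. u x - muw w x) (\<lambda>x. u x - (u x - v x))" by (rule peq_diff[OF peq_refl w(2)])
    then have "F (\<lambda>x. u x - muw w x) = F v" using periodicD[OF F] by simp
    then have "app ?W F u = ?k * F v" by (simp add: k(2))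
    then have "app ?W F c = ?k * F v" if "peq c u" using periodicD[OF W that] by simp
    then show ?thesis using P(2)[OF W, of c] k0 by (cases "peq c u") (simp_all add: field_simps)
  qed
  moreover have "scl (inverse ?k) (P * ?W) \<in> symbol_algebra"
    by (intro symbol_algebra.scl symbol_algebra_mult P symbol_algebra.word w)
  ultimately show ?thesis by blast
qed

end

section \<open>Multilinear identities of the symbol algebra\<close>

lemma prod_list_map_upd:
  assumes "distinct p" "k \<in> set p"
  obtains A B where "\<And>s. prod_list (map (y(k := s)) p) = A * s * (B :: 'a::ring_1)"
proof -
  obtain a b where p: "p = a @ k # b" using split_list[OF assms(2)] by blast
  then have "k \<notin> set a" "k \<notin> set b" using assms(1) by auto
  then have e: "map (y(k := s)) a = map y a" "map (y(k := s)) b = map y b" for s by auto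
  have "prod_list (map (y(k := s)) p) = prod_list (map y a) * s * prod_list (map y b)" for s
    unfolding p map_append list.map prod_list.append prod_list.Cons e by (simp add: mult.assoc)
  then show ?thesis using that by blast
qed

context root_torus
begin

definition multi :: "nat \<Rightarrow> (nat list \<Rightarrow> int) \<Rightarrow> (nat \<Rightarrow> ('i, 'k) lop) \<Rightarrow> ('i, 'k) lop" where
  "multi d c y = (\<Sum>p\<in>permutations_of_set {..<d}. scl (of_int (c p)) (prod_list (map y p)))"

lemma multi_linear:
  assumes "k < d"
  shows "multi d c (y(k := s + t)) = multi d c (y(k := s)) + multi d c (y(k := t))"
    and "multi d c (y(k := scl r s)) = scl r (multi d c (y(k := s)))"
proof -
  have "prod_list (map (y(k := s + t)) p) = prod_list (map (y(k := s)) p) + prod_list (map (y(k := t)) p)"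
    "prod_list (map (y(k := scl r s)) p) = scl r (prod_list (map (y(k := s)) p))"
    if "p \<in> permutations_of_set {..<d}" for p
  proof -
    have "distinct p" "k \<in> set p" using that assms by (auto simp: permutations_of_set_def)
    then obtain A B where "\<And>s. prod_list (map (y(k := s)) p) = A * s * B"
      by (rule prod_list_map_upd[where y = y]) blast
    then show "prod_list (map (y(k := s + t)) p) = prod_list (map (y(k := s)) p) + prod_list (map (y(k := t)) p)"
      "prod_list (map (y(k := scl r s)) p) = scl r (prod_list (map (y(k := s)) p))"
      by (simp_all add: distrib_left distrib_right scl_simps)
  qed
  then show "multi d c (y(k := s + t)) = multi d c (y(k := s)) + multi d c (y(k := t))"
    "multi d c (y(k := scl r s)) = scl r (multi d c (y(k := s)))"
    unfolding multi_def
    by (simp_all add: scl_simps sum.distrib scl_sum mult.commute del: map_fun_upd cong: sum.cong)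
qed

text \<open>The arguments are generalized from words to arbitrary elements one at a time, by
  linearity in each argument.\<close>

lemma multi_symbol_algebra:
  assumes words: "\<And>y. (\<And>p. p < d \<Longrightarrow> \<exists>w. set w \<subseteq> matrix_indices n \<and> y p = prod_list (map symb w)) \<Longrightarrow> multi d c y = 0"
    and y: "\<And>p. p < d \<Longrightarrow> y p \<in> symbol_algebra"
  shows "multi d c y = 0"
proof -
  let ?word = "\<lambda>s. \<exists>w. set w \<subseteq> matrix_indices n \<and> s = prod_list (map symb w)"
  have "multi d c y = 0" if "k \<le> d" "\<And>p. p < k \<Longrightarrow> y p \<in> symbol_algebra" "\<And>p. k \<le> p \<Longrightarrow> p < d \<Longrightarrow> ?word (y p)" for k y
    using that
  proof (induction k arbitrary: y)
    case 0
    then show ?case by (intro words) auto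
  next
    case (Suc k)
    have "multi d c (y(k := s)) = 0" if "s \<in> symbol_algebra" for s
      using that
    proof (induction rule: symbol_algebra.induct)
      case (word w)
      show ?case using Suc.prems word by (intro Suc.IH) auto
    next
      case (scl s r)
      have "k < d" using Suc.prems by simp
      then show ?case by (simp only: multi_linear(2) scl.IH scl_simps)
    next
      case (add s t)
      have "k < d" using Suc.prems by simp
      then show ?case by (simp only: multi_linear(1) add.IH add_0)
    qed
    from this[of "y k"] show ?case using Suc.prems(2)[of k] by simp
  qed
  from this[of d y] show ?thesis using y by simp
qed

end

context root_torus
begin

text \<open>The degree of a product does not depend on the order of its factors. All permutations
  therefore contribute in the same degree, and the identity passes to leading parts, first for words
  and then by multilinearity.\<close>

lemma multi_symbols:
  assumes id: "\<And>y. (\<And>p. p < d \<Longrightarrow> y p \<in> evl gens ` carrier FA) \<Longrightarrow>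
      (\<Sum>p\<in>permutations_of_set {..<d}. of_int (c p) * prod_list (map y p)) = 0"
    and y: "\<And>p. p < d \<Longrightarrow> y p \<in> symbol_algebra"
  shows "multi d c y = 0"
proof (rule multi_symbol_algebra[OF _ y])
  fix y assume y: "\<And>p. p < d \<Longrightarrow> \<exists>w. set w \<subseteq> matrix_indices n \<and> y p = prod_list (map symb w)"
  then obtain v where v: "\<And>p. p < d \<Longrightarrow> set (v p) \<subseteq> matrix_indices n"
      "\<And>p. p < d \<Longrightarrow> y p = prod_list (map symb (v p))"
    by metis
  define z where "z p = prod_list (map gens (v p))" for p
  have "z p \<in> evl gens ` carrier FA" if "p < d" for p
    unfolding z_def evl_wmon[symmetric] by (rule imageI[OF wmon_carrier[OF v(1)[OF that]]])
  then have "0 = (\<Sum>p\<in>permutations_of_set {..<d}. of_int (c p) * prod_list (map z p))"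
    using id by simp
  also have "\<dots> = (\<Sum>p\<in>permutations_of_set {..<d}. scl (cst (of_int (c p))) (prod_list (map z p)))"
    by (simp only: of_int_times_lop single_of_int)
  finally have e: "(\<Sum>p\<in>permutations_of_set {..<d}. scl (cst (of_int (c p))) (prod_list (map z p))) = 0" by simp
  have "lead (\<Sum>p\<in>permutations_of_set {..<d}. scl (cst (of_int (c p))) (prod_list (map z p)))
      (\<Sum>p<d. wdeg (v p)) (multi d c y)"
    unfolding multi_def
  proof (intro lead_sum lead_scl)
    fix p assume p: "p \<in> permutations_of_set {..<d}"
    have "lead (prod_list (map z p)) (sum_list (map (\<lambda>p. wdeg (v p)) p)) (prod_list (map y p))"
    proof (rule lead_prod_list)
      fix x assume "x \<in> set p"
      then have "x < d" using p by (auto simp: permutations_of_set_def)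
      then show "lead (z x) (wdeg (v x)) (y x)" unfolding z_def by (simp add: v lead_word)
    qed
    moreover have "sum_list (map (\<lambda>p. wdeg (v p)) p) = (\<Sum>p<d. wdeg (v p))"
      using p by (simp add: permutations_of_set_def sum_list_distinct_conv_sum_set)
    ultimately show "lead (prod_list (map z p)) (\<Sum>p<d. wdeg (v p)) (prod_list (map y p))" by simp
  qed
  then show "multi d c y = 0" unfolding e by (rule lead_zeroD)
qed

text \<open>The staircase \<open>E\<^sub>0\<^sub>0, E\<^sub>0\<^sub>1, E\<^sub>1\<^sub>1, E\<^sub>1\<^sub>2, \<dots>\<close> has only one nonzero product.\<close>

lemma multilinear_identity_degree:
  assumes m: "odd m"
    and id: "\<And>y. (\<And>p. p < d \<Longrightarrow> y p \<in> evl gens ` carrier FA) \<Longrightarrow>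
      (\<Sum>p\<in>permutations_of_set {..<d}. of_int (c p) * prod_list (map y p)) = 0"
    and c: "c [0..<d] = 1"
  shows "2 * N \<le> d"
proof (rule ccontr)
  assume "\<not> 2 * N \<le> d"
  then have d: "d < 2 * N" by simp
  \<comment> \<open>\<open>y p\<close> is the matrix unit with row \<open>p div 2\<close> and column
    \<open>(p + 1) div 2\<close>. For \<open>p < d < 2 * N\<close> both indices lie below
    \<open>N\<close>, so different indices name different classes.\<close>
  have "\<exists>s. s \<in> symbol_algebra \<and> (\<forall>F. periodic F \<longrightarrow>
      (\<forall>c. app s F c = of_bool (peq c (pt (p div 2))) * F (pt ((p + 1) div 2))))" for p
    using ex_matrix_unit[OF m, of "pt (p div 2)" "pt ((p + 1) div 2)"] by blast
  then obtain y where y: "\<And>p. y p \<in> symbol_algebra"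
      "\<And>p F c. periodic F \<Longrightarrow> app (y p) F c = of_bool (peq c (pt (p div 2))) * F (pt ((p + 1) div 2))"
    by metis
  have per: "periodic (app (prod_list (map y p)) F)" if "periodic F" for p F
    by (intro stableD[OF stable_prod_list] stable_symbol_algebra y that)
  have p1: "periodic (\<lambda>a. 1 :: 'k)" by (simp add: periodic_def)
  have step: "app (y a * y b) F = (\<lambda>c. 0)" if F: "periodic F" and ab: "a < d" "b < d" "\<not> a \<le> b" for a b F
  proof
    fix e
    \<comment> \<open>Adjacent factors can have a nonzero product only for
      \<open>(a + 1) div 2 = b div 2\<close>, which forces \<open>a \<le> b\<close>.\<close>
    have "(a + 1) div 2 < N" "b div 2 < N" "(a + 1) div 2 \<noteq> b div 2" using ab d by linarith+
    then have "\<not> peq (pt ((a + 1) div 2)) (pt (b div 2))" by (simp add: peq_pt_iff)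
    then show "app (y a * y b) F e = 0"
      using y(2)[OF stableD[OF stable_symbol_algebra[OF y(1)] F], of a b e] y(2)[OF F, of b] by simp
  qed
  have unsorted: "app (prod_list (map y p)) F = (\<lambda>c. 0)"
    if F: "periodic F" and p: "set p \<subseteq> {..<d}" "\<not> sorted p" for p F
    using p
  proof (induction p rule: induct_list012)
    case (3 a b p)
    show ?case
    proof (cases "a \<le> b")
      case True
      then have "\<not> sorted (b # p)" using 3(4) unfolding sorted2 by blast
      then have "app (prod_list (map y (b # p))) F = (\<lambda>c. 0)" using 3 by simp
      then show ?thesis by simp
    next
      case False
      have "app (prod_list (map y (a # b # p))) F = app (y a * y b) (app (prod_list (map y p)) F)"
        by simp
      then show ?thesis using step[OF per[OF F, of p], of a b] False 3(3) by simp
    qed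
  qed simp_all
  \<comment> \<open>The tail of the staircase that starts at \<open>k\<close> maps 1 to a function
    with value 1 at the row index of its first factor; the empty tail is the base case.\<close>
  have stair: "app (prod_list (map y [k..<d])) (\<lambda>a. 1) (pt (k div 2)) = 1" if "k \<le> d" for k
    using that
  proof (induction "d - k" arbitrary: k)
    case (Suc j)
    then have k: "k < d" by simp
    have "app (prod_list (map y [Suc k..<d])) (\<lambda>a. 1) (pt (Suc k div 2)) = 1"
      using Suc k by simp
    then show ?case
      using y(2)[OF per[OF p1, of "[Suc k..<d]"], of k "pt (k div 2)"] k by (simp add: upt_conv_Cons)
  qed simp
  have "0 = app (multi d c y) (\<lambda>a. 1) (pt 0)"
    using multi_symbols[OF id y(1)] by simp
  also have "\<dots> = (\<Sum>p\<in>permutations_of_set {..<d}. of_int (c p) * app (prod_list (map y p)) (\<lambda>a. 1) (pt 0))"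
    by (simp add: multi_def app_sum_lop)
  also have "\<dots> = (\<Sum>p\<in>permutations_of_set {..<d}. if p = [0..<d] then 1 else 0)"
  proof (rule sum.cong[OF refl])
    fix p assume p: "p \<in> permutations_of_set {..<d}"
    show "of_int (c p) * app (prod_list (map y p)) (\<lambda>a. 1) (pt 0) = (if p = [0..<d] then 1 else 0)"
    proof (cases "p = [0..<d]")
      case True
      then show ?thesis using stair[of 0] c by simp
    next
      case False
      have "\<not> sorted p"
      proof
        assume "sorted p"
        moreover have "distinct p" "set p = set [0..<d]"
          using permutations_of_setD[OF p] by (simp_all add: atLeast_upt)
        ultimately have "p = [0..<d]"
          using sorted_distinct_set_unique[of p "[0..<d]"] by simp
        then show False using False by blast
      qed
      moreover have "set p \<subseteq> {..<d}" using permutations_of_setD(1)[OF p] by blast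
      ultimately have "app (prod_list (map y p)) (\<lambda>a. 1) = (\<lambda>c. 0)" by (intro unsorted[OF p1])
      then show ?thesis using False by (simp only: if_False mult_zero_right)
    qed
  qed
  also have "\<dots> = 1"
  proof -
    have "[0..<d] \<in> permutations_of_set {..<d}"
      unfolding permutations_of_set_def by (simp add: atLeast_upt)
    then show ?thesis by (subst sum.delta) (simp_all del: upt_Suc)
  qed
  finally show False by simp
qed

text \<open>Polarizing along a monic word of top degree gives the identity permutation the
  coefficient 1, which is nonzero in every characteristic. The other terms of the polynomial need
  not be homogeneous.\<close>

lemma polynomial_identity_degree:
  assumes m: "odd m" and P: "P \<in> carrier (free_algebra UNIV)" "nc_monic P"
    and id: "\<And>r. range r \<subseteq> evl gens ` carrier FA \<Longrightarrow>
      (\<Sum>w\<in>{w. P w \<noteq> 0}. of_int (P w) * prod_list (map r w)) = 0"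
  shows "2 * N \<le> nc_degree P"
proof -
  interpret h: ring_hom_ring FA univ_ring "evl gens" by (rule evl_gens_hom)
  have fin: "finite {w. P w \<noteq> 0}" using P(1) by (simp add: free_algebra_carrier_iff)
  have len: "length w \<le> nc_degree P" if "P w \<noteq> 0" for w
    unfolding nc_degree_def using fin that by (intro Max_ge) auto
  obtain w0 where w0: "P w0 = 1" "length w0 = nc_degree P"
    using P(2) unfolding nc_monic_def by blast
  let ?d = "nc_degree P" and ?Im = "evl gens ` carrier FA"
  have zero: "0 \<in> ?Im" using h.hom_zero FA.zero_closed by (metis imageI univ_ring_simps(4))
  have plus: "x + y \<in> ?Im" if "x \<in> ?Im" "y \<in> ?Im" for x y
  proof -
    obtain a where a: "x = evl gens a" "a \<in> carrier FA" using \<open>x \<in> ?Im\<close> by (rule imageE)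
    obtain b where b: "y = evl gens b" "b \<in> carrier FA" using \<open>y \<in> ?Im\<close> by (rule imageE)
    have "x + y = evl gens (a \<oplus>\<^bsub>FA\<^esub> b)" using a b h.hom_add by simp
    then show ?thesis using a(2) b(2) by (simp only: imageI FA.add.m_closed)
  qed
  have mlin: "(\<Sum>p\<in>permutations_of_set {..<?d}. of_int (P (map ((!) w0) p)) * prod_list (map y p)) = 0"
    if y: "\<And>p. p < ?d \<Longrightarrow> y p \<in> ?Im" for y
    by (rule polarization[where Im = ?Im, OF zero plus fin len id y])
  have top: "P (map ((!) w0) [0..<?d]) = 1" using w0 map_nth[of w0] by simp
  show ?thesis by (rule multilinear_identity_degree[OF m mlin top])
qed

theorem single_parameter_quantum_matrices_PI:
  assumes m: "odd m"
  defines "R \<equiv> single_parameter_quantum_matrices n q"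
  shows "prime_ring R" "PI_ring R" "PI_degree R = N"
proof -
  interpret h: ring_hom_ring FA univ_ring "evl gens" by (rule evl_gens_hom)
  have R: "R = FA Quot (a_kernel FA univ_ring (evl gens))"
    unfolding R_def single_parameter_quantum_matrices_def quantum_matrices_def Let_def
      kernel_qideal qideal_def by (rule refl)
  \<comment> \<open>The map induced on the quotient: evaluation is constant on each coset.\<close>
  define \<phi> where "\<phi> X = the_elem (evl gens ` X)" for X
  have ring_R: "ring R" unfolding R by (rule ideal.quotient_is_ring[OF h.kernel_is_ideal])
  have hom: "\<phi> \<in> Ring.ring_hom R univ_ring" unfolding R \<phi>_def by (rule h.the_elem_hom)
  have image: "\<phi> ` carrier R = evl gens ` carrier FA" unfolding R \<phi>_def by (rule h.the_elem_surj)
  have inj: "inj_on \<phi> (carrier R)" unfolding R \<phi>_def by (rule inj_onI) (rule h.the_elem_inj)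
  interpret e: univ_ring_embedding R \<phi>
    by (intro univ_ring_embedding.intro ring_hom_ringI2 ring_R ring_univ_ring hom inj)
  \<comment> \<open>The product of two invertible leading parts is invertible, so it is not the
    leading part of 0.\<close>
  have domain: "x = 0 \<or> y = 0" if xy: "x \<in> \<phi> ` carrier R" "y \<in> \<phi> ` carrier R" "x * y = 0" for x y
  proof (rule ccontr)
    assume nz: "\<not> (x = 0 \<or> y = 0)"
    obtain f g where fg: "f \<in> carrier FA" "g \<in> carrier FA" "x = evl gens f" "y = evl gens g"
      using xy(1,2) unfolding image by blast
    then have "f \<notin> qideal" "g \<notin> qideal" using nz qideal_sub_kernel by blast+
    then obtain a s b t where "lead x a s" "invertible_lop s" "lead y b t" "invertible_lop t"
      using lead_nonideal fg by metis
    then have "lead (x * y) (a + b) (s * t)" "invertible_lop (s * t)"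
      by (simp_all add: lead_mult invertible_lop_mult)
    then show False using lead_zeroD invertible_lop_nonzero xy(3) by fastforce
  qed
  show "prime_ring R" by (rule e.prime_ringI[OF domain])
  have std: "monic_polynomial_identity R std_poly"
    unfolding e.monic_polynomial_identity_iff image
    using std_poly_carrier nc_monic_std_poly std_poly_identity by blast
  then show "PI_ring R" unfolding PI_ring_def using ring_R by blast
  have "PI_minimal_degree R = 2 * N"
    unfolding PI_minimal_degree_def
  proof (rule Least_equality)
    show "\<exists>f. monic_polynomial_identity R f \<and> nc_degree f = 2 * N"
      using std nc_degree_std_poly by blast
    fix d assume "\<exists>f. monic_polynomial_identity R f \<and> nc_degree f = d"
    then obtain f where f: "monic_polynomial_identity R f" "nc_degree f = d" by blast
    then show "2 * N \<le> d"
      unfolding e.monic_polynomial_identity_iff image using polynomial_identity_degree[OF m, of f] by simp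
  qed
  then show "PI_degree R = N" unfolding PI_degree_def by simp
qed

end

theorem mainTheorem10:
  fixes q :: "'k::field" and n m :: nat
  assumes "n \<ge> 1"
    and "q \<noteq> 0"
    and "primitive_root_of_unity m q"
    and "odd m"
  shows "prime_ring (single_parameter_quantum_matrices n q)
    \<and> PI_ring (single_parameter_quantum_matrices n q)
    \<and> PI_degree (single_parameter_quantum_matrices n q) = m ^ (n * (n - 1) div 2)"
proof -
  interpret root_torus n q m by unfold_locales (use assms in auto)
  show ?thesis
    using single_parameter_quantum_matrices_PI[OF assms(4)] by (simp add: N_def card_Pos)
qed

end
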